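(* Let $R$ be a finite valuation ring with residue field of odd size $q$ and with uniformizer of nilpotency degree $\ell$. For $n\geq 2$, \[ \mathrm{iso}(\mathrm{Um}(R^n))=\tfrac12 q^{(n-1)\ell}\big(1-q^{-(n-1)/2}\big)\ \text{ if } n\text{ is odd},\qquad \tfrac12 q^{(n-1)\ell}\big(1-q^{-n/2}\big)\geq \mathrm{iso}(\mathrm{Um}(R^n))\geq \tfrac12 q^{(n-1)\ell}\big(1-q^{-(n-1)/2}\big)\ \text{ if } n\text{ is even}. \] For $n\geq 3$, \[ \mathrm{iso}(\mathrm{Um}_0(R^n))\geq \tfrac12 q^{(n-2)(\ell-1)}\Big(\tfrac{q^{n-1}-1}{q-1}-q^{n/2-1}\Big)\ \text{ if } n\text{ is odd},\qquad \mathrm{iso}(\mathrm{Um}_0(R^n))= \tfrac12 q^{(n-2)(\ell-1)}\Big(\tfrac{q^{n-1}-1}{q-1}-q^{n/2-1}\Big)\ \text{ if } n\text{ is even}. \]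
   Context: Rings are commutative with identity. A finite valuation ring is a finite local principal ring; its maximal ideal is $(\pi)$, $q=|R/(\pi)|$, and $\ell$ is the smallest positive integer with $\pi^\ell=0$. $R^{n,u}$ is the set of $n$-tuples whose entries generate $R$ as an ideal; $R^\times$ is the unit group. Dot product: $a\cdot b=\sum_i a_ib_i$. $\mathrm{Um}(R^n)$ ($n\geq2$) is the bipartite graph on two copies $\{a_\bullet\},\{b_\circ\}$ of $R^{n,u}$ with $a_\bullet\sim b_\circ$ iff $a\cdot b=1$; $\mathrm{Um}_0(R^n)$ ($n\geq3$) is the bipartite graph on two copies of $R^{n,u}/R^\times$ with $[a]_\bullet\sim[b]_\circ$ iff $a\cdot b=0$. For a connected graph $X$, $\mathrm{iso}(X)=\min e(U,W)/\min\{|U|,|W|\}$ over all partitions of the vertex set into two non-empty sets $U,W$, where $e(U,W)$ counts edges between $U$ and $W$. *)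

theory Defs
  imports "HOL-Algebra.Algebraic_Closure_Type" "Jordan_Normal_Form.Matrix"
begin

text \<open>
  A ring is given by a type of class \<^class>\<open>comm_ring_1\<close>. Ideals and quotients are those of
  HOL-Algebra, applied to \<^const>\<open>ring_of_type_algebra\<close>, the ring structure whose carrier is the
  whole type.
\<close>

definition finite_valuation_ring :: "'a::{comm_ring_1,finite} itself \<Rightarrow> bool" where
  "finite_valuation_ring _ \<longleftrightarrow>
     (\<exists>!M. maximalideal M (ring_of_type_algebra :: 'a ring)) \<and>
     (\<forall>I. ideal I (ring_of_type_algebra :: 'a ring) \<longrightarrow>
          principalideal I (ring_of_type_algebra :: 'a ring))"

definition uniformizer :: "'a::comm_ring_1 \<Rightarrow> bool" where
  "uniformizer p \<longleftrightarrow> maximalideal (Idl\<^bsub>ring_of_type_algebra\<^esub> {p}) ring_of_type_algebra"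

definition residue_size :: "'a::comm_ring_1 \<Rightarrow> nat" where
  "residue_size p = card (carrier (ring_of_type_algebra Quot (Idl\<^bsub>ring_of_type_algebra\<^esub> {p})))"

definition nilpotency_degree :: "'a::comm_ring_1 \<Rightarrow> nat" where
  "nilpotency_degree p = (LEAST k. 0 < k \<and> p ^ k = 0)"

definition unimodular :: "nat \<Rightarrow> 'a::comm_ring_1 vec set" where
  "unimodular n = {a \<in> carrier_vec n. Idl\<^bsub>ring_of_type_algebra\<^esub> (vec_set a) = UNIV}"

definition unit_rel :: "nat \<Rightarrow> ('a::comm_ring_1 vec \<times> 'a vec) set" where
  "unit_rel n = {(a, b). a \<in> unimodular n \<and> b \<in> unimodular n \<and> (\<exists>u. u dvd 1 \<and> b = u \<cdot>\<^sub>v a)}"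

text \<open>A simple graph is a pair of a vertex set and a set of two-element sets of vertices.\<close>

type_synonym 'v ugraph = "'v set \<times> 'v set set"

definition edges_between :: "'v ugraph \<Rightarrow> 'v set \<Rightarrow> 'v set \<Rightarrow> nat" where
  "edges_between G U W = card {e \<in> snd G. \<exists>u\<in>U. \<exists>w\<in>W. e = {u, w}}"

text \<open>
  The minimum ranges over a finite set whenever the graph is finite, and over a non-empty one as
  soon as there are at least two vertices.
\<close>

definition iso_const :: "'v ugraph \<Rightarrow> real" where
  "iso_const G = Min {real (edges_between G U W) / real (min (card U) (card W)) | U W.
     U \<union> W = fst G \<and> U \<inter> W = {} \<and> U \<noteq> {} \<and> W \<noteq> {}}"

text \<open>The constructors \<^const>\<open>Inl\<close> and \<^const>\<open>Inr\<close> mark the two copies of the vertex set.\<close>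

definition Um :: "nat \<Rightarrow> ('a::comm_ring_1 vec + 'a vec) ugraph" where
  "Um n = (unimodular n <+> unimodular n,
           {{Inl a, Inr b} | a b. a \<in> unimodular n \<and> b \<in> unimodular n \<and> a \<bullet> b = 1})"

definition Um0 :: "nat \<Rightarrow> ('a::comm_ring_1 vec set + 'a vec set) ugraph" where
  "Um0 n = ((unimodular n // unit_rel n) <+> (unimodular n // unit_rel n),
            {{Inl (unit_rel n `` {a}), Inr (unit_rel n `` {b})} | a b.
               a \<in> unimodular n \<and> b \<in> unimodular n \<and> a \<bullet> b = 0})"

lemma unit_rel_scalar_prod:
  assumes "(a, a') \<in> unit_rel n" "(b, b') \<in> unit_rel n"
  shows "a \<bullet> b = 0 \<longleftrightarrow> a' \<bullet> b' = 0"
proof -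
  from assms obtain u v where u: "u dvd 1" "a' = u \<cdot>\<^sub>v a" and v: "v dvd 1" "b' = v \<cdot>\<^sub>v b"
    and dims: "dim_vec a = n" "dim_vec b = n"
    by (auto simp: unit_rel_def unimodular_def)
  then have eq: "a' \<bullet> b' = (u * v) * (a \<bullet> b)"
    by (simp add: ac_simps)
  from u(1) v(1) obtain s t where "1 = u * s" "1 = v * t"
    by (auto elim!: dvdE)
  then have "(s * t) * (u * v) = 1"
    by (metis mult.commute mult.left_commute mult.right_neutral)
  with eq have "a \<bullet> b = (s * t) * (a' \<bullet> b')"
    by (metis mult.assoc mult.left_neutral)
  with eq show ?thesis
    by auto
qed

end

theory Submission
  imports Defs "HOL-Number_Theory.Residues" "HOL-Library.Cardinality" "HOL-Library.Product_Plus"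
begin

text \<open>
  Both graphs are regular and bipartite, so a lower bound on the isoperimetric constant follows from a
  bound on the second singular value of the biadjacency matrix. The number of common neighbours of
  two vertices is constant unless the two vectors are proportional modulo the maximal ideal.
  Subtracting that constant leaves, up to a negative semidefinite term, a nonnegative matrix with
  constant row sums, and the row sum is the square of the second singular value.

  For the upper bounds one needs a cut whose sign function is an eigenvector. The residue field
  \<open>F\<close> has an extension \<open>K\<close> of degree \<open>n\<close>. Identify \<open>F\<^sup>n\<close> with \<open>K\<close>, and the dot product with the trace
  form. The quadratic character of \<open>K\<close> then has neighbourhood sums of constant absolute value, because
  multiplication by a field element moves the hyperplanes around. For odd \<open>n\<close> it restricts to the
  quadratic character of \<open>F\<close> and is an eigenvector for \<open>a \<bullet> b = 1\<close>; for even \<open>n\<close> it is trivial on \<open>F\<close> and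
  lives on the projective graph \<open>a \<bullet> b = 0\<close>.
\<close>

section \<open>Isoperimetric constants of regular bipartite graphs\<close>

text \<open>No Gauss sum is evaluated. The estimates behind the bound on the second singular value
  are equalities for a function that is constant on the support of the nonnegative matrix and, where
  the negative term is present, has sum 0 on each proportionality class. In the right parity the
  character has these properties, so the size of its neighbourhood sums is forced by the very count
  that gives the lower bound. If \<open>n\<close> is even, the character is constant on the unit
  multiples of a vector and cannot kill the negative term for \<open>a \<bullet> b = 1\<close>; a
  character in dimension \<open>n - 1\<close> replaces it, at the price of a gap between the two
  bounds. If \<open>n\<close> is odd, the character is not invariant under scaling by units and does
  not descend to the projective graph, where only the lower bound remains. Passing from
  \<open>F\<close> to the ring costs only constant factors: a solution over \<open>F\<close> of one
  equation with unimodular coefficients always lifts to equally many solutions over the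
  ring.\<close>

definition bipartite_graph :: "'v set \<Rightarrow> ('v \<Rightarrow> 'v \<Rightarrow> bool) \<Rightarrow> ('v + 'v) ugraph" where
  "bipartite_graph V P = (V <+> V, {{Inl a, Inr b} | a b. a \<in> V \<and> b \<in> V \<and> P a b})"

text \<open>The tags make \<open>(a, b) \<mapsto> {Inl a, Inr b}\<close> injective, so edges can be
  counted as pairs. As \<open>W\<close> is the complement of \<open>U\<close>, an edge is cut
  exactly when one of its ends lies in \<open>U\<close> and the other does not.\<close>

lemma edges_between_bipartite_graph:
  assumes UW: "U \<union> W = V <+> V" "U \<inter> W = {}"
  shows "edges_between (bipartite_graph V P) U W =
    card {(a, b) \<in> V \<times> V. P a b \<and> (Inl a \<in> U) \<noteq> (Inr b \<in> U)}"
proof -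
  let ?S = "{(a, b) \<in> V \<times> V. P a b \<and> (Inl a \<in> U) \<noteq> (Inr b \<in> U)}"
  let ?h = "\<lambda>(a, b). {Inl a, Inr b}"
  have W: "W = (V <+> V) - U" using UW by auto
  have "{e \<in> snd (bipartite_graph V P). \<exists>u\<in>U. \<exists>w\<in>W. e = {u, w}} = ?h ` ?S"
  proof (intro equalityI subsetI)
    fix e assume "e \<in> {e \<in> snd (bipartite_graph V P). \<exists>u\<in>U. \<exists>w\<in>W. e = {u, w}}"
    then obtain a b u w where *: "e = {Inl a, Inr b}" "a \<in> V" "b \<in> V" "P a b"
        "u \<in> U" "w \<in> W" "e = {u, w}"
      by (auto simp: bipartite_graph_def)
    hence "(u = Inl a \<and> w = Inr b) \<or> (u = Inr b \<and> w = Inl a)" by (auto simp: doubleton_eq_iff)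
    hence "(a, b) \<in> ?S" using * W by auto
    thus "e \<in> ?h ` ?S" using *(1) by (intro image_eqI[of _ _ "(a, b)"]) auto
  next
    fix e assume "e \<in> ?h ` ?S"
    then obtain a b where *: "e = {Inl a, Inr b}" "a \<in> V" "b \<in> V" "P a b"
       "(Inl a \<in> U) \<noteq> (Inr b \<in> U)" by auto
    have "\<exists>u\<in>U. \<exists>w\<in>W. e = {u, w}"
    proof (cases "Inl a \<in> U")
      case True thus ?thesis using * W by blast
    next
      case False
      hence "Inr b \<in> U" "Inl a \<in> W" using * W by auto
      thus ?thesis using *(1) by (metis insert_commute)
    qed
    thus "e \<in> {e \<in> snd (bipartite_graph V P). \<exists>u\<in>U. \<exists>w\<in>W. e = {u, w}}"
      using * by (auto simp: bipartite_graph_def)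
  qed
  moreover have "inj_on ?h ?S" by (auto simp: inj_on_def doubleton_eq_iff)
  ultimately show ?thesis unfolding edges_between_def by (simp add: card_image)
qed

abbreviation nbr_sum :: "'v set \<Rightarrow> ('v \<Rightarrow> 'v \<Rightarrow> bool) \<Rightarrow> ('v \<Rightarrow> real) \<Rightarrow> 'v \<Rightarrow> real" where
  "nbr_sum V P f b \<equiv> \<Sum>a | a \<in> V \<and> P a b. f a"

definition biadj_form :: "'v set \<Rightarrow> ('v \<Rightarrow> 'v \<Rightarrow> bool) \<Rightarrow> ('v \<Rightarrow> real) \<Rightarrow> ('v \<Rightarrow> real) \<Rightarrow> real" where
  "biadj_form V P f g = (\<Sum>b\<in>V. (nbr_sum V P f b) * g b)"

lemma biadj_form_altdef:
  assumes "finite V"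
  shows "biadj_form V P f g = (\<Sum>a\<in>V. \<Sum>b\<in>V. of_bool (P a b) * (f a * g b))"
proof -
  have "biadj_form V P f g = (\<Sum>b\<in>V. \<Sum>a\<in>V. of_bool (P a b) * (f a * g b))"
    unfolding biadj_form_def sum_distrib_right using assms
    by (intro sum.cong refl sum.mono_neutral_cong_left) auto
  also have "\<dots> = (\<Sum>a\<in>V. \<Sum>b\<in>V. of_bool (P a b) * (f a * g b))" by (rule sum.swap)
  finally show ?thesis .
qed

lemma regular_sum_left:
  assumes "finite V" "\<And>a. a \<in> V \<Longrightarrow> card {b \<in> V. P a b} = D"
  shows "(\<Sum>a\<in>V. \<Sum>b\<in>V. of_bool (P a b) * f a) = real D * (\<Sum>a\<in>V. f a :: real)"
proof -
  have "(\<Sum>b\<in>V. of_bool (P a b) * f a) = real D * f a" if "a \<in> V" for a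
  proof -
    have "(\<Sum>b\<in>V. of_bool (P a b) * f a) = (\<Sum>b | b \<in> V \<and> P a b. f a)"
      using assms(1) by (intro sum.mono_neutral_cong_right) auto
    thus ?thesis using assms(2)[OF that] by simp
  qed
  thus ?thesis by (simp add: sum_distrib_left)
qed

lemma card_eq_real_sum:
  assumes "finite V"
  shows "real (card {(a, b) \<in> V \<times> V. Q a b}) = (\<Sum>a\<in>V. \<Sum>b\<in>V. of_bool (Q a b))"
proof -
  have "real (card {(a, b) \<in> V \<times> V. Q a b}) = (\<Sum>x \<in> {(a, b) \<in> V \<times> V. Q a b}. 1)" by simp
  also have "\<dots> = (\<Sum>x \<in> V \<times> V. of_bool (Q (fst x) (snd x)))"
    using assms by (intro sum.mono_neutral_cong_left) auto
  also have "\<dots> = (\<Sum>a\<in>V. \<Sum>b\<in>V. of_bool (Q a b))"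
    by (simp add: sum.cartesian_product case_prod_unfold)
  finally show ?thesis .
qed

abbreviation cut_ratio :: "'v ugraph \<Rightarrow> 'v set \<Rightarrow> 'v set \<Rightarrow> real" where
  "cut_ratio G U W \<equiv> real (edges_between G U W) / real (min (card U) (card W))"

locale regular_bipartite =
  fixes V :: "'v set" and P :: "'v \<Rightarrow> 'v \<Rightarrow> bool" and D :: nat
  assumes finite_V: "finite V" and V_nonempty: "V \<noteq> {}"
    and left_degree: "\<And>a. a \<in> V \<Longrightarrow> card {b \<in> V. P a b} = D"
    and right_degree: "\<And>b. b \<in> V \<Longrightarrow> card {a \<in> V. P a b} = D"
begin

lemma card_V_pos: "card V > 0"
  using finite_V V_nonempty by (simp add: card_gt_0_iff)

lemma sum_left: "(\<Sum>a\<in>V. \<Sum>b\<in>V. of_bool (P a b) * f a) = real D * (\<Sum>a\<in>V. f a :: real)"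
  using regular_sum_left[of V P D] finite_V left_degree by blast

lemma sum_right: "(\<Sum>a\<in>V. \<Sum>b\<in>V. of_bool (P a b) * g b) = real D * (\<Sum>b\<in>V. g b :: real)"
  by (subst sum.swap) (use regular_sum_left[of V "\<lambda>b a. P a b" D g] finite_V right_degree in blast)

lemma biadj_form_one:
  "biadj_form V P f (\<lambda>_. c) = real D * c * (\<Sum>a\<in>V. f a)"
proof -
  have "biadj_form V P f (\<lambda>_. c) = (\<Sum>a\<in>V. \<Sum>b\<in>V. of_bool (P a b) * (f a * c))"
    by (rule biadj_form_altdef[OF finite_V])
  also have "\<dots> = real D * (\<Sum>a\<in>V. f a * c)" by (rule sum_left)
  finally show ?thesis by (simp flip: sum_distrib_right)
qed

lemma biadj_form_one_left:
  "biadj_form V P (\<lambda>_. c) g = real D * c * (\<Sum>b\<in>V. g b)"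
proof -
  have "biadj_form V P (\<lambda>_. c) g = (\<Sum>a\<in>V. \<Sum>b\<in>V. of_bool (P a b) * (c * g b))"
    by (rule biadj_form_altdef[OF finite_V])
  also have "\<dots> = real D * (\<Sum>b\<in>V. c * g b)" by (rule sum_right)
  finally show ?thesis by (simp flip: sum_distrib_left)
qed

lemma cut_set_props:
  defines "S \<equiv> {cut_ratio (bipartite_graph V P) U W | U W.
     U \<union> W = fst (bipartite_graph V P) \<and> U \<inter> W = {} \<and> U \<noteq> {} \<and> W \<noteq> {}}"
  shows "finite S" "S \<noteq> {}"
proof -
  let ?V = "V <+> V"
  have "finite ?V" using finite_V by simp
  have "S \<subseteq> (\<lambda>(U, W). cut_ratio (bipartite_graph V P) U W)
      ` (Pow ?V \<times> Pow ?V)"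
  proof
    fix s assume "s \<in> S"
    then obtain U W where "s = cut_ratio (bipartite_graph V P) U W"
      "U \<union> W = ?V" unfolding S_def bipartite_graph_def by auto
    thus "s \<in> (\<lambda>(U, W). cut_ratio (bipartite_graph V P) U W)
      ` (Pow ?V \<times> Pow ?V)" by (intro image_eqI[of _ _ "(U, W)"]) auto
  qed
  thus "finite S" using \<open>finite ?V\<close> by (meson finite_Pow_iff finite_SigmaI finite_imageI finite_subset)
  have "Inl ` V \<union> Inr ` V = fst (bipartite_graph V P) \<and> Inl ` V \<inter> Inr ` V = {} \<and>
     Inl ` V \<noteq> {} \<and> Inr ` V \<noteq> {}"
    using V_nonempty by (auto simp: bipartite_graph_def)
  thus "S \<noteq> {}" unfolding S_def by blast
qed

text \<open>With \<open>f\<close>, \<open>g\<close> the indicators of the two halves of one side of a cut, the hypothesis bounds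
  the deviation of the number of inner edges from its expected value; Cheeger's easy inequality
  then follows by completing a square.\<close>

lemma iso_const_ge:
  assumes lam: "lam > 0" "lam \<le> real D"
    and spec: "\<And>f. (\<Sum>a\<in>V. f a) = 0 \<Longrightarrow>
      (\<Sum>b\<in>V. (nbr_sum V P f b)\<^sup>2) \<le> lam\<^sup>2 * (\<Sum>a\<in>V. (f a)\<^sup>2 :: real)"
  shows "iso_const (bipartite_graph V P) \<ge> (real D - lam) / 2"
  unfolding iso_const_def
proof (rule Min.boundedI[OF cut_set_props], clarify)
  fix U W
  assume UW: "U \<union> W = fst (bipartite_graph V P)" "U \<inter> W = {}" "U \<noteq> {}" "W \<noteq> {}"
  define N where "N = real (card V)"
  have N: "N > 0" using card_V_pos by (simp add: N_def)
  have UW': "U \<union> W = V <+> V" using UW by (simp add: bipartite_graph_def)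
  define f :: "'v \<Rightarrow> real" where "f = (\<lambda>a. of_bool (Inl a \<in> U))"
  define g :: "'v \<Rightarrow> real" where "g = (\<lambda>b. of_bool (Inr b \<in> U))"
  define F where "F = (\<Sum>a\<in>V. f a)"
  define G where "G = (\<Sum>b\<in>V. g b)"
  have fin: "finite U" "finite W"
    using UW' finite_V by (metis finite_Plus finite_Un)+
  have cU: "real (card U) = F + G"
  proof -
    have "U = Inl ` {a \<in> V. Inl a \<in> U} \<union> Inr ` {b \<in> V. Inr b \<in> U}" using UW' by auto
    hence "card U = card (Inl ` {a \<in> V. Inl a \<in> U} \<union> Inr ` {b \<in> V. Inr b \<in> U} :: ('v + 'v) set)" by simp
    also have "\<dots> = card {a \<in> V. Inl a \<in> U} + card {b \<in> V. Inr b \<in> U}"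
      by (subst card_Un_disjoint) (use finite_V in \<open>auto simp: card_image\<close>)
    finally have *: "card U = card {a \<in> V. Inl a \<in> U} + card {b \<in> V. Inr b \<in> U}" .
    have "F = real (card {a \<in> V. Inl a \<in> U})" "G = real (card {b \<in> V. Inr b \<in> U})"
      unfolding F_def G_def f_def g_def using finite_V by (simp_all add: Int_def)
    thus ?thesis using * by simp
  qed
  have "card U + card W = card (V <+> V)"
    using fin UW' UW(2) by (metis card_Un_disjoint)
  hence cUW: "real (card U) + real (card W) = 2 * N" unfolding N_def using finite_V
    by (simp add: card_Plus flip: of_nat_add)
  have sq: "(f a)\<^sup>2 = f a" "(g a)\<^sup>2 = g a" for a by (auto simp: f_def g_def)
  define e where "e = real (edges_between (bipartite_graph V P) U W)"
  have "e = (\<Sum>a\<in>V. \<Sum>b\<in>V. of_bool (P a b \<and> (Inl a \<in> U) \<noteq> (Inr b \<in> U)))"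
    unfolding e_def edges_between_bipartite_graph[OF UW' UW(2)] by (rule card_eq_real_sum[OF finite_V])
  also have "\<dots> = (\<Sum>a\<in>V. \<Sum>b\<in>V. of_bool (P a b) * f a + of_bool (P a b) * g b
      - 2 * (of_bool (P a b) * (f a * g b)))"
    by (intro sum.cong refl) (auto simp: f_def g_def)
  also have "\<dots> = D * F + D * G - 2 * biadj_form V P f g"
    unfolding biadj_form_altdef[OF finite_V] F_def G_def
    by (simp only: sum.distrib sum_subtractf sum_distrib_left[symmetric] sum_left sum_right)
  finally have e: "e = D * F + D * G - 2 * biadj_form V P f g" .
  \<comment> \<open>The hypothesis \<open>spec\<close> covers only functions of sum 0. Centring both
    indicators splits off the constant parts, which contribute exactly
    \<open>D * F * G / N\<close>.\<close>
  define f0 where "f0 = (\<lambda>a. f a - F / N)"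
  define g0 where "g0 = (\<lambda>a. g a - G / N)"
  define w where "w = (\<lambda>b. \<Sum>a | a \<in> V \<and> P a b. f0 a)"
  have f0: "(\<Sum>a\<in>V. f0 a) = 0" "(\<Sum>a\<in>V. g0 a) = 0"
    using N unfolding f0_def g0_def by (simp_all add: sum_subtractf F_def G_def N_def)
  have f0sq: "(\<Sum>a\<in>V. (f0 a)\<^sup>2) = F - F\<^sup>2 / N" "(\<Sum>a\<in>V. (g0 a)\<^sup>2) = G - G\<^sup>2 / N"
  proof -
    have *: "(\<Sum>a\<in>V. (h a - t)\<^sup>2) = (\<Sum>a\<in>V. (h a)\<^sup>2) - 2 * (\<Sum>a\<in>V. h a) * t + N * t\<^sup>2"
      for h :: "'v \<Rightarrow> real" and t
      unfolding power2_diff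
      by (simp only: sum.distrib sum_subtractf sum_distrib_left[symmetric] sum_distrib_right[symmetric])
         (simp add: N_def)
    show "(\<Sum>a\<in>V. (f0 a)\<^sup>2) = F - F\<^sup>2 / N" "(\<Sum>a\<in>V. (g0 a)\<^sup>2) = G - G\<^sup>2 / N"
      unfolding f0_def g0_def * sq F_def[symmetric] G_def[symmetric]
      using N by (simp_all add: field_simps power2_eq_square)
  qed
  have "biadj_form V P f g = biadj_form V P f0 g0 + biadj_form V P (\<lambda>_. F/N) g + biadj_form V P f0 (\<lambda>_. G / N)"
    unfolding biadj_form_altdef[OF finite_V] f0_def g0_def
    by (simp add: sum.distrib[symmetric] algebra_simps)
  also have "\<dots> = (\<Sum>b\<in>V. w b * g0 b) + D * F * G / N"
    unfolding biadj_form_one_left biadj_form_one f0 G_def[symmetric]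
    by (simp add: biadj_form_def w_def)
  finally have form: "biadj_form V P f g = (\<Sum>b\<in>V. w b * g0 b) + D * F * G / N" .
  have "2 * lam * (\<Sum>b\<in>V. w b * g0 b) = (\<Sum>b\<in>V. 2 * lam * (w b * g0 b))" by (simp add: sum_distrib_left)
  also have "\<dots> \<le> (\<Sum>b\<in>V. (w b)\<^sup>2 + lam\<^sup>2 * (g0 b)\<^sup>2)"
  proof (intro sum_mono)
    fix b show "2 * lam * (w b * g0 b) \<le> (w b)\<^sup>2 + lam\<^sup>2 * (g0 b)\<^sup>2"
      using zero_le_power2[of "w b - lam * g0 b"] by (simp add: power2_diff power_mult_distrib mult_ac)
  qed
  also have "\<dots> = (\<Sum>b\<in>V. (w b)\<^sup>2) + lam\<^sup>2 * (G - G\<^sup>2 / N)"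
    by (simp add: sum.distrib sum_distrib_left[symmetric] f0sq)
  also have "\<dots> \<le> lam\<^sup>2 * (F - F\<^sup>2 / N) + lam\<^sup>2 * (G - G\<^sup>2 / N)"
    using spec[OF f0(1)] unfolding w_def f0sq by simp
  finally have "lam * (2 * (\<Sum>b\<in>V. w b * g0 b)) \<le> lam * (lam * (F - F\<^sup>2 / N + (G - G\<^sup>2 / N)))"
    by (simp add: power2_eq_square algebra_simps)
  hence wg: "2 * (\<Sum>b\<in>V. w b * g0 b) \<le> lam * (F - F\<^sup>2 / N + (G - G\<^sup>2 / N))"
    using lam(1) by simp
  have "e \<ge> D * F + D * G - 2 * (D * F * G / N) - lam * (F - F\<^sup>2 / N + (G - G\<^sup>2 / N))"
    using e form wg by linarith
  \<comment> \<open>The surplus over the desired bound is a square: an uneven distribution of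
    \<open>U\<close> over the two copies can only add edges.\<close>
  moreover have "D * F + D * G - 2 * (D * F * G / N) - lam * (F - F\<^sup>2 / N + (G - G\<^sup>2 / N))
     - (D - lam) * ((F + G) * (2 * N - (F + G)) / (2 * N)) = (D + lam) * (F - G)\<^sup>2 / (2 * N)"
    using N by (simp add: field_simps power2_eq_square)
  moreover have "(D + lam) * (F - G)\<^sup>2 / (2 * N) \<ge> 0" using N lam by simp
  moreover have "y \<le> e" if "x \<le> e" "x - y = z" "0 \<le> z" for x y z using that by linarith
  ultimately have e1: "e \<ge> (D - lam) * ((F + G) * (2 * N - (F + G)) / (2 * N))" by blast
  define m where "m = real (min (card U) (card W))"
  have m: "m > 0" "m = min (F + G) (2 * N - (F + G))"
    using UW fin cU cUW by (auto simp: m_def card_gt_0_iff min_def)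
  \<comment> \<open>The right-hand side is the size of \<open>U\<close> times that of
    \<open>W\<close>; the larger of the two is at least \<open>N\<close>, since together they make
    \<open>2 * N\<close>.\<close>
  have "m * N \<le> (F + G) * (2 * N - (F + G))"
  proof (cases "F + G \<le> N")
    case True
    hence "m = F + G" using m by auto
    thus ?thesis using m True by (auto intro!: mult_left_mono)
  next
    case False
    hence "m = 2 * N - (F + G)" using m by auto
    thus ?thesis using m(1) False mult_right_mono[of N "F + G" m] by (simp add: mult.commute)
  qed
  hence "m / 2 \<le> (F + G) * (2 * N - (F + G)) / (2 * N)" using N by (simp add: field_simps)
  hence "(D - lam) * (m / 2) \<le> (D - lam) * ((F + G) * (2 * N - (F + G)) / (2 * N))"
    using lam(2) by (intro mult_left_mono) auto
  hence "(D - lam) / 2 * m \<le> e" using e1 by linarith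
  thus "(D - lam) / 2 \<le> cut_ratio (bipartite_graph V P) U W"
    using m(1) unfolding e_def[symmetric] m_def[symmetric] by (simp add: pos_le_divide_eq)
qed

text \<open>The cut collects the vertices of value 1 in either copy. By \<open>balanced\<close> both
  parts have exactly \<open>card V\<close> vertices, and an edge is cut exactly when
  \<open>f a * g b = -1\<close>.\<close>

lemma iso_const_le:
  assumes f: "\<And>a. a \<in> V \<Longrightarrow> f a \<in> {1, -1}" and g: "\<And>b. b \<in> V \<Longrightarrow> g b \<in> {1, -1 :: real}"
    and balanced: "(\<Sum>a\<in>V. f a) + (\<Sum>b\<in>V. g b) = 0"
  shows "iso_const (bipartite_graph V P) \<le> (real D - biadj_form V P f g / real (card V)) / 2"
proof -
  define N where "N = real (card V)"
  have N: "N > 0" using card_V_pos by (simp add: N_def)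
  define U where "U = Inl ` {a \<in> V. f a = 1} \<union> Inr ` {b \<in> V. g b = 1}"
  define W where "W = Inl ` {a \<in> V. f a = -1} \<union> Inr ` {b \<in> V. g b = -1}"
  have UW: "U \<union> W = V <+> V" "U \<inter> W = {}" using f g by (fastforce simp: U_def W_def)+
  have fin: "finite U" "finite W" using finite_V by (auto simp: U_def W_def)
  have ce: "real (card {a \<in> V. h a = s}) = (\<Sum>a\<in>V. (1 + s * h a) / 2)"
    if "\<And>a. a \<in> V \<Longrightarrow> h a \<in> {1, -1 :: real}" "s \<in> {1, -1}" for h :: "'v \<Rightarrow> real" and s
  proof -
    have "real (card {a \<in> V. h a = s}) = (\<Sum>a\<in>{a \<in> V. h a = s}. 1)" by simp
    also have "\<dots> = (\<Sum>a\<in>V. of_bool (h a = s))"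
      using finite_V by (intro sum.mono_neutral_cong_left) auto
    also have "\<dots> = (\<Sum>a\<in>V. (1 + s * h a) / 2)"
    proof (intro sum.cong refl)
      fix a assume "a \<in> V"
      from that(1)[OF this] that(2) show "of_bool (h a = s) = (1 + s * h a) / 2" by auto
    qed
    finally show ?thesis .
  qed
  have cU: "real (card U) = N"
  proof -
    have "card U = card {a \<in> V. f a = 1} + card {b \<in> V. g b = 1}" unfolding U_def
      by (subst card_Un_disjoint) (use finite_V in \<open>auto simp: card_image\<close>)
    hence "real (card U) = (\<Sum>a\<in>V. (1 + 1 * f a) / 2) + (\<Sum>a\<in>V. (1 + 1 * g a) / 2)"
      by (simp only: of_nat_add ce[OF f] ce[OF g] insert_iff simp_thms)
    thus ?thesis using balanced by (simp add: sum.distrib sum_divide_distrib[symmetric] N_def field_simps)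
  qed
  have cW: "real (card W) = N"
  proof -
    have "card W = card {a \<in> V. f a = -1} + card {b \<in> V. g b = -1}" unfolding W_def
      by (subst card_Un_disjoint) (use finite_V in \<open>auto simp: card_image\<close>)
    hence "real (card W) = (\<Sum>a\<in>V. (1 + (-1) * f a) / 2) + (\<Sum>a\<in>V. (1 + (-1) * g a) / 2)"
      by (simp only: of_nat_add ce[OF f] ce[OF g] insert_iff simp_thms)
    thus ?thesis using balanced by (simp add: sum_subtractf sum_divide_distrib[symmetric] N_def field_simps)
  qed
  have "real (edges_between (bipartite_graph V P) U W) =
      (\<Sum>a\<in>V. \<Sum>b\<in>V. of_bool (P a b \<and> (Inl a \<in> U) \<noteq> (Inr b \<in> U)))"
    unfolding edges_between_bipartite_graph[OF UW] by (rule card_eq_real_sum[OF finite_V])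
  also have "\<dots> = (\<Sum>a\<in>V. \<Sum>b\<in>V. (of_bool (P a b) * 1 - of_bool (P a b) * (f a * g b)) / 2)"
  proof (intro sum.cong refl)
    fix a b assume "a \<in> V" "b \<in> V"
    with f[of a] g[of b] show "of_bool (P a b \<and> (Inl a \<in> U) \<noteq> (Inr b \<in> U)) =
       (of_bool (P a b) * 1 - of_bool (P a b) * (f a * g b)) / 2"
      by (auto simp: U_def)
  qed
  also have "\<dots> = (D * N - biadj_form V P f g) / 2"
    unfolding biadj_form_altdef[OF finite_V]
    using sum_left[of "\<lambda>_. 1"]
    by (simp only: sum_subtractf sum_divide_distrib[symmetric]) (simp add: N_def)
  finally have e: "real (edges_between (bipartite_graph V P) U W) = (D * N - biadj_form V P f g) / 2" .
  have "iso_const (bipartite_graph V P) \<le>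
      cut_ratio (bipartite_graph V P) U W"
    unfolding iso_const_def
  proof (rule Min_le[OF cut_set_props(1)])
    have "U \<noteq> {}" "W \<noteq> {}" using cU cW N by auto
    thus "cut_ratio (bipartite_graph V P) U W \<in>
      {cut_ratio (bipartite_graph V P) U W | U W.
     U \<union> W = fst (bipartite_graph V P) \<and> U \<inter> W = {} \<and> U \<noteq> {} \<and> W \<noteq> {}}"
      using UW by (auto simp: bipartite_graph_def)
  qed
  also have "real (min (card U) (card W)) = N" using cU cW by (simp add: min_def)
  also have "real (edges_between (bipartite_graph V P) U W) / N = (D - biadj_form V P f g / N) / 2"
    using N unfolding e by (simp add: field_simps)
  finally show ?thesis unfolding N_def .
qed

end

section \<open>Codegrees and the second singular value\<close>

lemma sum_squares_biadj:
  fixes f :: "'v \<Rightarrow> real"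
  assumes "finite V"
  shows "(\<Sum>b\<in>V. (nbr_sum V P f b)\<^sup>2) =
    (\<Sum>a\<in>V. \<Sum>a'\<in>V. real (card {b \<in> V. P a b \<and> P a' b}) * (f a * f a'))"
proof -
  have "(\<Sum>b\<in>V. (nbr_sum V P f b)\<^sup>2) =
    (\<Sum>b\<in>V. (\<Sum>a\<in>V. of_bool (P a b) * f a)\<^sup>2)"
    using assms by (intro sum.cong refl arg_cong[of _ _ "\<lambda>x. x\<^sup>2"] sum.mono_neutral_cong_left) auto
  also have "\<dots> = (\<Sum>b\<in>V. \<Sum>a\<in>V. \<Sum>a'\<in>V. of_bool (P a b \<and> P a' b) * (f a * f a'))"
    unfolding power2_eq_square sum_product by (intro sum.cong refl) auto
  also have "\<dots> = (\<Sum>a\<in>V. \<Sum>b\<in>V. \<Sum>a'\<in>V. of_bool (P a b \<and> P a' b) * (f a * f a'))"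
    by (rule sum.swap)
  also have "\<dots> = (\<Sum>a\<in>V. \<Sum>a'\<in>V. \<Sum>b\<in>V. of_bool (P a b \<and> P a' b) * (f a * f a'))"
    by (rule sum.cong[OF refl], rule sum.swap)
  also have "\<dots> = (\<Sum>a\<in>V. \<Sum>a'\<in>V. real (card {b \<in> V. P a b \<and> P a' b}) * (f a * f a'))"
    using assms by (simp add: sum_distrib_right[symmetric] Int_def)
  finally show ?thesis .
qed

text \<open>The form is the sum, over all classes, of the squared class sums of
  \<open>f\<close>.\<close>

lemma equivalence_form_nonneg:
  fixes f :: "'v \<Rightarrow> real" and cls :: "'v \<Rightarrow> 'c"
  assumes "finite V"
  shows "(\<Sum>a\<in>V. \<Sum>a'\<in>V. of_bool (cls a = cls a') * (f a * f a')) \<ge> 0"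
proof -
  have "(\<Sum>a\<in>V. \<Sum>a'\<in>V. of_bool (cls a = cls a') * (f a * f a')) =
    (\<Sum>a\<in>V. \<Sum>a'\<in>V. \<Sum>y\<in>cls ` V. (of_bool (cls a = y) * f a) * (of_bool (cls a' = y) * f a'))"
  proof (intro sum.cong refl)
    fix a a' assume "a \<in> V" "a' \<in> V"
    have "(\<Sum>y\<in>cls ` V. (of_bool (cls a = y) * f a) * (of_bool (cls a' = y) * f a')) =
      (\<Sum>y\<in>cls ` V. if y = cls a then of_bool (cls a = cls a') * (f a * f a') else 0)"
      by (intro sum.cong refl) auto
    thus "of_bool (cls a = cls a') * (f a * f a') =
       (\<Sum>y\<in>cls ` V. (of_bool (cls a = y) * f a) * (of_bool (cls a' = y) * f a'))"
      using \<open>a \<in> V\<close> assms by simp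
  qed
  also have "\<dots> = (\<Sum>a\<in>V. \<Sum>y\<in>cls ` V. \<Sum>a'\<in>V. (of_bool (cls a = y) * f a) * (of_bool (cls a' = y) * f a'))"
    by (rule sum.cong[OF refl], rule sum.swap)
  also have "\<dots> = (\<Sum>y\<in>cls ` V. \<Sum>a\<in>V. \<Sum>a'\<in>V. (of_bool (cls a = y) * f a) * (of_bool (cls a' = y) * f a'))"
    by (rule sum.swap)
  also have "\<dots> = (\<Sum>y\<in>cls ` V. (\<Sum>a\<in>V. of_bool (cls a = y) * f a)\<^sup>2)"
    by (simp add: power2_eq_square sum_product)
  finally show ?thesis by (simp add: sum_nonneg)
qed

text \<open>The codegree matrix of the graph is split into a multiple of the all-ones matrix, a negative
  semidefinite part, and a nonnegative matrix \<open>B\<close> with constant row sums, whose norm is the row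
  sum.\<close>

locale codegree_decomposition =
  fixes V :: "'v set" and P :: "'v \<Rightarrow> 'v \<Rightarrow> bool" and cls :: "'v \<Rightarrow> 'c"
    and B :: "'v \<Rightarrow> 'v \<Rightarrow> real" and c c0 rho :: real
  assumes fin: "finite V"
    and codegree: "\<And>a a'. a \<in> V \<Longrightarrow> a' \<in> V \<Longrightarrow>
      real (card {b \<in> V. P a b \<and> P a' b}) = c - c0 * of_bool (cls a = cls a') + B a a'"
    and c0: "c0 \<ge> 0"
    and B_nonneg: "\<And>a a'. a \<in> V \<Longrightarrow> a' \<in> V \<Longrightarrow> B a a' \<ge> 0"
    and B_row: "\<And>a. a \<in> V \<Longrightarrow> (\<Sum>a'\<in>V. B a a') = rho"
begin

text \<open>Symmetry is inherited from the codegree and from equality of classes.\<close>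

lemma B_sym: "a \<in> V \<Longrightarrow> a' \<in> V \<Longrightarrow> B a a' = B a' a"
  using codegree[of a a'] codegree[of a' a] by (simp add: conj_commute eq_commute)

lemma sum_squares_eq:
  assumes "(\<Sum>a\<in>V. f a) = 0"
  shows "(\<Sum>b\<in>V. (nbr_sum V P f b)\<^sup>2) =
    (\<Sum>a\<in>V. \<Sum>a'\<in>V. B a a' * (f a * f a'))
    - c0 * (\<Sum>a\<in>V. \<Sum>a'\<in>V. of_bool (cls a = cls a') * (f a * f a'))"
proof -
  have "(\<Sum>b\<in>V. (nbr_sum V P f b)\<^sup>2) =
    (\<Sum>a\<in>V. \<Sum>a'\<in>V. (c - c0 * of_bool (cls a = cls a') + B a a') * (f a * f a'))"
    unfolding sum_squares_biadj[OF fin] by (intro sum.cong refl) (simp only: codegree)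
  also have "\<dots> = c * (\<Sum>a\<in>V. \<Sum>a'\<in>V. f a * f a')
      - c0 * (\<Sum>a\<in>V. \<Sum>a'\<in>V. of_bool (cls a = cls a') * (f a * f a'))
      + (\<Sum>a\<in>V. \<Sum>a'\<in>V. B a a' * (f a * f a'))"
    unfolding sum_distrib_left sum_subtractf[symmetric] sum.distrib[symmetric]
    by (intro sum.cong refl) (simp only: algebra_simps)
  also have "(\<Sum>a\<in>V. \<Sum>a'\<in>V. f a * f a') = 0"
    using assms by (simp add: sum_product[symmetric])
  finally show ?thesis by simp
qed

text \<open>A Schur test: replacing each product \<open>f a * f a'\<close> by the mean of the two
  squares leaves only row sums of \<open>B\<close>, by symmetry. The term with \<open>c\<close>
  vanishes because \<open>f\<close> has sum 0.\<close>

lemma sum_squares_le: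
  assumes "(\<Sum>a\<in>V. f a) = 0"
  shows "(\<Sum>b\<in>V. (nbr_sum V P f b)\<^sup>2) \<le> rho * (\<Sum>a\<in>V. (f a)\<^sup>2)"
proof -
  have "(\<Sum>a\<in>V. \<Sum>a'\<in>V. B a a' * (f a * f a')) \<le>
     (\<Sum>a\<in>V. \<Sum>a'\<in>V. B a a' * (f a)\<^sup>2 / 2 + B a a' * (f a')\<^sup>2 / 2)"
  proof (intro sum_mono)
    fix a a' assume "a \<in> V" "a' \<in> V"
    moreover have "f a * f a' \<le> ((f a)\<^sup>2 + (f a')\<^sup>2) / 2"
      using zero_le_power2[of "f a - f a'"] by (simp add: power2_diff)
    ultimately have "B a a' * (f a * f a') \<le> B a a' * (((f a)\<^sup>2 + (f a')\<^sup>2) / 2)"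
      by (intro mult_left_mono B_nonneg)
    thus "B a a' * (f a * f a') \<le> B a a' * (f a)\<^sup>2 / 2 + B a a' * (f a')\<^sup>2 / 2"
      by (simp add: field_simps)
  qed
  also have "\<dots> = (\<Sum>a\<in>V. \<Sum>a'\<in>V. B a a' * (f a)\<^sup>2 / 2) + (\<Sum>a\<in>V. \<Sum>a'\<in>V. B a a' * (f a')\<^sup>2 / 2)"
    by (simp only: sum.distrib)
  also have "(\<Sum>a\<in>V. \<Sum>a'\<in>V. B a a' * (f a')\<^sup>2 / 2) = (\<Sum>a'\<in>V. \<Sum>a\<in>V. B a a' * (f a')\<^sup>2 / 2)"
    by (rule sum.swap)
  also have "\<dots> = (\<Sum>a\<in>V. \<Sum>a'\<in>V. B a a' * (f a)\<^sup>2 / 2)"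
    by (intro sum.cong refl) (simp add: B_sym)
  also have "(\<Sum>a\<in>V. \<Sum>a'\<in>V. B a a' * (f a)\<^sup>2 / 2) = rho * (\<Sum>a\<in>V. (f a)\<^sup>2) / 2"
    by (simp add: sum_divide_distrib[symmetric] sum_distrib_right[symmetric] B_row sum_distrib_left)
  finally have "(\<Sum>a\<in>V. \<Sum>a'\<in>V. B a a' * (f a * f a')) \<le> rho * (\<Sum>a\<in>V. (f a)\<^sup>2)" by simp
  moreover have "c0 * (\<Sum>a\<in>V. \<Sum>a'\<in>V. of_bool (cls a = cls a') * (f a * f a')) \<ge> 0"
    using c0 equivalence_form_nonneg[OF fin] by (intro mult_nonneg_nonneg)
  ultimately show ?thesis unfolding sum_squares_eq[OF assms] by linarith
qed

text \<open>Both losses of the upper bound disappear: on the support of \<open>B\<close> the product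
  equals the mean of the squares, and the class term is built from vanishing class sums.\<close>

lemma sum_squares_eigen:
  assumes "(\<Sum>a\<in>V. f a) = 0"
    and inv: "\<And>a a'. a \<in> V \<Longrightarrow> a' \<in> V \<Longrightarrow> B a a' \<noteq> 0 \<Longrightarrow> f a' = f a"
    and cancel: "\<And>a. a \<in> V \<Longrightarrow> c0 \<noteq> 0 \<Longrightarrow> (\<Sum>a' | a' \<in> V \<and> cls a = cls a'. f a') = 0"
  shows "(\<Sum>b\<in>V. (nbr_sum V P f b)\<^sup>2) = rho * (\<Sum>a\<in>V. (f a)\<^sup>2)"
proof -
  have "(\<Sum>a\<in>V. \<Sum>a'\<in>V. B a a' * (f a * f a')) = (\<Sum>a\<in>V. \<Sum>a'\<in>V. B a a' * (f a)\<^sup>2)"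
    using inv by (intro sum.cong refl) (auto simp: power2_eq_square)
  also have "\<dots> = rho * (\<Sum>a\<in>V. (f a)\<^sup>2)"
    by (simp add: sum_distrib_right[symmetric] B_row sum_distrib_left)
  finally have 1: "(\<Sum>a\<in>V. \<Sum>a'\<in>V. B a a' * (f a * f a')) = rho * (\<Sum>a\<in>V. (f a)\<^sup>2)" .
  have "(\<Sum>a\<in>V. \<Sum>a'\<in>V. of_bool (cls a = cls a') * (f a * f a')) = 0" if "c0 \<noteq> 0"
  proof (rule sum.neutral, rule ballI)
    fix a assume "a \<in> V"
    have "(\<Sum>a'\<in>V. of_bool (cls a = cls a') * (f a * f a')) = (\<Sum>a' | a' \<in> V \<and> cls a = cls a'. f a * f a')"
      using fin by (intro sum.mono_neutral_cong_right) auto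
    also have "\<dots> = f a * (\<Sum>a' | a' \<in> V \<and> cls a = cls a'. f a')" by (simp add: sum_distrib_left)
    also have "\<dots> = 0" using cancel[OF \<open>a \<in> V\<close> that] by simp
    finally show "(\<Sum>a'\<in>V. of_bool (cls a = cls a') * (f a * f a')) = 0" .
  qed
  thus ?thesis unfolding sum_squares_eq[OF assms(1)] 1 by (cases "c0 = 0") auto
qed

text \<open>Determines the common absolute value \<open>m\<close> of the neighbourhood sums by
  computing the sum of their squares in two ways. For the character this takes the place of
  evaluating a character sum over a hyperplane.\<close>

lemma eigen_const_squared:
  assumes V: "V \<noteq> {}" and f: "\<And>a. a \<in> V \<Longrightarrow> f a \<in> {1, -1 :: real}" and sum: "(\<Sum>a\<in>V. f a) = 0"
    and inv: "\<And>a a'. a \<in> V \<Longrightarrow> a' \<in> V \<Longrightarrow> B a a' \<noteq> 0 \<Longrightarrow> f a' = f a"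
    and cancel: "\<And>a. a \<in> V \<Longrightarrow> c0 \<noteq> 0 \<Longrightarrow> (\<Sum>a' | a' \<in> V \<and> cls a = cls a'. f a') = 0"
    and const: "\<And>b. b \<in> V \<Longrightarrow> (nbr_sum V P f b) = sg b * m \<and> sg b \<in> {1, -1}"
  shows "m\<^sup>2 = rho"
proof -
  have "(sg b * m)\<^sup>2 = m\<^sup>2" if "b \<in> V" for b using const[OF that] by auto
  hence "(\<Sum>b\<in>V. m\<^sup>2) = (\<Sum>b\<in>V. (nbr_sum V P f b)\<^sup>2)"
    by (intro sum.cong refl) (simp add: const)
  also have "\<dots> = rho * (\<Sum>a\<in>V. (f a)\<^sup>2)"
    using sum inv cancel by (rule sum_squares_eigen)
  also have "(\<Sum>a\<in>V. (f a)\<^sup>2) = (\<Sum>a\<in>V. 1)"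
    using f by (intro sum.cong refl) (fastforce simp: power2_eq_square)
  finally show ?thesis using V fin by simp
qed

end

text \<open>The second copy is cut by the sign of the neighbourhood sum, so that every vertex
  contributes \<open>lam\<close> to the form. These signs add up to 0 because all neighbourhood sums
  together count each \<open>f a\<close> exactly \<open>D\<close> times.\<close>

lemma (in regular_bipartite) iso_const_le_eigen:
  assumes f: "\<And>a. a \<in> V \<Longrightarrow> f a \<in> {1, -1 :: real}" and sum_f: "(\<Sum>a\<in>V. f a) = 0"
    and abs: "\<And>b. b \<in> V \<Longrightarrow> \<bar>nbr_sum V P f b\<bar> = lam" and lam: "lam > 0"
  shows "iso_const (bipartite_graph V P) \<le> (real D - lam) / 2"
proof -
  define g where "g = (\<lambda>b. (nbr_sum V P f b) / lam)"
  have g: "g b \<in> {1, -1}" if "b \<in> V" for b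
    using abs[OF that] lam by (auto simp: g_def abs_if field_simps split: if_splits)
  have "biadj_form V P f (\<lambda>_. 1) = 0" using biadj_form_one[of f 1] sum_f by simp
  hence "(\<Sum>b\<in>V. g b) = 0" by (simp add: biadj_form_def g_def sum_divide_distrib[symmetric])
  hence "iso_const (bipartite_graph V P) \<le> (real D - biadj_form V P f g / real (card V)) / 2"
    using f g sum_f by (intro iso_const_le) auto
  also have "biadj_form V P f g = (\<Sum>b\<in>V. lam)"
    unfolding biadj_form_def
  proof (intro sum.cong refl)
    fix b assume "b \<in> V"
    have "(nbr_sum V P f b) * g b = (nbr_sum V P f b)\<^sup>2 / lam"
      by (simp add: g_def power2_eq_square)
    also have "\<dots> = \<bar>nbr_sum V P f b\<bar>\<^sup>2 / lam" by simp
    also have "\<dots> = lam" using lam unfolding abs[OF \<open>b \<in> V\<close>] by (simp add: power2_eq_square)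
    finally show "(nbr_sum V P f b) * g b = lam" .
  qed
  also have "\<dots> / real (card V) = lam" using card_V_pos by simp
  finally show ?thesis .
qed

section \<open>Finite fields\<close>

text \<open>A family of maximal length with injective coefficient map spans \<open>K\<close>.
  Injectivity serves as linear independence since it gives at once
  \<open>2 ^ k \<le> card K\<close>, hence a maximal length, and in the end the cardinality of
  \<open>K\<close>. The lemma is applied to the prime field inside a finite field and to a finite
  field inside its extensions.\<close>

lemma finite_subspace_basis:
  fixes F K :: "'l::field set"
  assumes K: "finite K" "0 \<in> K" "\<And>x y. x \<in> K \<Longrightarrow> y \<in> K \<Longrightarrow> x + y \<in> K"
      "\<And>c x. c \<in> F \<Longrightarrow> x \<in> K \<Longrightarrow> c * x \<in> K"
    and F: "finite F" "0 \<in> F" "1 \<in> F" "\<And>c d. c \<in> F \<Longrightarrow> d \<in> F \<Longrightarrow> c - d \<in> F"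
      "\<And>c d. c \<in> F \<Longrightarrow> d \<in> F \<Longrightarrow> c / d \<in> F"
  obtains k :: nat and e where "\<And>i. i < k \<Longrightarrow> e i \<in> K"
    "bij_betw (\<lambda>c. \<Sum>i<k. c i * e i) ({..<k} \<rightarrow>\<^sub>E F) K"
proof -
  define indep where "indep = (\<lambda>(k::nat) e. (\<forall>i<k. e i \<in> K) \<and>
    inj_on (\<lambda>c. \<Sum>i<k. c i * e i) ({..<k} \<rightarrow>\<^sub>E F))"
  have into: "(\<Sum>i<k. c i * e i) \<in> K" if "\<forall>i<k. e i \<in> K" "\<forall>i<k. c i \<in> F" for k and c e :: "nat \<Rightarrow> 'l"
    using that by (induction k) (auto intro: K)
  have image: "(\<lambda>c. \<Sum>i<k. c i * e i) ` ({..<k} \<rightarrow>\<^sub>E F) \<subseteq> K" if "indep k e" for k e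
  proof (rule image_subsetI)
    fix c assume "c \<in> {..<k} \<rightarrow>\<^sub>E F"
    hence "\<forall>i<k. c i \<in> F" by auto
    with that show "(\<Sum>i<k. c i * e i) \<in> K" using into[of k e c] unfolding indep_def by blast
  qed
  have card_F: "card F \<ge> 2"
  proof -
    have "card {0, 1 :: 'l} \<le> card F" using F by (intro card_mono) auto
    thus ?thesis by simp
  qed
  have bound: "k \<le> card K" if "indep k e" for k e
  proof -
    have "(\<lambda>c. \<Sum>i<k. c i * e i) ` ({..<k} \<rightarrow>\<^sub>E F) \<subseteq> K"
      using that by (rule image)
    moreover have "card ((\<lambda>c. \<Sum>i<k. c i * e i) ` ({..<k} \<rightarrow>\<^sub>E F)) = card F ^ k"
      using that unfolding indep_def by (subst card_image) (auto simp only: card_PiE finite_lessThan prod_constant card_lessThan)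
    ultimately have "card F ^ k \<le> card K" using card_mono[OF K(1)] by metis
    moreover have "k < 2 ^ k" by simp
    moreover have "2 ^ k \<le> card F ^ k" using card_F by (intro power_mono) auto
    ultimately show ?thesis by linarith
  qed
  have "indep 0 (\<lambda>_. 0)" by (auto simp: indep_def)
  define k where "k = (GREATEST k. \<exists>e. indep k e)"
  have ex: "\<exists>e. indep k e"
    unfolding k_def by (rule GreatestI_ex_nat[of _ "card K"]) (use \<open>indep 0 _\<close> bound in blast)+
  have max: "\<not> indep (Suc k) e" for e
    using Greatest_le_nat[of "\<lambda>k. \<exists>e. indep k e" "Suc k" "card K"] bound unfolding k_def[symmetric]
    by (metis Suc_n_not_le_n)
  from ex obtain e where e: "indep k e" ..
  let ?h = "\<lambda>c. \<Sum>i<k. c i * e i"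
  have "?h ` ({..<k} \<rightarrow>\<^sub>E F) = K"
  proof (rule ccontr)
    assume "?h ` ({..<k} \<rightarrow>\<^sub>E F) \<noteq> K"
    moreover have "?h ` ({..<k} \<rightarrow>\<^sub>E F) \<subseteq> K"
      using e by (rule image)
    ultimately obtain z where z: "z \<in> K" "z \<notin> ?h ` ({..<k} \<rightarrow>\<^sub>E F)" by blast
    have notin: "z \<noteq> ?h c" if "\<forall>i<k. c i \<in> F" for c
    proof
      assume "z = ?h c"
      also have "\<dots> = ?h (restrict c {..<k})" by simp
      finally have z': "z = ?h (restrict c {..<k})" .
      have "z \<in> ?h ` ({..<k} \<rightarrow>\<^sub>E F)"
        by (rule image_eqI[of _ _ "restrict c {..<k}"], rule z') (use that in auto)
      thus False using z(2) by blast
    qed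
    \<comment> \<open>If two equal combinations had different coefficients at \<open>z\<close>,
      dividing by the difference would put \<open>z\<close> into the span; otherwise the
      independence of \<open>e\<close> applies.\<close>
    have "indep (Suc k) (e(k := z))"
      unfolding indep_def
    proof (intro conjI inj_onI allI impI)
      fix i assume "i < Suc k"
      thus "(e(k := z)) i \<in> K" using e z by (auto simp: indep_def less_Suc_eq)
    next
      fix c d assume cd: "c \<in> {..<Suc k} \<rightarrow>\<^sub>E F" "d \<in> {..<Suc k} \<rightarrow>\<^sub>E F"
        "(\<Sum>i<Suc k. c i * (e(k := z)) i) = (\<Sum>i<Suc k. d i * (e(k := z)) i)"
      have eq: "?h c + c k * z = ?h d + d k * z"
        using cd(3) by simp
      have cF: "c i \<in> F" "d i \<in> F" if "i < Suc k" for i using cd that by (auto simp: PiE_def Pi_def)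
      have "c k = d k"
      proof (rule ccontr)
        assume ne: "c k \<noteq> d k"
        have "(c k - d k) * z = ?h d - ?h c" using eq by (simp add: algebra_simps)
        hence "z = (?h d - ?h c) / (c k - d k)" using ne by (simp add: field_simps)
        also have "\<dots> = ?h (\<lambda>i. (d i - c i) / (c k - d k))"
          by (simp add: sum_divide_distrib sum_subtractf[symmetric] algebra_simps diff_divide_distrib)
        finally have "z = ?h (\<lambda>i. (d i - c i) / (c k - d k))" .
        moreover have "\<forall>i<k. (d i - c i) / (c k - d k) \<in> F" using cF F(4,5) by simp
        ultimately show False using notin[of "\<lambda>i. (d i - c i) / (c k - d k)"] by simp
      qed
      hence "?h (restrict c {..<k}) = ?h (restrict d {..<k})" using eq by simp
      moreover have "restrict c {..<k} \<in> {..<k} \<rightarrow>\<^sub>E F" "restrict d {..<k} \<in> {..<k} \<rightarrow>\<^sub>E F"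
        using cF by auto
      ultimately have "restrict c {..<k} = restrict d {..<k}"
        by (rule inj_onD[OF conjunct2[OF e[unfolded indep_def]]])
      hence "c i = d i" if "i < k" for i using that by (metis lessThan_iff restrict_apply')
      with \<open>c k = d k\<close> show "c = d"
        using cd(1,2) by (intro PiE_ext[of c _ _ d]) (auto simp: less_Suc_eq)
    qed
    thus False using max by blast
  qed
  with e have "bij_betw ?h ({..<k} \<rightarrow>\<^sub>E F) K" by (simp add: indep_def bij_betw_def)
  with e show ?thesis by (intro that[of k e]) (auto simp: indep_def)
qed

text \<open>The multiples of 1 form the prime field \<open>F\<close>, over which the whole field has
  a basis. That the order is a power of the characteristic is what makes raising to the power
  \<open>CARD('f) ^ n\<close> additive.\<close>

lemma card_finite_field_eq_CHAR_power:
  obtains k where "CARD('f::finite_field) = CHAR('f) ^ k"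
proof -
  let ?p = "CHAR('f)"
  define F where "F = range (of_nat :: nat \<Rightarrow> 'f)"
  have F_add: "x + y \<in> F" if "x \<in> F" "y \<in> F" for x y
  proof -
    from that obtain m n where "x = of_nat m" "y = of_nat n" by (auto simp: F_def)
    thus ?thesis unfolding F_def by (intro range_eqI[of _ _ "m + n"]) simp
  qed
  have F_mult: "x * y \<in> F" if "x \<in> F" "y \<in> F" for x y
  proof -
    from that obtain m n where "x = of_nat m" "y = of_nat n" by (auto simp: F_def)
    thus ?thesis unfolding F_def by (intro range_eqI[of _ _ "m * n"]) simp
  qed
  have p: "prime ?p" by simp
  have F_uminus: "- x \<in> F" if "x \<in> F" for x
  proof -
    have "of_nat (?p - 1) = (-1 :: 'f)"
      using p by (subst of_nat_diff) (auto simp: prime_gt_0_nat Suc_leI)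
    hence "-1 \<in> F" unfolding F_def by (metis rangeI)
    from F_mult[OF this that] show ?thesis by simp
  qed
  have F_inv: "inverse x \<in> F" if "x \<in> F" for x
  proof (cases "x = 0")
    case False
    \<comment> \<open>An injective map of the finite set \<open>F\<close> into itself is onto, so it
      hits 1.\<close>
    have "(\<lambda>y. x * y) ` F = F"
      by (rule endo_inj_surj) (use False that F_mult in \<open>auto simp: inj_on_def\<close>)
    moreover have "1 \<in> F" unfolding F_def by (metis of_nat_1 rangeI)
    ultimately obtain y where "y \<in> F" "x * y = 1" by (metis imageE)
    thus ?thesis by (metis inverse_unique)
  qed (use that in auto)
  have card_F: "card F = ?p"
  proof -
    have "F = of_nat ` {..<?p}"
    proof -
      have "(of_nat m :: 'f) \<in> of_nat ` {..<?p}" for m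
      proof (rule image_eqI)
        show "of_nat m = (of_nat (m mod ?p) :: 'f)"
          unfolding of_nat_eq_iff_cong_CHAR by (simp add: cong_def)
      qed (use p in \<open>simp add: prime_gt_0_nat\<close>)
      thus ?thesis by (auto simp: F_def)
    qed
    moreover have "inj_on (of_nat :: nat \<Rightarrow> 'f) {..<?p}"
      by (auto simp: inj_on_def of_nat_eq_iff_cong_CHAR cong_def)
    ultimately show ?thesis by (simp add: card_image)
  qed
  obtain k and e :: "nat \<Rightarrow> 'f" where "bij_betw (\<lambda>c. \<Sum>i<k. c i * e i) ({..<k} \<rightarrow>\<^sub>E F) UNIV"
  proof (rule finite_subspace_basis[of UNIV F])
    show "0 \<in> F" "1 \<in> F" unfolding F_def by (metis of_nat_0 of_nat_1 rangeI)+
    show "c - d \<in> F" if "c \<in> F" "d \<in> F" for c d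
      using F_add[OF that(1) F_uminus[OF that(2)]] by simp
    show "c / d \<in> F" if "c \<in> F" "d \<in> F" for c d
      using F_mult[OF that(1) F_inv[OF that(2)]] by (simp add: field_simps)
  qed auto
  from bij_betw_same_card[OF this] have "CARD('f) = ?p ^ k"
    by (simp add: card_PiE card_F)
  thus ?thesis by (rule that)
qed

text \<open>A polynomial without a common root with its derivative has only roots of order 1, and
  over an algebraically closed field the orders add up to the degree.\<close>

lemma card_roots_alg_closed:
  fixes p :: "'l::alg_closed_field poly"
  assumes p: "p \<noteq> 0" and simple: "\<And>x. poly p x = 0 \<Longrightarrow> poly (pderiv p) x \<noteq> 0"
  shows "card {x. poly p x = 0} = degree p"
proof -
  have order: "order x p = 1" if "poly p x = 0" for x
  proof -
    have "\<not> [:-x, 1:] ^ 2 dvd p"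
    proof
      assume "[:-x, 1:] ^ 2 dvd p"
      then obtain r where r: "p = [:-x, 1:] ^ 2 * r" by (elim dvdE)
      have "poly (pderiv p) x = 0" unfolding r power2_eq_square pderiv_mult poly_add poly_mult by simp
      with simple that show False by blast
    qed
    moreover have "order x p \<noteq> 0" using that p by (simp add: order_eq_0_iff)
    ultimately show ?thesis using p by (simp add: order_divides)
  qed
  obtain A where A: "size A = degree p" "p = smult (lead_coeff p) (\<Prod>x\<in>#A. [:-x, 1:])"
    using alg_closed_imp_factorization[OF p] by blast
  have "proots p = proots (\<Prod>x\<in>#A. [:-x, 1:])"
    by (subst A(2)) (use p in simp)
  also have "\<dots> = A"
  proof (induction A)
    case (add x A)
    have "(\<Prod>x\<in>#A. [:-x, 1:]) \<noteq> 0" by (auto simp: prod_mset_zero_iff)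
    hence "proots ([:-x, 1:] * (\<Prod>x\<in>#A. [:-x, 1:])) = proots [:-x, 1:] + A"
      by (subst proots_mult) (auto simp: add simp del: mult_pCons_left)
    thus ?case by (simp del: mult_pCons_left)
  qed auto
  finally have "size (proots p) = degree p" using A(1) by simp
  moreover have "proots p = mset_set {x. poly p x = 0}"
  proof (rule multiset_eqI)
    fix x
    show "count (proots p) x = count (mset_set {x. poly p x = 0}) x"
      using p poly_roots_finite[OF p] order[of x]
      by (cases "poly p x = 0") (auto simp: order_eq_0_iff)
  qed
  ultimately show ?thesis by simp
qed

subsection \<open>Extensions of a finite field\<close>

text \<open>For \<open>n > 0\<close>, the extension of degree \<open>n\<close>, cut out of one
  algebraic closure as the fixed points of the \<open>n\<close>-th iterate of Frobenius; a type
  could not depend on \<open>n\<close>.\<close>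

definition field_ext :: "nat \<Rightarrow> 'f::finite_field alg_closure set" where
  "field_ext n = {x. x ^ (CARD('f) ^ n) = x}"

definition field_trace :: "nat \<Rightarrow> 'f::finite_field alg_closure \<Rightarrow> 'f alg_closure" where
  "field_trace n x = (\<Sum>i<n. x ^ (CARD('f) ^ i))"

text \<open>The value 0 at 0 lets sums of the quadratic character range over all vectors.\<close>

definition quad_char :: "nat \<Rightarrow> 'f::finite_field alg_closure \<Rightarrow> real" where
  "quad_char n x = (if x = 0 then 0 else if x ^ ((CARD('f) ^ n - 1) div 2) = 1 then 1 else -1)"

lemma alg_closure_power_card_add:
  fixes x y :: "'f::finite_field alg_closure"
  shows "(x + y) ^ (CARD('f) ^ n) = x ^ (CARD('f) ^ n) + y ^ (CARD('f) ^ n)"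
proof -
  obtain k where k: "CARD('f) = CHAR('f) ^ k" by (rule card_finite_field_eq_CHAR_power)
  show ?thesis
    by (rule freshmans_dream'[of _ "k * n"]) (simp_all add: k power_mult)
qed

lemma alg_closure_power_card_sum:
  fixes f :: "'b \<Rightarrow> 'f::finite_field alg_closure"
  shows "sum f A ^ (CARD('f) ^ n) = (\<Sum>i\<in>A. f i ^ (CARD('f) ^ n))"
  by (induction A rule: infinite_finite_induct)
     (simp_all add: alg_closure_power_card_add power_0_left)

lemma to_ac_power_card [simp]: "to_ac (c :: 'f::finite_field) ^ (CARD('f) ^ n) = to_ac c"
  using finite_field_power_card_power_eq_same[of "CARD('f) ^ n" n c]
  by (metis to_ac_power)

lemma card_finite_field_ge_2: "CARD('f::finite_field) \<ge> 2"
proof -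
  have "card {0, 1 :: 'f} \<le> CARD('f)" by (intro card_mono) auto
  thus ?thesis by simp
qed

text \<open>The elements are the roots of \<open>X ^ Q - X\<close> with
  \<open>Q = CARD('f) ^ n\<close>. Its derivative is -1, because the characteristic divides
  \<open>Q\<close>, so all roots are simple.\<close>

lemma card_field_ext:
  assumes "n > 0"
  shows "card (field_ext n :: 'f::finite_field alg_closure set) = CARD('f) ^ n"
proof -
  let ?Q = "CARD('f) ^ n"
  have "2 ^ 1 \<le> (2::nat) ^ n" using assms by (intro power_increasing) auto
  also have "\<dots> \<le> ?Q" using card_finite_field_ge_2 by (intro power_mono) auto
  finally have Q: "?Q \<ge> 2" by simp
  define p :: "'f alg_closure poly" where "p = monom 1 ?Q - monom 1 1"
  have deg: "degree p = ?Q"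
    unfolding p_def diff_conv_add_uminus
    by (subst degree_add_eq_left) (use Q in \<open>auto simp: degree_monom_eq\<close>)
  have "of_nat ?Q = (0 :: 'f alg_closure)"
  proof -
    have "CHAR('f) dvd CARD('f)" by (rule CHAR_dvd_CARD)
    hence "CHAR('f) dvd ?Q" using assms by (meson dvd_power dvd_trans)
    thus ?thesis using of_nat_eq_0_iff_char_dvd[of ?Q, where ?'a = "'f alg_closure"] by simp
  qed
  hence "pderiv p = - 1"
    by (simp add: p_def pderiv_diff pderiv_monom)
  moreover have "p \<noteq> 0" using deg Q by auto
  ultimately have "card {x. poly p x = 0} = ?Q" using card_roots_alg_closed[of p] deg by simp
  also have "{x. poly p x = 0} = field_ext n"
    by (auto simp: field_ext_def p_def poly_monom)
  finally show ?thesis .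
qed

lemma finite_field_ext: "n > 0 \<Longrightarrow> finite (field_ext n :: 'f::finite_field alg_closure set)"
  by (rule card_ge_0_finite) (use card_finite_field_ge_2[where ?'f = 'f] in \<open>simp add: card_field_ext\<close>)

lemma field_ext_closed:
  fixes x y :: "'f::finite_field alg_closure"
  shows "to_ac c \<in> field_ext n" "0 \<in> field_ext n" "1 \<in> field_ext n"
    "x \<in> field_ext n \<Longrightarrow> y \<in> field_ext n \<Longrightarrow> x + y \<in> field_ext n"
    "x \<in> field_ext n \<Longrightarrow> y \<in> field_ext n \<Longrightarrow> x * y \<in> field_ext n"
    "x \<in> field_ext n \<Longrightarrow> inverse x \<in> field_ext n"
    "x \<in> field_ext n \<Longrightarrow> y \<in> field_ext n \<Longrightarrow> x / y \<in> field_ext n"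
  by (simp_all add: field_ext_def alg_closure_power_card_add power_mult_distrib power_inverse power_divide)

lemma field_ext_sum:
  fixes f :: "'b \<Rightarrow> 'f::finite_field alg_closure"
  assumes "\<And>i. i \<in> A \<Longrightarrow> f i \<in> field_ext n"
  shows "sum f A \<in> field_ext n"
  using assms by (induction A rule: infinite_finite_induct) (auto intro: field_ext_closed)

lemma range_to_ac_eq: "range (to_ac :: 'f::finite_field \<Rightarrow> _) = field_ext 1"
proof (rule card_subset_eq)
  show "card (range (to_ac :: 'f \<Rightarrow> _)) = card (field_ext 1 :: 'f alg_closure set)"
    by (simp add: card_field_ext card_image inj_to_ac)
qed (auto simp: finite_field_ext field_ext_closed)

section \<open>The trace to the base field\<close>

lemma field_trace_add: "field_trace n (x + y) = field_trace n x + field_trace n y"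
  by (simp add: field_trace_def alg_closure_power_card_add sum.distrib)

lemma field_trace_scale: "field_trace n (to_ac c * x) = to_ac c * field_trace n x"
  by (simp add: field_trace_def power_mult_distrib sum_distrib_left)

lemma field_trace_0 [simp]: "field_trace n 0 = 0"
  using field_trace_scale[of n 0 0] by simp

lemma field_trace_sum: "field_trace n (sum f A) = (\<Sum>i\<in>A. field_trace n (f i))"
  by (induction A rule: infinite_finite_induct) (simp_all add: field_trace_add)

text \<open>Frobenius permutes the summands cyclically, since its \<open>n\<close>-th iterate fixes
  \<open>x\<close>; the trace is thus a fixed point of Frobenius.\<close>

lemma field_trace_range:
  assumes "x \<in> field_ext n"
  shows "field_trace n x \<in> range to_ac"
proof (cases n)
  case (Suc m)
  have "field_trace n x ^ (CARD('a) ^ 1) = (\<Sum>i<n. x ^ (CARD('a) ^ Suc i))"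
    unfolding field_trace_def alg_closure_power_card_sum
    by (simp add: mult.commute flip: power_mult)
  also have "\<dots> = (\<Sum>i<m. x ^ (CARD('a) ^ Suc i)) + x ^ (CARD('a) ^ n)" by (simp add: Suc)
  also have "x ^ (CARD('a) ^ n) = x" using assms by (simp add: field_ext_def)
  also have "(\<Sum>i<m. x ^ (CARD('a) ^ Suc i)) + x = field_trace n x"
    unfolding field_trace_def Suc by (subst sum.lessThan_Suc_shift) simp
  finally show ?thesis unfolding range_to_ac_eq by (simp add: field_ext_def)
next
  case 0
  thus ?thesis using rangeI[of to_ac 0] by (simp add: field_trace_def)
qed

text \<open>The trace is a nonzero polynomial of degree at most \<open>q ^ (n - 1)\<close> for
  \<open>q = CARD('f)\<close>, too small to vanish at all \<open>q ^ n\<close> elements. This makes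
  the trace form nondegenerate.\<close>

lemma field_trace_nonzero:
  assumes "n > 0"
  obtains x :: "'f::finite_field alg_closure" where "x \<in> field_ext n" "field_trace n x \<noteq> 0"
proof -
  obtain m where m: "n = Suc m" using assms gr0_conv_Suc by blast
  let ?q = "CARD('f)"
  define p :: "'f alg_closure poly" where "p = (\<Sum>i<n. monom 1 (?q ^ i))"
  have q: "?q \<ge> 2" by (rule card_finite_field_ge_2)
  have inj: "?q ^ i = ?q ^ j \<longleftrightarrow> i = j" for i j using q by (intro power_inject_exp) auto
  have "coeff p (?q ^ m) = (\<Sum>i<n. if i = m then 1 else 0)"
    unfolding p_def by (simp add: coeff_sum inj)
  hence "coeff p (?q ^ m) = 1" by (simp add: m)
  hence p0: "p \<noteq> 0" by auto
  have deg: "degree p \<le> ?q ^ m" unfolding p_def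
    by (intro degree_sum_le order.trans[OF degree_monom_le] power_increasing) (use q in \<open>auto simp: m\<close>)
  have "card {x. poly p x = 0} \<le> ?q ^ m" using card_poly_roots_bound[OF p0] deg by linarith
  also have "\<dots> < ?q ^ n" unfolding m using q by simp
  also have "\<dots> = card (field_ext n :: 'f alg_closure set)" using card_field_ext[OF assms, where ?'f = 'f] by simp
  finally have "\<not> field_ext n \<subseteq> {x. poly p x = 0}"
    using card_mono[of "{x. poly p x = 0}" "field_ext n"] poly_roots_finite[OF p0] by linarith
  thus ?thesis using that by (auto simp: p_def poly_sum poly_monom field_trace_def)
qed

section \<open>The quadratic character of an extension\<close>

lemma quad_char_0 [simp]: "quad_char n 0 = 0" by (simp add: quad_char_def)

lemma quad_char_abs: "x \<noteq> 0 \<Longrightarrow> quad_char n x \<in> {1, -1}" by (simp add: quad_char_def)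

lemma neg_one_neq_one:
  assumes odd_card: "odd CARD('f::finite_field)"
  shows "(-1 :: 'f alg_closure) \<noteq> 1"
proof
  assume "(-1 :: 'f alg_closure) = 1"
  hence "1 + 1 = (0 :: 'f alg_closure)" by (metis add.right_inverse)
  hence "of_nat 2 = (0 :: 'f alg_closure)" by simp
  hence "CHAR('f) dvd 2" using of_nat_eq_0_iff_char_dvd[of 2, where ?'a = "'f alg_closure"] by simp
  moreover have "prime CHAR('f)" by simp
  ultimately have "CHAR('f) = 2" using two_is_prime_nat primes_dvd_imp_eq by blast
  moreover have "CHAR('f) dvd CARD('f)" by (rule CHAR_dvd_CARD)
  ultimately show False using odd_card by simp
qed

text \<open>Since \<open>x ^ (Q - 1) = 1\<close>, the power is a square root of 1. The lemma
  translates the real-valued sign back into a field element, where multiplicativity can be read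
  off.\<close>

lemma quad_char_power:
  fixes x :: "'f::finite_field alg_closure"
  assumes odd_card: "odd CARD('f::finite_field)" and "x \<in> field_ext n" "x \<noteq> 0"
  shows "x ^ ((CARD('f) ^ n - 1) div 2) = (if quad_char n x = 1 then 1 else -1)"
proof -
  let ?Q = "CARD('f) ^ n"
  have "odd ?Q" using odd_card by simp
  hence "even (?Q - 1)" "?Q \<ge> 1" by (auto simp: Suc_leI odd_pos)
  have "x * x ^ (?Q - 1) = x" using assms \<open>?Q \<ge> 1\<close> 
    by (simp add: field_ext_def flip: power_Suc)
  hence "x ^ (?Q - 1) = 1" using assms by simp
  hence "(x ^ ((?Q - 1) div 2))\<^sup>2 = 1" using \<open>even (?Q - 1)\<close>
    by (simp flip: power_mult)
  hence "x ^ ((?Q - 1) div 2) = 1 \<or> x ^ ((?Q - 1) div 2) = -1" by (simp add: power2_eq_1_iff)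
  thus ?thesis using assms(3) neg_one_neq_one[OF odd_card] by (auto simp: quad_char_def)
qed

lemma quad_char_mult:
  fixes x y :: "'f::finite_field alg_closure"
  assumes odd_card: "odd CARD('f::finite_field)" and "x \<in> field_ext n" "y \<in> field_ext n"
  shows "quad_char n (x * y) = quad_char n x * quad_char n y"
proof (cases "x = 0 \<or> y = 0")
  case False
  thus ?thesis
    using quad_char_power[OF odd_card, of x n] quad_char_power[OF odd_card, of y n] assms neg_one_neq_one[OF odd_card]
      quad_char_abs[of x n] quad_char_abs[of y n]
    by (auto simp: quad_char_def[of n "x * y"] power_mult_distrib split: if_splits)
qed auto

text \<open>\<open>X ^ ((Q - 1) div 2) - 1\<close> has at most half as many roots as there are
  nonzero elements.\<close>

lemma quad_char_nontrivial:
  assumes odd_card: "odd CARD('f::finite_field)" and "n > 0"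
  obtains x :: "'f::finite_field alg_closure" where "x \<in> field_ext n" "x \<noteq> 0" "quad_char n x = -1"
proof -
  let ?Q = "CARD('f) ^ n" and ?h = "(CARD('f) ^ n - 1) div 2"
  have "odd ?Q" using odd_card by simp
  moreover have "2 ^ 1 \<le> (2::nat) ^ n" using assms by (intro power_increasing) auto
  moreover have "2 ^ n \<le> ?Q" using card_finite_field_ge_2 by (intro power_mono) auto
  \<comment> \<open>This keeps the exponent \<open>?h\<close> positive, without which the polynomial
    \<open>p\<close> would be 0.\<close>
  ultimately have Q: "?Q \<ge> 3" by (cases "?Q = 2") auto
  define p :: "'f alg_closure poly" where "p = monom 1 ?h - 1"
  have h: "?h > 0" using Q by auto
  have "coeff p ?h = 1" using h by (simp add: p_def)
  hence p0: "p \<noteq> 0" by auto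
  have "degree p \<le> ?h" unfolding p_def
    by (intro degree_diff_le order.trans[OF degree_monom_le]) auto
  hence "card {x. poly p x = 0} \<le> ?h" using card_poly_roots_bound[OF p0] by linarith
  also have "?h < ?Q - 1" using Q by simp
  also have "\<dots> = card (field_ext n - {0 :: 'f alg_closure})"
    using assms by (simp add: card_Diff_singleton field_ext_closed card_field_ext)
  finally have "\<not> field_ext n - {0} \<subseteq> {x. poly p x = 0}"
    using card_mono[of "{x. poly p x = 0}" "field_ext n - {0}"] poly_roots_finite[OF p0] by linarith
  then obtain x where "x \<in> field_ext n" "x \<noteq> 0" "poly p x \<noteq> 0" by auto
  thus ?thesis by (intro that[of x]) (auto simp: p_def poly_monom quad_char_def)
qed

lemma quad_char_inverse:
  fixes x :: "'f::finite_field alg_closure"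
  assumes "x \<in> field_ext n"
  shows "quad_char n (inverse x) = quad_char n x"
  using assms by (simp add: quad_char_def power_inverse)

text \<open>Multiplication by a nonsquare permutes the field and changes every sign.\<close>

lemma sum_quad_char_field_ext:
  assumes odd_card: "odd CARD('f::finite_field)" and "n > 0"
  shows "(\<Sum>x\<in>field_ext n. quad_char n (x :: 'f::finite_field alg_closure)) = 0"
proof -
  obtain t :: "'f alg_closure" where t: "t \<in> field_ext n" "t \<noteq> 0" "quad_char n t = -1"
    by (rule quad_char_nontrivial[OF assms])
  have "(\<Sum>x::'f alg_closure\<in>field_ext n. quad_char n x) = (\<Sum>x\<in>field_ext n. quad_char n (t * x))"
    by (rule sum.reindex_bij_witness[of _ "\<lambda>x. t * x" "\<lambda>x. x / t"]) (use t in \<open>auto intro: field_ext_closed\<close>)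
  also have "\<dots> = (\<Sum>x::'f alg_closure\<in>field_ext n. - quad_char n x)"
    using t by (intro sum.cong refl) (simp add: quad_char_mult[OF odd_card])
  finally show ?thesis by (simp add: sum_negf)
qed

text \<open>Substitute \<open>x / y\<close> for \<open>x\<close>. All nonzero \<open>y\<close> give
  the same sum up to the sign \<open>quad_char n y\<close>, so that only one unknown number for each
  value \<open>s\<close> remains.\<close>

lemma sum_quad_char_trace:
  fixes y :: "'f::finite_field alg_closure"
  assumes odd_card: "odd CARD('f::finite_field)" and "y \<in> field_ext n" "y \<noteq> 0"
  shows "(\<Sum>x | x \<in> field_ext n \<and> field_trace n (y * x) = s. quad_char n x) =
    quad_char n y * (\<Sum>x | x \<in> field_ext n \<and> field_trace n x = s. quad_char n x)"
proof -
  have "(\<Sum>x | x \<in> field_ext n \<and> field_trace n (y * x) = s. quad_char n x) =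
     (\<Sum>x | x \<in> field_ext n \<and> field_trace n x = s. quad_char n (inverse y * x))"
    by (rule sum.reindex_bij_witness[of _ "\<lambda>x. inverse y * x" "\<lambda>x. y * x"])
       (use assms in \<open>auto intro: field_ext_closed simp: mult.assoc[symmetric]\<close>)
  also have "\<dots> = (\<Sum>x | x \<in> field_ext n \<and> field_trace n x = s. quad_char n y * quad_char n x)"
    using assms by (intro sum.cong refl) (auto simp: quad_char_mult[OF odd_card] field_ext_closed quad_char_inverse)
  finally show ?thesis by (simp add: sum_distrib_left)
qed

lemma power_minus_one_eq_sum:
  fixes q :: nat
  assumes "q \<ge> 1"
  shows "q ^ n - 1 = (q - 1) * (\<Sum>i<n. q ^ i)"
proof -
  obtain m where m: "q = Suc m" using assms by (cases q) auto
  have "Suc m ^ n = 1 + m * (\<Sum>i<n. Suc m ^ i)"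
    by (induction n) (simp_all add: algebra_simps)
  thus ?thesis by (simp add: m)
qed

text \<open>\<open>(q ^ n - 1) / 2\<close> is \<open>(q - 1) / 2\<close> times
  \<open>1 + q + ... + q ^ (n - 1)\<close>, and for odd \<open>q\<close> this last sum has the
  parity of \<open>n\<close>. All distinctions between even and odd dimension originate
  here.\<close>

lemma to_ac_power_half_card:
  assumes odd_card: "odd CARD('f::finite_field)" and c: "c \<noteq> 0"
  shows "to_ac c ^ ((CARD('f) ^ n - 1) div 2) = (if even n \<or> quad_char 1 (to_ac (c :: 'f)) = 1 then 1 else -1)"
proof -
  let ?q = "CARD('f)" and ?x = "to_ac c ^ ((CARD('f) - 1) div 2)"
  have q: "even (?q - 1)" "?q \<ge> 1" using odd_card by (auto simp: Suc_leI odd_pos)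
  have "(?q ^ n - 1) div 2 = (?q - 1) div 2 * (\<Sum>i<n. ?q ^ i)"
    using q(1) unfolding power_minus_one_eq_sum[OF q(2)] by (metis dvd_div_mult)
  hence "to_ac c ^ ((?q ^ n - 1) div 2) = ?x ^ (\<Sum>i<n. ?q ^ i)" by (simp only: power_mult)
  also have "?x = (if quad_char 1 (to_ac c) = 1 then 1 else -1)"
    using quad_char_power[OF odd_card, of "to_ac c" 1] c by (simp add: field_ext_closed)
  also have "\<dots> ^ (\<Sum>i<n. ?q ^ i) = (if even n \<or> quad_char 1 (to_ac c) = 1 then 1 else -1)"
  proof -
    have "even (\<Sum>i<n. ?q ^ i) \<longleftrightarrow> even n" using odd_card by (subst even_sum_iff) auto
    thus ?thesis by simp
  qed
  finally show ?thesis .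
qed

lemma quad_char_to_ac_odd:
  assumes odd_card: "odd CARD('f::finite_field)" and "odd n"
  shows "quad_char n (to_ac (c :: 'f)) = quad_char 1 (to_ac c)"
proof (cases "c = 0")
  case False
  with assms neg_one_neq_one[OF odd_card] quad_char_abs[of "to_ac c" 1] show ?thesis
    unfolding quad_char_def[of n] to_ac_power_half_card[OF odd_card False] by auto
qed simp

lemma quad_char_to_ac_even:
  assumes "odd CARD('f::finite_field)" "even n" "c \<noteq> 0"
  shows "quad_char n (to_ac (c :: 'f)) = 1"
  using assms(2,3) unfolding quad_char_def[of n] to_ac_power_half_card[OF assms(1,3), of n] by simp

section \<open>Bases of the extension and duality under the trace\<close>

lemma field_ext_basis:
  assumes "n > 0"
  obtains e :: "nat \<Rightarrow> 'f::finite_field alg_closure" where "\<And>i. i < n \<Longrightarrow> e i \<in> field_ext n"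
    "bij_betw (\<lambda>c. \<Sum>i<n. to_ac (c i) * e i) ({..<n} \<rightarrow>\<^sub>E UNIV) (field_ext n)"
proof -
  have sub: "c - d \<in> range to_ac" if "c \<in> range to_ac" "d \<in> range to_ac" for c d :: "'f alg_closure"
    using that rangeI[of to_ac "a - b" for a b] by (auto simp flip: to_ac_diff)
  have div: "c / d \<in> range to_ac" if "c \<in> range to_ac" "d \<in> range to_ac" for c d :: "'f alg_closure"
    using that rangeI[of to_ac "a / b" for a b] by (auto simp flip: to_ac_divide)
  obtain k and e :: "nat \<Rightarrow> 'f alg_closure" where e: "\<And>i. i < k \<Longrightarrow> e i \<in> field_ext n"
    and bij: "bij_betw (\<lambda>c. \<Sum>i<k. c i * e i) ({..<k} \<rightarrow>\<^sub>E range to_ac) (field_ext n)"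
  proof (rule finite_subspace_basis[of "field_ext n" "range to_ac :: 'f alg_closure set"])
    show "0 \<in> range to_ac" "1 \<in> range to_ac" by (metis to_ac_0 to_ac_1 rangeI)+
  qed (use assms sub div in \<open>auto simp: finite_field_ext intro: field_ext_closed\<close>)
  have "CARD('f) ^ k = CARD('f) ^ n"
    using bij_betw_same_card[OF bij] card_field_ext[OF assms, where ?'f = 'f]
    by (simp add: card_PiE card_image inj_to_ac)
  hence k: "k = n" using card_finite_field_ge_2[where ?'f = 'f] by (subst (asm) power_inject_exp) auto
  let ?h = "\<lambda>c. restrict (\<lambda>i. to_ac (c i)) {..<n}"
  have "bij_betw ?h ({..<n} \<rightarrow>\<^sub>E UNIV) ({..<n} \<rightarrow>\<^sub>E (range to_ac :: 'f alg_closure set))"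
    by (rule bij_betwI[where g = "\<lambda>c. restrict (\<lambda>i. of_ac (c i)) {..<n}"])
       (auto simp: fun_eq_iff PiE_def extensional_def to_ac_of_ac Pi_def)
  from bij_betw_trans[OF this bij[unfolded k]]
  have "bij_betw (\<lambda>c. \<Sum>i<n. to_ac (c i) * e i) ({..<n} \<rightarrow>\<^sub>E UNIV) (field_ext n)"
    by (simp add: o_def)
  thus ?thesis using e k by (intro that[of e]) auto
qed

text \<open>Every linear form on \<open>F\<^sup>n\<close> becomes \<open>x \<mapsto> tr (y x)\<close> for some \<open>y\<close> in the extension.\<close>

lemma field_ext_dual:
  fixes e :: "nat \<Rightarrow> 'f::finite_field alg_closure"
  assumes n: "n > 0" and e: "\<And>i. i < n \<Longrightarrow> e i \<in> field_ext n"
    and bij: "bij_betw (\<lambda>c. \<Sum>i<n. to_ac (c i) * e i) ({..<n} \<rightarrow>\<^sub>E UNIV) (field_ext n)"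
  obtains y where "y \<in> field_ext n" "\<And>i. i < n \<Longrightarrow> field_trace n (y * e i) = to_ac (b i)"
proof -
  let ?h = "\<lambda>y. restrict (\<lambda>i. field_trace n (y * e i)) {..<n}"
  let ?B = "{..<n} \<rightarrow>\<^sub>E (range to_ac :: 'f alg_closure set)"
  have "inj_on ?h (field_ext n)"
  proof (rule inj_onI)
    fix y z assume yz: "y \<in> field_ext n" "z \<in> field_ext n" "?h y = ?h z"
    obtain x :: "'f alg_closure" where x: "x \<in> field_ext n" "field_trace n x \<noteq> 0"
      by (rule field_trace_nonzero[OF n])
    show "y = z"
    proof (rule ccontr)
      assume "y \<noteq> z"
      have mz: "- z \<in> field_ext n"
        using field_ext_closed(5)[OF field_ext_closed(1)[of "-1"] yz(2)] by simp
      \<comment> \<open>At this element the forms of \<open>y\<close> and \<open>z\<close> differ by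
        the trace of \<open>x\<close>, which is nonzero; expanding the element in the basis
        contradicts their agreement on the basis.\<close>
      have "x / (y - z) \<in> field_ext n"
        using field_ext_closed(4)[OF yz(1) mz] x by (auto intro!: field_ext_closed)
      with bij obtain c where c: "x / (y - z) = (\<Sum>i<n. to_ac (c i) * e i)"
        unfolding bij_betw_def by (metis (no_types, lifting) imageE)
      have tr: "field_trace n (y * e i) = field_trace n (z * e i)" if "i < n" for i
        using yz(3) that by (metis lessThan_iff restrict_apply')
      have form: "field_trace n (w * (\<Sum>i<n. to_ac (c i) * e i)) =
          (\<Sum>i<n. to_ac (c i) * field_trace n (w * e i))" for w
        unfolding sum_distrib_left field_trace_sum mult.left_commute[of w] field_trace_scale ..
      have "y * (x / (y - z)) = z * (x / (y - z)) + x"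
        using \<open>y \<noteq> z\<close> by (simp add: field_simps)
      hence "field_trace n (y * (x / (y - z))) = field_trace n (z * (x / (y - z))) + field_trace n x"
        by (simp only: field_trace_add)
      thus False using x(2) tr unfolding c form by simp
    qed
  qed
  moreover have "?h ` field_ext n \<subseteq> ?B"
    using e by (intro image_subsetI) (simp add: restrict_PiE_iff field_trace_range field_ext_closed)
  \<comment> \<open>The two sides have equal size, so injectivity already yields every tuple of
    values.\<close>
  moreover have "card ?B = card (field_ext n :: 'f alg_closure set)"
    using n by (simp add: card_PiE card_image inj_to_ac card_field_ext)
  moreover have "finite ?B" by (intro finite_PiE) auto
  ultimately have "?h ` field_ext n = ?B" by (intro card_subset_eq) (auto simp: card_image)
  moreover have "restrict (\<lambda>i. to_ac (b i)) {..<n} \<in> ?B" by auto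
  ultimately have "restrict (\<lambda>i. to_ac (b i)) {..<n} \<in> ?h ` field_ext n" by simp
  then obtain y where y: "restrict (\<lambda>i. to_ac (b i)) {..<n} = ?h y" "y \<in> field_ext n" by (rule imageE)
  show ?thesis
  proof (rule that[OF y(2)])
    fix i assume "i < n"
    with fun_cong[OF y(1), of i] show "field_trace n (y * e i) = to_ac (b i)" by simp
  qed
qed

section \<open>Linear equations over a chain ring\<close>

lemma card_eq_fibres:
  assumes "finite A" "finite B" "h ` A \<subseteq> B" "\<And>y. y \<in> B \<Longrightarrow> card {x \<in> A. h x = y} = k"
  shows "card A = card B * k"
proof -
  have "A = (\<Union>y\<in>B. {x \<in> A. h x = y})" using assms(3) by auto
  hence "card A = card (\<Union>y\<in>B. {x \<in> A. h x = y})" by simp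
  also have "\<dots> = (\<Sum>y\<in>B. card {x \<in> A. h x = y})"
    using assms(1,2) by (intro card_UN_disjoint) auto
  also have "\<dots> = card B * k" using assms(4) by simp
  finally show ?thesis .
qed

lemma card_additive_fibre:
  fixes h :: "'a::ab_group_add \<Rightarrow> 'b::ab_group_add"
  assumes "finite V" "\<And>v w. v \<in> V \<Longrightarrow> w \<in> V \<Longrightarrow> v + w \<in> V" "\<And>v w. v \<in> V \<Longrightarrow> w \<in> V \<Longrightarrow> v - w \<in> V"
    and h: "\<And>v w. v \<in> V \<Longrightarrow> w \<in> V \<Longrightarrow> h (v + w) = h v + h w"
  shows "card V = card (h ` V) * card {v \<in> V. h v = 0}"
proof (rule card_eq_fibres)
  fix c assume "c \<in> h ` V"
  then obtain v0 where v0: "v0 \<in> V" "h v0 = c" by auto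
  have "bij_betw (\<lambda>v. v + v0) {v \<in> V. h v = 0} {v \<in> V. h v = c}"
  proof (rule bij_betwI[where g = "\<lambda>v. v - v0"])
    show "(\<lambda>v. v - v0) \<in> {v \<in> V. h v = c} \<rightarrow> {v \<in> V. h v = 0}"
      using v0 assms h[of "v - v0" v0 for v] by (auto simp: Pi_iff)
  qed (use v0 assms in auto)
  from bij_betw_same_card[OF this] show "card {x \<in> V. h x = c} = card {v \<in> V. h v = 0}" by simp
qed (use assms in auto)

text \<open>Vectors of all dimensions together form no group, so the fibre count is redone inside
  one dimension, where subtraction cancels addition.\<close>

lemma card_additive_vec_fibre:
  fixes V :: "'a::ab_group_add vec set" and h :: "'a vec \<Rightarrow> 'b::ab_group_add"
  assumes "finite V" "V \<subseteq> carrier_vec n"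
    and "\<And>v w. v \<in> V \<Longrightarrow> w \<in> V \<Longrightarrow> v + w \<in> V" "\<And>v w. v \<in> V \<Longrightarrow> w \<in> V \<Longrightarrow> v - w \<in> V"
    and h: "\<And>v w. v \<in> V \<Longrightarrow> w \<in> V \<Longrightarrow> h (v + w) = h v + h w"
    and c: "c \<in> h ` V"
  shows "card V = card (h ` V) * card {v \<in> V. h v = c}"
proof -
  have *: "v - w + w = v" "v + w - w = v" if "v \<in> V" "w \<in> V" for v w
  proof -
    have "v \<in> carrier_vec n" "w \<in> carrier_vec n" using that assms(2) by auto
    thus "v - w + w = v" "v + w - w = v" by (auto intro!: eq_vecI)
  qed
  have fib: "card {v \<in> V. h v = d} = card {v \<in> V. h v = 0}" if "d \<in> h ` V" for d
  proof -
    from that obtain v0 where v0: "v0 \<in> V" "h v0 = d" by auto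
    have "bij_betw (\<lambda>v. v + v0) {v \<in> V. h v = 0} {v \<in> V. h v = d}"
    proof (rule bij_betwI[where g = "\<lambda>v. v - v0"])
      show "(\<lambda>v. v - v0) \<in> {v \<in> V. h v = d} \<rightarrow> {v \<in> V. h v = 0}"
      proof
        fix v assume "v \<in> {v \<in> V. h v = d}"
        hence v: "v \<in> V" "h v = d" by auto
        have "h v = h (v - v0) + h v0" using h[of "v - v0" v0] *(1)[OF v(1) v0(1)] v v0 assms by simp
        thus "v - v0 \<in> {v \<in> V. h v = 0}" using v v0 assms by simp
      qed
    qed (use v0 assms * in auto)
    from bij_betw_same_card[OF this] show ?thesis by simp
  qed
  show ?thesis
    by (rule card_eq_fibres) (use assms(1) fib c in auto)
qed

text \<open>Used with \<open>S\<close> the whole ring and with \<open>S\<close> the maximal ideal.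
  The latter gives exactly the vectors that are not unimodular, so counts of unimodular solutions
  become differences of two instances of one lemma.\<close>

definition vecs_in :: "'a set \<Rightarrow> nat \<Rightarrow> 'a vec set" where
  "vecs_in S n = {v \<in> carrier_vec n. \<forall>i<n. v $ i \<in> S}"

lemma vecs_in_UNIV [simp]: "vecs_in UNIV n = carrier_vec n"
  by (simp add: vecs_in_def)

lemma bij_betw_vecs_in: "bij_betw (vec n) ({..<n} \<rightarrow>\<^sub>E S) (vecs_in S n)"
proof (rule bij_betwI[where g = "\<lambda>v. restrict (vec_index v) {..<n}"])
  show "(\<lambda>v. restrict (vec_index v) {..<n}) \<in> vecs_in S n \<rightarrow> {..<n} \<rightarrow>\<^sub>E S"
    by (auto simp: vecs_in_def)
  fix f assume f: "f \<in> {..<n} \<rightarrow>\<^sub>E S"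
  show "restrict (vec_index (vec n f)) {..<n} = f"
  proof
    fix i show "restrict (vec_index (vec n f)) {..<n} i = f i"
      using PiE_arb[OF f, of i] by (cases "i < n") simp_all
  qed
next
  show "vec n \<in> ({..<n} \<rightarrow>\<^sub>E S) \<rightarrow> vecs_in S n"
  proof
    fix f assume "f \<in> {..<n} \<rightarrow>\<^sub>E S"
    hence "f i \<in> S" if "i < n" for i using that by (auto dest: PiE_mem)
    thus "vec n f \<in> vecs_in S n" by (simp add: vecs_in_def)
  qed
next
  fix v assume "v \<in> vecs_in S n"
  thus "vec n (restrict (vec_index v) {..<n}) = v"
    by (intro eq_vecI) (auto simp: vecs_in_def)
qed

lemma card_vecs_in: "card (vecs_in S n) = card S ^ n"
  using bij_betw_same_card[OF bij_betw_vecs_in[of n S]] by (simp add: card_PiE)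

lemma finite_vecs_in: "finite S \<Longrightarrow> finite (vecs_in S n)"
  using bij_betw_finite[OF bij_betw_vecs_in[of n S]] by (simp add: finite_PiE)

lemma finite_carrier_vec [simp]: "finite (carrier_vec n :: 'a::finite vec set)"
  using finite_vecs_in[of "UNIV :: 'a set" n] by simp

section \<open>Ideals as closed subsets\<close>

definition is_ideal_set :: "'a::comm_ring_1 set \<Rightarrow> bool" where
  "is_ideal_set S \<longleftrightarrow> 0 \<in> S \<and> (\<forall>x\<in>S. \<forall>y\<in>S. x + y \<in> S) \<and> (\<forall>x\<in>S. \<forall>r. r * x \<in> S)"

lemma a_inv_type_algebra: "\<ominus>\<^bsub>ring_of_type_algebra\<^esub> x = - (x :: 'a::comm_ring_1)"
proof -
  interpret cring "ring_of_type_algebra :: 'a ring" by (rule cring_from_type_algebra)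
  show ?thesis by (rule minus_equality) (simp_all add: ring_of_type_algebra_def)
qed

lemma is_ideal_set_iff: "is_ideal_set (S :: 'a::comm_ring_1 set) \<longleftrightarrow> ideal S ring_of_type_algebra"
proof
  let ?R = "ring_of_type_algebra :: 'a ring"
  interpret cring ?R by (rule cring_from_type_algebra)
  assume S: "is_ideal_set S"
  have neg: "- x \<in> S" if "x \<in> S" for x
    using S that unfolding is_ideal_set_def by (metis mult_minus1)
  show "ideal S ?R"
  proof (rule idealI)
    show "subgroup S (add_monoid ?R)"
    proof
      show "inv\<^bsub>add_monoid ?R\<^esub> x \<in> S" if "x \<in> S" for x
        using neg[OF that] a_inv_type_algebra[of x] by (simp add: a_inv_def)
    qed (use S in \<open>auto simp: is_ideal_set_def ring_of_type_algebra_def\<close>)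
  qed (use S in \<open>auto simp: is_ideal_set_def ring_of_type_algebra_def mult.commute intro: ring_axioms[unfolded ring_of_type_algebra_def]\<close>)
next
  let ?R = "ring_of_type_algebra :: 'a ring"
  assume "ideal S ?R"
  then interpret ideal S ?R .
  show "is_ideal_set S"
    using additive_subgroup.zero_closed[OF additive_subgroup_axioms]
      additive_subgroup.a_closed[OF additive_subgroup_axioms] I_l_closed
    by (auto simp: is_ideal_set_def ring_of_type_algebra_def)
qed

lemma is_ideal_set_diff: "is_ideal_set S \<Longrightarrow> x \<in> S \<Longrightarrow> y \<in> S \<Longrightarrow> x - y \<in> S"
  unfolding is_ideal_set_def by (metis diff_conv_add_uminus mult_minus1)

lemma is_ideal_set_sum:
  "is_ideal_set S \<Longrightarrow> (\<And>i. i \<in> A \<Longrightarrow> f i \<in> S) \<Longrightarrow> sum f A \<in> S"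
  by (induction A rule: infinite_finite_induct) (auto simp: is_ideal_set_def)

lemma is_ideal_set_UNIV: "is_ideal_set UNIV"
  by (simp add: is_ideal_set_def)

lemma is_ideal_set_scalar_prod:
  assumes "is_ideal_set S" "v \<in> vecs_in S n"
  shows "a \<bullet> v \<in> S"
  unfolding scalar_prod_def
  by (intro is_ideal_set_sum[OF assms(1)]) (use assms in \<open>auto simp: is_ideal_set_def vecs_in_def\<close>)

lemma vecs_in_closed:
  assumes "is_ideal_set S" "v \<in> vecs_in S n" "w \<in> vecs_in S n"
  shows "v + w \<in> vecs_in S n" "v - w \<in> vecs_in S n"
  using assms is_ideal_set_diff[OF assms(1)] by (auto simp: vecs_in_def is_ideal_set_def)

text \<open>What the counting arguments use of a finite valuation ring. The residue field is a type
  of its own, so that its algebraic closure can be formed; \<open>res\<close> with kernel generated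
  by \<open>\<pi>\<close>, together with the exact nilpotency degree \<open>l\<close>, stands for
  the ideal theory.\<close>

locale chain_ring =
  fixes \<pi> :: "'a::{comm_ring_1,finite}" and res :: "'a \<Rightarrow> 'f::finite_field" and l :: nat
  assumes res_add: "res (x + y) = res x + res y"
    and res_mult: "res (x * y) = res x * res y"
    and res_1 [simp]: "res 1 = 1"
    and surj_res: "surj res"
    and res_eq_0_iff: "res x = 0 \<longleftrightarrow> \<pi> dvd x"
    and pi_power_l: "\<pi> ^ l = 0"
    and pi_power_less: "k < l \<Longrightarrow> \<pi> ^ k \<noteq> 0"
    and l_pos: "l > 0"
begin

definition \<open>q = card (range res)\<close>

definition \<open>N = q ^ l\<close>

definition \<open>\<PP> = {x. res x = 0}\<close>

definition \<open>r = card \<PP>\<close>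

lemma res_0 [simp]: "res 0 = 0" using res_add[of 0 0] by (metis add_0 add_right_imp_eq)
lemma res_minus: "res (- x) = - res x" using res_add[of x "- x"] by (simp add: add_eq_0_iff)
lemma res_diff: "res (x - y) = res x - res y" using res_add[of x "- y"] by (simp add: res_minus)
lemma res_sum: "res (sum f A) = (\<Sum>i\<in>A. res (f i))"
  by (induction A rule: infinite_finite_induct) (simp_all add: res_add)
lemma res_scalar_prod: "res (a \<bullet> b) = (\<Sum>i<dim_vec b. res (a $ i) * res (b $ i))"
  by (simp add: scalar_prod_def res_sum res_mult atLeast0LessThan)

lemma obtain_lift: obtains x where "res x = s"
  using surj_res by (metis surjD)

text \<open>Lifting the inverse of the residue inverts \<open>x\<close> up to a factor
  \<open>1 - \<pi> * z\<close>, and a geometric series inverts this factor because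
  \<open>\<pi> * z\<close> is nilpotent.\<close>

lemma obtain_inverse:
  assumes "res x \<noteq> 0"
  obtains u where "u * x = 1"
proof -
  obtain y where y: "res y = inverse (res x)" by (rule obtain_lift)
  have "res (1 - x * y) = 0" using assms by (simp add: res_diff res_mult y)
  then obtain z where z: "1 - x * y = \<pi> * z" unfolding res_eq_0_iff by (elim dvdE)
  have "(1 - \<pi> * z) * (\<Sum>i<l. (\<pi> * z) ^ i) = 1 - (\<pi> * z) ^ l" by (rule one_diff_power_eq[symmetric])
  also have "\<dots> = 1" by (simp add: power_mult_distrib pi_power_l)
  also have "1 - \<pi> * z = x * y" by (simp add: z[symmetric])
  finally have "y * (\<Sum>i<l. (\<pi> * z) ^ i) * x = 1" by (simp add: mult_ac)
  thus ?thesis by (rule that)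
qed

lemma is_ideal_set_PP: "is_ideal_set \<PP>"
  by (simp add: is_ideal_set_def \<PP>_def res_add res_mult)

lemma card_residue_field: "CARD('f) = q"
  by (simp add: q_def surj_res)

lemma card_ring_eq: "CARD('a) = q * r"
proof -
  have "card (UNIV :: 'a set) = card (range res) * card {v \<in> UNIV. res v = 0}"
    by (rule card_additive_fibre) (auto simp: res_add)
  thus ?thesis by (simp add: q_def r_def \<PP>_def)
qed

lemma r_pos: "r > 0"
  using card_ring_eq finite_UNIV_card_ge_0[where ?'a = 'a] by (cases "r = 0") auto

text \<open>Let \<open>A k\<close> be the annihilator of \<open>\<pi> ^ k\<close>. For
  \<open>k < l\<close>, multiplication by \<open>\<pi>\<close> maps \<open>A (Suc k)\<close> onto
  \<open>A k\<close> with kernel \<open>A 1\<close>, so that \<open>A l\<close>, the whole ring, has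
  \<open>card (A 1) ^ l\<close> elements. On the whole ring the same map has kernel
  \<open>A 1\<close> and image \<open>\<PP>\<close>, hence \<open>card (A 1) = q\<close>.\<close>

lemma card_ring: "CARD('a) = N"
proof -
  define A where "A = (\<lambda>k. {x::'a. \<pi> ^ k * x = 0})"
  have closed: "v + w \<in> A k" "v - w \<in> A k" if "v \<in> A k" "w \<in> A k" for v w k
    using that by (auto simp: A_def algebra_simps)
  have img: "(\<lambda>x. \<pi> * x) ` A (Suc k) = A k" if "k < l" for k
  proof (intro equalityI subsetI)
    fix y assume y: "y \<in> A k"
    \<comment> \<open>A unit annihilated by \<open>\<pi> ^ k\<close> would force
      \<open>\<pi> ^ k = 0\<close>, against \<open>k < l\<close>.\<close>
    have "res y = 0"
    proof (rule ccontr)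
      assume "res y \<noteq> 0"
      then obtain u where "u * y = 1" by (rule obtain_inverse)
      hence "\<pi> ^ k = (u * y) * \<pi> ^ k" by simp
      also have "\<dots> = u * (\<pi> ^ k * y)" by (simp add: mult_ac)
      finally have "\<pi> ^ k = u * (\<pi> ^ k * y)" .
      thus False using y pi_power_less[OF that] by (simp add: A_def)
    qed
    then obtain x where "y = \<pi> * x" unfolding res_eq_0_iff by (elim dvdE)
    thus "y \<in> (\<lambda>x. \<pi> * x) ` A (Suc k)" using y by (auto simp: A_def mult_ac)
  qed (auto simp: A_def mult_ac)
  have step: "card (A (Suc k)) = card (A k) * card (A 1)" if "k < l" for k
  proof -
    have "card (A (Suc k)) = card ((\<lambda>x. \<pi> * x) ` A (Suc k)) * card {v \<in> A (Suc k). \<pi> * v = 0}"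
      by (rule card_additive_fibre) (auto simp: closed algebra_simps)
    also have "{v \<in> A (Suc k). \<pi> * v = 0} = A 1" by (auto simp: A_def power_Suc2 mult.assoc simp del: power_Suc)
    finally show ?thesis using img[OF that] by simp
  qed
  have "card (A k) = card (A 1) ^ k" if "k \<le> l" for k
    using that
  proof (induction k)
    case 0
    have "A 0 = {0}" by (auto simp: A_def)
    thus ?case by simp
  next
    case (Suc k)
    have "card (A (Suc k)) = card (A k) * card (A 1)" using Suc by (intro step) auto
    also have "card (A k) = card (A 1) ^ k" using Suc by auto
    finally show ?case by (simp only: power_Suc2)
  qed
  from this[of l] have N: "CARD('a) = card (A 1) ^ l" by (simp add: A_def pi_power_l)
  have "card (UNIV :: 'a set) = card (range (\<lambda>x. \<pi> * x)) * card {v \<in> UNIV. \<pi> * v = 0}"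
    by (rule card_additive_fibre) (auto simp: algebra_simps)
  also have "range (\<lambda>x. \<pi> * x) = \<PP>" by (auto simp: \<PP>_def res_eq_0_iff)
  also have "{v \<in> UNIV. \<pi> * v = 0} = A 1" by (simp add: A_def)
  finally have "q * r = card (A 1) * r" by (simp add: card_ring_eq r_def mult.commute)
  with N show ?thesis using r_pos by (simp add: N_def)
qed

lemma N_eq: "N = q * r"
  using card_ring card_ring_eq by simp

lemma q_ge_2: "q \<ge> 2"
  using card_finite_field_ge_2[where ?'f = 'f] by (simp add: card_residue_field)

lemma r_eq_power: "r = q ^ (l - 1)"
proof -
  obtain m where m: "l = Suc m" using l_pos gr0_conv_Suc by blast
  have "q * r = q ^ l" using N_eq N_def by simp
  also have "\<dots> = q * q ^ m" by (simp add: m)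
  finally have "q * r = q * q ^ m" .
  thus ?thesis using m q_ge_2 by simp
qed

section \<open>Unimodular vectors and linear equations\<close>

lemma unimodular_iff: "a \<in> unimodular n \<longleftrightarrow> a \<in> carrier_vec n \<and> (\<exists>i<n. res (a $ i) \<noteq> 0)"
proof -
  let ?R = "ring_of_type_algebra :: 'a ring"
  interpret cring ?R by (rule cring_from_type_algebra)
  have carr: "carrier ?R = UNIV" by (simp add: ring_of_type_algebra_def)
  have PP: "ideal \<PP> ?R" using is_ideal_set_PP by (simp add: is_ideal_set_iff)
  have "(Idl\<^bsub>?R\<^esub> (vec_set a) = UNIV) \<longleftrightarrow> (\<exists>i<n. res (a $ i) \<noteq> 0)" if a: "a \<in> carrier_vec n"
  proof
    assume gen: "Idl\<^bsub>?R\<^esub> (vec_set a) = UNIV"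
    show "\<exists>i<n. res (a $ i) \<noteq> 0"
    proof (rule ccontr)
      assume "\<not> (\<exists>i<n. res (a $ i) \<noteq> 0)"
      \<comment> \<open>Without a unit among the entries, the generated ideal stays inside the
        proper ideal \<open>\<PP>\<close>.\<close>
      hence "vec_set a \<subseteq> \<PP>" using a by (auto simp: vec_set_def \<PP>_def)
      from genideal_minimal[OF PP this] gen have "1 \<in> \<PP>" by auto
      thus False by (simp add: \<PP>_def)
    qed
  next
    assume "\<exists>i<n. res (a $ i) \<noteq> 0"
    then obtain i where i: "i < n" "res (a $ i) \<noteq> 0" by blast
    then obtain u where u: "u * a $ i = 1" using obtain_inverse by blast
    have id: "ideal (Idl\<^bsub>?R\<^esub> (vec_set a)) ?R" by (rule genideal_ideal) (simp add: carr)
    have "a $ i \<in> Idl\<^bsub>?R\<^esub> (vec_set a)"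
      using genideal_self[of "vec_set a"] a i by (auto simp: carr vec_set_def)
    from ideal.I_l_closed[OF id this, of u] have "\<one>\<^bsub>?R\<^esub> \<in> Idl\<^bsub>?R\<^esub> (vec_set a)"
      using u by (simp add: ring_of_type_algebra_def)
    from ideal.one_imp_carrier[OF id this] show "Idl\<^bsub>?R\<^esub> (vec_set a) = UNIV" by (simp add: carr)
  qed
  thus ?thesis by (auto simp: unimodular_def)
qed

lemma unimodular_carrier: "(a :: 'a vec) \<in> unimodular n \<Longrightarrow> a \<in> carrier_vec n"
  by (simp add: unimodular_iff)

lemma finite_unimodular [simp]: "finite (unimodular n :: 'a vec set)"
  by (rule finite_subset[of _ "carrier_vec n"]) (auto simp: unimodular_iff)

lemma not_unimodular: "carrier_vec n - unimodular n = vecs_in \<PP> n"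
  by (auto simp: unimodular_iff vecs_in_def \<PP>_def)

text \<open>A unit entry of \<open>a\<close> makes \<open>v \<mapsto> a \<bullet> v\<close> map the
  vectors over \<open>S\<close> onto \<open>S\<close>, and all fibres of an additive map have the
  same size.\<close>

lemma card_fibre_one:
  fixes a :: "'a vec"
  assumes a: "a \<in> unimodular n" and S: "is_ideal_set S" "c \<in> S"
  shows "card {v \<in> vecs_in S n. a \<bullet> v = c} = card S ^ (n - 1)"
proof -
  from a obtain i where i: "i < n" "res (a $ i) \<noteq> 0" and ac: "a \<in> carrier_vec n"
    by (auto simp: unimodular_iff)
  then obtain u where u: "u * a $ i = 1" using obtain_inverse by blast
  have img: "(\<lambda>v. a \<bullet> v) ` vecs_in S n = S"
  proof (intro equalityI subsetI)
    fix d assume d: "d \<in> S"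
    let ?v = "(u * d) \<cdot>\<^sub>v unit_vec n i"
    have "?v \<in> vecs_in S n" using d i S by (auto simp: vecs_in_def is_ideal_set_def unit_vec_def)
    moreover have "a \<bullet> ?v = d" using ac i u by (simp add: mult_ac)
    ultimately show "d \<in> (\<lambda>v. a \<bullet> v) ` vecs_in S n" by force
  qed (use S is_ideal_set_scalar_prod in auto)
  have "card (vecs_in S n) = card ((\<lambda>v. a \<bullet> v) ` vecs_in S n) * card {v \<in> vecs_in S n. a \<bullet> v = c}"
  proof (rule card_additive_vec_fibre[where n = n])
    show "a \<bullet> (v + w) = a \<bullet> v + a \<bullet> w" if "v \<in> vecs_in S n" "w \<in> vecs_in S n" for v w
      using that ac by (auto simp: vecs_in_def intro!: scalar_prod_add_distrib)
  qed (use vecs_in_closed[OF S(1)] S img in \<open>auto simp: finite_vecs_in vecs_in_def\<close>)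
  hence "card S * card S ^ (n - 1) = card S * card {v \<in> vecs_in S n. a \<bullet> v = c}"
    unfolding img card_vecs_in using i by (cases n) auto
  moreover have "S \<noteq> {}" using S by auto
  ultimately show ?thesis by simp
qed

definition cong_vec :: "nat \<Rightarrow> 'a vec \<Rightarrow> 'a vec \<Rightarrow> bool" where
  "cong_vec n a b \<longleftrightarrow> (\<forall>i<n. res (b $ i) = res (a $ i))"

definition prop_vec :: "nat \<Rightarrow> 'a vec \<Rightarrow> 'a vec \<Rightarrow> bool" where
  "prop_vec n a b \<longleftrightarrow> (\<exists>s. s \<noteq> 0 \<and> (\<forall>i<n. res (b $ i) = s * res (a $ i)))"

lemma cong_imp_prop: "cong_vec n a b \<Longrightarrow> prop_vec n a b"
  unfolding cong_vec_def prop_vec_def by (intro exI[of _ 1]) auto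

lemma cong_vec_refl [simp]: "cong_vec n a a"
  and cong_vec_sym: "cong_vec n a b \<Longrightarrow> cong_vec n b a"
  and prop_vec_refl [simp]: "prop_vec n a a"
  and prop_vec_sym: "prop_vec n a b \<Longrightarrow> prop_vec n b a"
  and prop_vec_trans: "prop_vec n a b \<Longrightarrow> prop_vec n b c \<Longrightarrow> prop_vec n a c"
proof -
  show "cong_vec n a a" "cong_vec n a b \<Longrightarrow> cong_vec n b a" by (auto simp: cong_vec_def)
  show "prop_vec n a a" unfolding prop_vec_def by (intro exI[of _ 1]) auto
  show "prop_vec n b a" if "prop_vec n a b"
  proof -
    from that obtain s where "s \<noteq> 0" "\<forall>i<n. res (b $ i) = s * res (a $ i)" by (auto simp: prop_vec_def)
    thus ?thesis unfolding prop_vec_def by (intro exI[of _ "inverse s"]) (auto simp: field_simps)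
  qed
  show "prop_vec n a c" if "prop_vec n a b" "prop_vec n b c"
  proof -
    from that obtain s t where "s \<noteq> 0" "\<forall>i<n. res (b $ i) = s * res (a $ i)"
      "t \<noteq> 0" "\<forall>i<n. res (c $ i) = t * res (b $ i)" by (auto simp: prop_vec_def)
    thus ?thesis unfolding prop_vec_def by (intro exI[of _ "t * s"]) auto
  qed
qed

text \<open>Subtracting a multiple of \<open>a\<close> from \<open>b\<close> clears the entry of \<open>b\<close> at a unit entry of \<open>a\<close>.\<close>

lemma card_fibre_two:
  fixes a b :: "'a vec"
  assumes a: "a \<in> unimodular n" and b: "b \<in> unimodular n" and np: "\<not> prop_vec n a b"
    and S: "is_ideal_set S" "c \<in> S" "d \<in> S"
  shows "card {v \<in> vecs_in S n. a \<bullet> v = c \<and> b \<bullet> v = d} = card S ^ (n - 2)"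
proof -
  from a obtain i where i: "i < n" "res (a $ i) \<noteq> 0" and ac: "a \<in> carrier_vec n"
    by (auto simp: unimodular_iff)
  from b have bc: "b \<in> carrier_vec n" by (auto simp: unimodular_iff)
  from i obtain u where u: "u * a $ i = 1" using obtain_inverse by blast
  have ru: "res u * res (a $ i) = 1" using u by (metis res_mult res_1)
  \<comment> \<open>Otherwise the residues of \<open>b\<close> would be
    \<open>res (b $ i * u)\<close> times those of \<open>a\<close>, with a nonzero factor because
    \<open>b\<close> is unimodular; this is proportionality.\<close>
  have "\<exists>j<n. res (b $ j - b $ i * u * a $ j) \<noteq> 0"
  proof (rule ccontr)
    assume "\<not> ?thesis"
    hence *: "\<forall>j<n. res (b $ j) = res (b $ i * u) * res (a $ j)" by (simp add: res_diff res_mult)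
    moreover have "res (b $ i * u) \<noteq> 0" using * b by (auto simp: unimodular_iff)
    ultimately show False using np by (auto simp: prop_vec_def)
  qed
  then obtain j where j: "j < n" "res (b $ j - b $ i * u * a $ j) \<noteq> 0" by blast
  then obtain w where w: "w * (b $ j - b $ i * u * a $ j) = 1" using obtain_inverse by blast
  have ij: "i \<noteq> j" using j ru by (auto simp: res_diff res_mult mult.assoc)
  let ?h = "\<lambda>v. (a \<bullet> v, b \<bullet> v)"
  have img: "?h ` vecs_in S n = S \<times> S"
  proof (intro equalityI subsetI)
    fix p assume "p \<in> S \<times> S"
    then obtain e f where p: "p = (e, f)" and ef: "e \<in> S" "f \<in> S" by auto
    \<comment> \<open>\<open>y\<close> solves the equation left after elimination, where position
      \<open>i\<close> has coefficient 0; \<open>x\<close> follows from the equation for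
      \<open>a\<close> by back substitution.\<close>
    define y where "y = w * (f - b $ i * u * e)"
    define x where "x = u * (e - a $ j * y)"
    have yS: "y \<in> S" using ef S is_ideal_set_diff[OF S(1)] by (auto simp: y_def is_ideal_set_def)
    have xS: "x \<in> S" using ef yS S is_ideal_set_diff[OF S(1)] by (auto simp: x_def is_ideal_set_def)
    let ?v = "x \<cdot>\<^sub>v unit_vec n i + y \<cdot>\<^sub>v unit_vec n j"
    have "?v \<in> vecs_in S n" using i j xS yS S by (auto simp: vecs_in_def is_ideal_set_def unit_vec_def)
    moreover have "a \<bullet> ?v = e"
    proof -
      have "a \<bullet> ?v = a $ i * x + a $ j * y" using ac i j
        by (subst scalar_prod_add_distrib[of _ n]) (auto simp: mult_ac)
      also have "\<dots> = (u * a $ i) * (e - a $ j * y) + a $ j * y" by (simp add: x_def mult_ac)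
      finally show ?thesis by (simp add: u)
    qed
    moreover have "b \<bullet> ?v = f"
    proof -
      have "b \<bullet> ?v = b $ i * x + b $ j * y" using bc i j
        by (subst scalar_prod_add_distrib[of _ n]) (auto simp: mult_ac)
      also have "\<dots> = b $ i * u * e + (b $ j - b $ i * u * a $ j) * y" by (simp add: x_def algebra_simps)
      also have "(b $ j - b $ i * u * a $ j) * y = (w * (b $ j - b $ i * u * a $ j)) * (f - b $ i * u * e)"
        by (simp add: y_def mult_ac)
      finally show ?thesis by (simp add: w)
    qed
    ultimately show "p \<in> ?h ` vecs_in S n" using p by force
  qed (use S is_ideal_set_scalar_prod in auto)
  have "card (vecs_in S n) = card (?h ` vecs_in S n) * card {v \<in> vecs_in S n. ?h v = (c, d)}"
  proof (rule card_additive_vec_fibre[where n = n])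
    show "?h (v + w) = ?h v + ?h w" if "v \<in> vecs_in S n" "w \<in> vecs_in S n" for v w
      using that ac bc by (auto simp: vecs_in_def intro!: scalar_prod_add_distrib)
  qed (use vecs_in_closed[OF S(1)] S img in \<open>auto simp: finite_vecs_in vecs_in_def\<close>)
  hence "card S ^ n = card S * card S * card {v \<in> vecs_in S n. a \<bullet> v = c \<and> b \<bullet> v = d}"
    unfolding img card_vecs_in by (simp add: card_cartesian_product)
  moreover have "n \<ge> 2" using i j ij by linarith
  hence "card S ^ n = card S * card S * card S ^ (n - 2)"
    by (metis le_add_diff_inverse power2_eq_square power_add)
  moreover have "S \<noteq> {}" using S by auto
  ultimately show ?thesis by simp
qed

text \<open>The lifts differ from \<open>a0\<close> by vectors \<open>d\<close> over
  \<open>\<PP>\<close> with \<open>b \<bullet> d = c - a0 \<bullet> b\<close>. The condition on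
  residues puts this right-hand side into \<open>\<PP>\<close>, so the count of solutions over the
  ideal applies.\<close>

lemma card_lifts:
  assumes a0: "a0 \<in> carrier_vec n" and b: "b \<in> unimodular n" and c: "res (a0 \<bullet> b) = res c"
  shows "card {a \<in> carrier_vec n. cong_vec n a0 a \<and> a \<bullet> b = c} = r ^ (n - 1)"
proof -
  have bc: "b \<in> carrier_vec n" using b by (simp add: unimodular_iff)
  have "bij_betw (\<lambda>d. d + a0) {d \<in> vecs_in \<PP> n. b \<bullet> d = c - a0 \<bullet> b}
     {a \<in> carrier_vec n. cong_vec n a0 a \<and> a \<bullet> b = c}"
  proof (rule bij_betwI[where g = "\<lambda>d. d - a0"])
    show "(\<lambda>d. d + a0) \<in> {d \<in> vecs_in \<PP> n. b \<bullet> d = c - a0 \<bullet> b} \<rightarrow>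
      {a \<in> carrier_vec n. cong_vec n a0 a \<and> a \<bullet> b = c}"
      using a0 bc by (auto simp: vecs_in_def cong_vec_def \<PP>_def res_add
        add_scalar_prod_distrib[of _ n] comm_scalar_prod[of b n])
    show "(\<lambda>d. d - a0) \<in> {a \<in> carrier_vec n. cong_vec n a0 a \<and> a \<bullet> b = c} \<rightarrow>
       {d \<in> vecs_in \<PP> n. b \<bullet> d = c - a0 \<bullet> b}"
      using a0 bc by (auto simp: vecs_in_def cong_vec_def \<PP>_def res_diff
        scalar_prod_minus_distrib[of _ n] comm_scalar_prod[of b n])
  qed (use a0 in \<open>auto simp: vecs_in_def intro!: eq_vecI\<close>)
  from bij_betw_same_card[OF this] have "card {a \<in> carrier_vec n. cong_vec n a0 a \<and> a \<bullet> b = c} =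
     card {d \<in> vecs_in \<PP> n. b \<bullet> d = c - a0 \<bullet> b}" by simp
  also have "\<dots> = r ^ (n - 1)" unfolding r_def
    by (rule card_fibre_one[OF b is_ideal_set_PP]) (use c in \<open>simp add: \<PP>_def res_diff\<close>)
  finally show ?thesis .
qed

lemma card_cong_class:
  assumes a0: "a0 \<in> carrier_vec n"
  shows "card {a \<in> carrier_vec n. cong_vec n a0 a} = r ^ n"
proof -
  have "bij_betw (\<lambda>d. d + a0) (vecs_in \<PP> n) {a \<in> carrier_vec n. cong_vec n a0 a}"
  proof (rule bij_betwI[where g = "\<lambda>d. d - a0"])
    show "(\<lambda>d. d + a0) \<in> vecs_in \<PP> n \<rightarrow> {a \<in> carrier_vec n. cong_vec n a0 a}"
      using a0 by (auto simp: vecs_in_def cong_vec_def \<PP>_def res_add)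
    show "(\<lambda>d. d - a0) \<in> {a \<in> carrier_vec n. cong_vec n a0 a} \<rightarrow> vecs_in \<PP> n"
      using a0 by (auto simp: vecs_in_def cong_vec_def \<PP>_def res_diff)
  qed (use a0 in \<open>auto simp: vecs_in_def intro!: eq_vecI\<close>)
  from bij_betw_same_card[OF this] show ?thesis using card_vecs_in[of \<PP> n] by (simp add: r_def)
qed

end

section \<open>Common neighbours\<close>

text \<open>Incident pairs are counted from either end. It turns row sums of codegrees into counts
  of lifts at each neighbour.\<close>

lemma double_count:
  assumes "finite A" "finite B"
  shows "(\<Sum>a\<in>A. of_bool (Q a) * real (card {b \<in> B. T b \<and> S a b})) =
    (\<Sum>b | b \<in> B \<and> T b. real (card {a \<in> A. Q a \<and> S a b}))"
proof -
  have "(\<Sum>a\<in>A. of_bool (Q a) * real (card {b \<in> B. T b \<and> S a b})) =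
    (\<Sum>a\<in>A. \<Sum>b\<in>B. of_bool (Q a) * of_bool (T b \<and> S a b))"
    using assms by (simp add: sum_distrib_left[symmetric] Int_def)
  also have "\<dots> = (\<Sum>b\<in>B. \<Sum>a\<in>A. of_bool (Q a) * of_bool (T b \<and> S a b))"
    by (rule sum.swap)
  also have "\<dots> = (\<Sum>b\<in>B. of_bool (T b) * (\<Sum>a\<in>A. of_bool (Q a \<and> S a b)))"
    unfolding sum_distrib_left by (intro sum.cong refl) auto
  also have "\<dots> = (\<Sum>b | b \<in> B \<and> T b. \<Sum>a\<in>A. of_bool (Q a \<and> S a b))"
    using assms(2) by (intro sum.mono_neutral_cong_right) auto
  also have "\<dots> = (\<Sum>b | b \<in> B \<and> T b. real (card {a \<in> A. Q a \<and> S a b}))"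
    using assms by (simp add: Int_def)
  finally show ?thesis .
qed

context chain_ring
begin

lemma unimodular_scalar_prod_comm:
  "(a :: 'a vec) \<in> unimodular n \<Longrightarrow> b \<in> unimodular n \<Longrightarrow> a \<bullet> b = b \<bullet> a"
  by (meson comm_scalar_prod unimodular_carrier)

text \<open>A dot product with a vector over \<open>\<PP>\<close> lies in \<open>\<PP>\<close>.
  Hence all solutions for right-hand side 1 are unimodular, while for right-hand side 0 the
  solutions over \<open>\<PP>\<close> must be subtracted.\<close>

lemma unimodular_of_scalar_prod:
  assumes "(b :: 'a vec) \<in> carrier_vec n" "res (a \<bullet> b) \<noteq> 0"
  shows "b \<in> unimodular n"
proof (rule ccontr)
  assume "b \<notin> unimodular n"
  hence "b \<in> vecs_in \<PP> n" using assms not_unimodular by blast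
  from is_ideal_set_scalar_prod[OF is_ideal_set_PP this] assms(2) show False by (simp add: \<PP>_def)
qed

lemma smult_unimodular:
  assumes "(a :: 'a vec) \<in> unimodular n" "res t \<noteq> 0"
  shows "t \<cdot>\<^sub>v a \<in> unimodular n"
  using assms by (auto simp: unimodular_iff res_mult)

lemma unimodular_nonempty: "n > 0 \<Longrightarrow> (unimodular n :: 'a vec set) \<noteq> {}"
proof -
  assume "n > 0"
  hence "unit_vec n 0 \<in> (unimodular n :: 'a vec set)" by (auto simp: unimodular_iff)
  thus ?thesis by blast
qed

lemma card_neighbours_one:
  assumes "(a :: 'a vec) \<in> unimodular n"
  shows "card {b \<in> unimodular n. a \<bullet> b = 1} = N ^ (n - 1)"
proof -
  have "{b \<in> unimodular n. a \<bullet> b = 1} = {b \<in> vecs_in UNIV n. a \<bullet> b = 1}"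
    using unimodular_of_scalar_prod[of _ n a] unimodular_carrier by auto
  thus ?thesis using card_fibre_one[OF assms is_ideal_set_UNIV, of 1] by (simp add: card_ring)
qed

text \<open>The remaining vectors are those over \<open>\<PP>\<close>. The form as a sum avoids
  subtraction of natural numbers.\<close>

lemma card_unimodular_split:
  "card {b \<in> unimodular n. Q b} + card {b \<in> vecs_in \<PP> n. Q b} = card {b :: 'a vec. b \<in> vecs_in UNIV n \<and> Q b}"
proof -
  have "{b. b \<in> vecs_in UNIV n \<and> Q b} = {b \<in> unimodular n. Q b} \<union> {b \<in> vecs_in \<PP> n. Q b}"
    using not_unimodular[of n] unimodular_carrier by auto
  thus ?thesis
    using not_unimodular[of n] by (simp only:) (intro card_Un_disjoint[symmetric]; auto simp: finite_vecs_in)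
qed

lemma card_unimodular: "card (unimodular n :: 'a vec set) + r ^ n = N ^ n"
  using card_unimodular_split[of n "\<lambda>_. True"] card_vecs_in[of "UNIV :: 'a set" n]
  by (simp add: card_vecs_in card_ring r_def)

lemma card_neighbours_zero:
  assumes "(a :: 'a vec) \<in> unimodular n"
  shows "card {b \<in> unimodular n. a \<bullet> b = 0} + r ^ (n - 1) = N ^ (n - 1)"
  using card_unimodular_split[of n "\<lambda>b. a \<bullet> b = 0"] card_fibre_one[OF assms is_ideal_set_UNIV, of 0]
    card_fibre_one[OF assms is_ideal_set_PP, of 0]
  by (simp add: card_ring r_def \<PP>_def)

abbreviation common :: "nat \<Rightarrow> 'a \<Rightarrow> 'a vec \<Rightarrow> 'a vec \<Rightarrow> nat" where
  "common n c a a' \<equiv> card {b \<in> unimodular n. a \<bullet> b = c \<and> a' \<bullet> b = c}"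

lemma card_common_neighbours_zero:
  assumes "(a :: 'a vec) \<in> unimodular n" "a' \<in> unimodular n" "\<not> prop_vec n a a'"
  shows "common n 0 a a' + r ^ (n - 2) = N ^ (n - 2)"
  using card_unimodular_split[of n "\<lambda>b. a \<bullet> b = 0 \<and> a' \<bullet> b = 0"]
    card_fibre_two[OF assms is_ideal_set_UNIV, of 0 0] card_fibre_two[OF assms is_ideal_set_PP, of 0 0]
  by (simp add: card_ring r_def \<PP>_def)

definition prop_class :: "nat \<Rightarrow> 'a vec \<Rightarrow> 'a vec set" where
  "prop_class n a = {a' \<in> unimodular n. prop_vec n a a'}"

lemma prop_class_eq_iff:
  "a \<in> unimodular n \<Longrightarrow> a' \<in> unimodular n \<Longrightarrow> prop_class n a = prop_class n a' \<longleftrightarrow> prop_vec n a a'"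
  unfolding prop_class_def using prop_vec_refl prop_vec_sym prop_vec_trans by blast

text \<open>For vectors that are not proportional, the two equations are independent and have
  \<open>N ^ (n - 2)\<close> common solutions. If \<open>a'\<close> is \<open>s\<close> times
  \<open>a\<close> modulo \<open>\<PP>\<close>, a common neighbour forces \<open>s = 1\<close>; so
  proportional but incongruent vectors have none, and \<open>c0 = c\<close> cancels the constant
  there. Congruent pairs go into \<open>B\<close>, whose row sum counts the
  \<open>N ^ (n - 1)\<close> neighbours \<open>b\<close> of \<open>a\<close> and, for each of them,
  \<open>r ^ (n - 1)\<close> congruent vectors adjacent to \<open>b\<close>.\<close>

lemma um_codegree_decomposition:
  "codegree_decomposition (unimodular n) (\<lambda>a b. a \<bullet> b = 1) (prop_class n)
    (\<lambda>a a'. of_bool (cong_vec n a a') * real (common n 1 a a'))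
    (real N ^ (n - 2)) (real N ^ (n - 2)) (real N ^ (n - 1) * real r ^ (n - 1))"
proof
  fix a a' :: "'a vec" assume a: "a \<in> unimodular n" and a': "a' \<in> unimodular n"
  have "real (common n 1 a a') = real N ^ (n - 2)" if "\<not> prop_vec n a a'"
  proof -
    have "{b \<in> unimodular n. a \<bullet> b = 1 \<and> a' \<bullet> b = 1} = {b \<in> vecs_in UNIV n. a \<bullet> b = 1 \<and> a' \<bullet> b = 1}"
      using unimodular_of_scalar_prod[of _ n a] unimodular_carrier by auto
    thus ?thesis using card_fibre_two[OF a a' that is_ideal_set_UNIV, of 1 1] by (simp add: card_ring)
  qed
  moreover have "common n 1 a a' = 0"
    if "prop_vec n a a'" "\<not> cong_vec n a a'"
  proof -
    from that(1) obtain s where s: "\<forall>i<n. res (a' $ i) = s * res (a $ i)" by (auto simp: prop_vec_def)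
    have False if b: "b \<in> unimodular n" "a \<bullet> b = 1" "a' \<bullet> b = 1" for b
    proof -
      have "dim_vec b = n" using unimodular_carrier[OF b(1)] by simp
      hence "res (a' \<bullet> b) = s * res (a \<bullet> b)"
        using s by (simp add: res_scalar_prod sum_distrib_left mult.assoc)
      hence "s = 1" using b by simp
      thus False using s \<open>\<not> cong_vec n a a'\<close> by (simp add: cong_vec_def)
    qed
    thus ?thesis by auto
  qed
  moreover have "prop_vec n a a'" if "cong_vec n a a'" using that by (rule cong_imp_prop)
  ultimately show "real (common n 1 a a') =
      real N ^ (n - 2) - real N ^ (n - 2) * of_bool (prop_class n a = prop_class n a') +
      of_bool (cong_vec n a a') * real (common n 1 a a')"
    unfolding prop_class_eq_iff[OF a a'] by (cases "prop_vec n a a'"; cases "cong_vec n a a'") auto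
next
  fix a :: "'a vec" assume a: "a \<in> unimodular n"
  have "(\<Sum>a'\<in>unimodular n. of_bool (cong_vec n a a') *
      real (common n 1 a a')) =
    (\<Sum>b | b \<in> unimodular n \<and> a \<bullet> b = 1. real (card {a' \<in> unimodular n. cong_vec n a a' \<and> a' \<bullet> b = 1}))"
    by (rule double_count) auto
  also have "\<dots> = (\<Sum>b | b \<in> unimodular n \<and> a \<bullet> b = 1. real (r ^ (n - 1)))"
  proof (intro sum.cong refl)
    fix b assume "b \<in> {b. b \<in> unimodular n \<and> a \<bullet> b = 1}"
    hence b: "b \<in> unimodular n" "a \<bullet> b = 1" by auto
    have "{a' \<in> unimodular n. cong_vec n a a' \<and> a' \<bullet> b = 1} =
       {a' \<in> carrier_vec n. cong_vec n a a' \<and> a' \<bullet> b = 1}"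
      using a by (auto simp: unimodular_iff cong_vec_def)
    thus "real (card {a' \<in> unimodular n. cong_vec n a a' \<and> a' \<bullet> b = 1}) = real (r ^ (n - 1))"
      using card_lifts[OF unimodular_carrier[OF a] b(1), of 1] b(2) by simp
  qed
  also have "\<dots> = real N ^ (n - 1) * real r ^ (n - 1)"
    using card_neighbours_one[OF a] by simp
  finally show "(\<Sum>a'\<in>unimodular n. of_bool (cong_vec n a a') *
      real (common n 1 a a')) = real N ^ (n - 1) * real r ^ (n - 1)" .
qed auto

text \<open>The proportionality class splits into \<open>q - 1\<close> congruence classes, one for
  each nonzero residue and each represented by a multiple of \<open>a\<close>.\<close>

lemma card_prop_class:
  assumes a: "a \<in> unimodular n"
    and k: "\<And>t. res t \<noteq> 0 \<Longrightarrow> card {a' \<in> carrier_vec n. cong_vec n (t \<cdot>\<^sub>v a) a' \<and> Q a'} = k"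
  shows "card {a' \<in> unimodular n. prop_vec n a a' \<and> Q a'} = (q - 1) * k"
proof -
  define T where "T = (\<lambda>s. SOME t. res t = s)"
  have T: "res (T s) = s" for s unfolding T_def by (rule someI_ex) (metis obtain_lift)
  define Z where "Z = (\<lambda>s. {a' \<in> carrier_vec n. cong_vec n (T s \<cdot>\<^sub>v a) a' \<and> Q a'})"
  from a obtain i where i: "i < n" "res (a $ i) \<noteq> 0" and ac: "a \<in> carrier_vec n"
    by (auto simp: unimodular_iff)
  have cong: "cong_vec n (T s \<cdot>\<^sub>v a) a' \<longleftrightarrow> (\<forall>i<n. res (a' $ i) = s * res (a $ i))" for s a'
    using ac by (simp add: cong_vec_def res_mult T)
  have "{a' \<in> unimodular n. prop_vec n a a' \<and> Q a'} = (\<Union>s\<in>UNIV - {0}. Z s)"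
  proof (intro equalityI subsetI)
    fix a' assume "a' \<in> {a' \<in> unimodular n. prop_vec n a a' \<and> Q a'}"
    thus "a' \<in> (\<Union>s\<in>UNIV - {0}. Z s)"
      by (auto simp: Z_def cong prop_vec_def unimodular_carrier)
  next
    fix a' assume "a' \<in> (\<Union>s\<in>UNIV - {0}. Z s)"
    then obtain s where s: "s \<noteq> 0" "a' \<in> carrier_vec n" "\<forall>i<n. res (a' $ i) = s * res (a $ i)" "Q a'"
      by (auto simp: Z_def cong)
    have "res (a' $ i) \<noteq> 0" using s i by simp
    with s i show "a' \<in> {a' \<in> unimodular n. prop_vec n a a' \<and> Q a'}"
      by (auto simp: unimodular_iff prop_vec_def)
  qed
  hence "card {a' \<in> unimodular n. prop_vec n a a' \<and> Q a'} = card (\<Union>s\<in>UNIV - {0}. Z s)" by simp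
  also have "\<dots> = (\<Sum>s\<in>UNIV - {0}. card (Z s))"
  proof (intro card_UN_disjoint ballI impI)
    fix s t :: 'f assume "s \<noteq> t"
    thus "Z s \<inter> Z t = {}" using i by (auto simp: Z_def cong)
  qed (auto simp: Z_def)
  also have "\<dots> = (\<Sum>s\<in>UNIV - {0 :: 'f}. k)"
    by (intro sum.cong refl) (auto simp: Z_def k T)
  also have "\<dots> = (q - 1) * k" by (simp add: card_Diff_singleton card_residue_field)
  finally show ?thesis .
qed

text \<open>Proportional vectors have at least as many common neighbours as independent ones: after
  clearing an entry and dividing by a power of \<open>\<pi>\<close>, the second vector becomes independent of the
  first, and its orthogonal complement only shrinks.\<close>

lemma card_common_neighbours_zero_ge:
  assumes a: "(a :: 'a vec) \<in> unimodular n" and a': "a' \<in> unimodular n" and n: "n \<ge> 2"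
  shows "N ^ (n - 2) \<le> common n 0 a a' + r ^ (n - 2)"
proof -
  from a obtain i where i: "i < n" "res (a $ i) \<noteq> 0" and ac: "a \<in> carrier_vec n"
    by (auto simp: unimodular_iff)
  have ac': "a' \<in> carrier_vec n" using a' by (rule unimodular_carrier)
  from i obtain u where u: "u * a $ i = 1" using obtain_inverse by blast
  define d where "d = (\<lambda>j. a' $ j - a' $ i * u * a $ j)"
  have di: "d i = 0" using u by (simp add: d_def mult.assoc)
  obtain k c where c: "\<And>j. j < n \<Longrightarrow> d j = \<pi> ^ k * c j" "c i = 0" "\<exists>j<n. res (c j) \<noteq> 0"
  proof (cases "\<forall>j<n. d j = 0")
    case True
    \<comment> \<open>Here \<open>a'\<close> is a multiple of \<open>a\<close>, and
      \<open>k = l\<close> makes \<open>\<pi> ^ k\<close> vanish. Any unimodular \<open>c\<close>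
      with entry 0 at \<open>i\<close> will do; \<open>n \<ge> 2\<close> provides a second position
      for its unit entry.\<close>
    define j where "j = (if i = 0 then 1 else 0 :: nat)"
    have "j < n" "j \<noteq> i" using n by (auto simp: j_def)
    thus ?thesis using True by (intro that[of l "\<lambda>m. if m = j then 1 else 0"]) (auto simp: pi_power_l)
  next
    case False
    \<comment> \<open>Its maximum is the largest exponent up to \<open>l\<close> whose power divides
      all entries of \<open>d\<close>; by maximality the quotients cannot all be nonunits.\<close>
    define A where "A = {k. k \<le> l \<and> (\<forall>j<n. \<pi> ^ k dvd d j)}"
    have A: "finite A" "0 \<in> A" by (auto simp: A_def)
    define k where "k = Max A"
    have kA: "k \<in> A" unfolding k_def using A by (intro Max_in) auto
    have "k \<noteq> l" using False kA by (auto simp: A_def pi_power_l)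
    hence kl: "Suc k \<le> l" using kA by (auto simp: A_def)
    have "\<exists>c. d j = \<pi> ^ k * c" if "j < n" for j using kA that by (auto simp: A_def dvd_def)
    then obtain c where c: "\<And>j. j < n \<Longrightarrow> d j = \<pi> ^ k * c j" by metis
    \<comment> \<open>Quotients by \<open>\<pi> ^ k\<close> are not unique. Since
      \<open>d i = 0\<close>, the one at \<open>i\<close> can be taken to be 0, which keeps the new
      vector from being proportional to \<open>a\<close>.\<close>
    define c' where "c' = c(i := 0)"
    have c': "d j = \<pi> ^ k * c' j" if "j < n" for j using c[OF that] di by (auto simp: c'_def)
    have "\<exists>j<n. res (c' j) \<noteq> 0"
    proof (rule ccontr)
      assume "\<not> (\<exists>j<n. res (c' j) \<noteq> 0)"
      hence "\<pi> ^ Suc k dvd d j" if "j < n" for j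
        using that c'[OF that] by (auto simp: res_eq_0_iff mult.commute[of \<pi>] intro!: mult_dvd_mono)
      hence "Suc k \<in> A" using kl by (auto simp: A_def)
      from Max_ge[OF A(1) this] show False by (simp add: k_def)
    qed
    thus ?thesis using c' by (intro that[of k c']) (auto simp: c'_def)
  qed
  define w where "w = vec n c"
  have w: "w \<in> unimodular n" using c(3) by (auto simp: w_def unimodular_iff)
  have "\<not> prop_vec n a w"
  proof
    assume "prop_vec n a w"
    then obtain s where "s \<noteq> 0" "res (w $ i) = s * res (a $ i)" using i by (auto simp: prop_vec_def)
    thus False using i c(2) by (simp add: w_def)
  qed
  from card_common_neighbours_zero[OF a w this]
  have "N ^ (n - 2) = common n 0 a w + r ^ (n - 2)" by simp
  moreover have "{b \<in> unimodular n. a \<bullet> b = 0 \<and> w \<bullet> b = 0} \<subseteq> {b \<in> unimodular n. a \<bullet> b = 0 \<and> a' \<bullet> b = 0}"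
  proof clarify
    fix b assume b: "b \<in> unimodular n" "a \<bullet> b = 0" "w \<bullet> b = 0"
    have dim: "dim_vec b = n" using unimodular_carrier[OF b(1)] by simp
    have "a' \<bullet> b = (\<Sum>j<n. d j * b $ j + (a' $ i * u) * (a $ j * b $ j))"
      by (simp add: scalar_prod_def dim atLeast0LessThan d_def algebra_simps)
    also have "\<dots> = (\<Sum>j<n. \<pi> ^ k * (w $ j * b $ j) + (a' $ i * u) * (a $ j * b $ j))"
      by (intro sum.cong refl) (simp add: c(1) w_def mult.assoc)
    also have "\<dots> = \<pi> ^ k * (w \<bullet> b) + (a' $ i * u) * (a \<bullet> b)"
      by (simp add: scalar_prod_def dim atLeast0LessThan sum.distrib sum_distrib_left)
    finally show "a' \<bullet> b = 0" using b by simp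
  qed
  hence "common n 0 a w \<le> common n 0 a a'"
    by (intro card_mono) auto
  ultimately show ?thesis by simp
qed

text \<open>Proportional vectors have at least \<open>c\<close> common neighbours, so the excess
  over \<open>c\<close> is itself nonnegative and no negative term is split off:
  \<open>c0 = 0\<close>. The row sum is
  \<open>(N ^ (n - 1) - r ^ (n - 1)) * (q - 1) * r ^ (n - 1)\<close> minus \<open>c\<close> times
  the class size \<open>(q - 1) * r ^ n\<close>; with \<open>N = q * r\<close> it collapses to the
  stated product.\<close>

lemma um0_codegree_decomposition:
  fixes n :: nat
  assumes n: "n \<ge> 2"
  defines "c \<equiv> real N ^ (n - 2) - real r ^ (n - 2)"
  shows "codegree_decomposition (unimodular n) (\<lambda>a b. a \<bullet> b = 0) (\<lambda>_. ())
    (\<lambda>a a'. of_bool (prop_vec n a a') * (real (common n 0 a a') - c))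
    c 0 (((real q - 1) * real r ^ (n - 1))\<^sup>2 * real q ^ (n - 2))"
proof
  fix a a' :: "'a vec" assume a: "a \<in> unimodular n" and a': "a' \<in> unimodular n"
  have "real (common n 0 a a') = c" if "\<not> prop_vec n a a'"
    using card_common_neighbours_zero[OF a a' that] unfolding c_def
    by (simp add: of_nat_add[symmetric] eq_diff_eq flip: of_nat_power)
  thus "real (common n 0 a a') = c - 0 * of_bool (() = ()) +
     of_bool (prop_vec n a a') * (real (common n 0 a a') - c)"
    by (cases "prop_vec n a a'") auto
  have "real (N ^ (n - 2)) \<le> real (common n 0 a a' + r ^ (n - 2))"
    using card_common_neighbours_zero_ge[OF a a' n] by (rule of_nat_mono)
  thus "0 \<le> of_bool (prop_vec n a a') * (real (common n 0 a a') - c)"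
    by (intro mult_nonneg_nonneg) (auto simp: c_def)
next
  fix a :: "'a vec" assume a: "a \<in> unimodular n"
  obtain m where m: "n = Suc (Suc m)" using n by (metis add_2_eq_Suc le_Suc_ex)
  have q1: "real (q - Suc 0) = real q - 1" using q_ge_2 by simp
  have c1: "card {a' \<in> unimodular n. prop_vec n a a' \<and> a' \<bullet> b = 0} = (q - 1) * r ^ (n - 1)"
    if b: "b \<in> unimodular n" "a \<bullet> b = 0" for b
  proof (rule card_prop_class[OF a])
    fix t :: 'a
    have "(t \<cdot>\<^sub>v a) \<bullet> b = 0"
      using b unimodular_carrier[OF a] unimodular_carrier[OF b(1)] by simp
    thus "card {a' \<in> carrier_vec n. cong_vec n (t \<cdot>\<^sub>v a) a' \<and> a' \<bullet> b = 0} = r ^ (n - 1)"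
      using unimodular_carrier[OF a] by (intro card_lifts[OF _ b(1)]) auto
  qed
  have c2: "card {a' \<in> unimodular n. prop_vec n a a' \<and> True} = (q - 1) * r ^ n"
    using unimodular_carrier[OF a] by (intro card_prop_class[OF a]) (simp add: card_cong_class)
  have D: "real (card {b \<in> unimodular n. a \<bullet> b = 0}) = real N ^ (n - 1) - real r ^ (n - 1)"
    using card_neighbours_zero[OF a] by (simp add: eq_diff_eq flip: of_nat_power of_nat_add)
  have "(\<Sum>a'\<in>unimodular n. of_bool (prop_vec n a a') * (real (common n 0 a a') - c))
    = (\<Sum>a'\<in>unimodular n. of_bool (prop_vec n a a') * real (common n 0 a a'))
     - (\<Sum>a'\<in>unimodular n. of_bool (prop_vec n a a')) * c"
    by (simp add: right_diff_distrib sum_subtractf sum_distrib_right del: sum_of_bool_eq)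
  also have "(\<Sum>a'\<in>unimodular n. of_bool (prop_vec n a a')) = real ((q - 1) * r ^ n)"
    using c2 by (simp add: Int_def)
  also have "(\<Sum>a'\<in>unimodular n. of_bool (prop_vec n a a') * real (common n 0 a a')) =
    (\<Sum>b | b \<in> unimodular n \<and> a \<bullet> b = 0. real (card {a' \<in> unimodular n. prop_vec n a a' \<and> a' \<bullet> b = 0}))"
    by (rule double_count) auto
  also have "\<dots> = (\<Sum>b | b \<in> unimodular n \<and> a \<bullet> b = 0. real ((q - 1) * r ^ (n - 1)))"
    by (intro sum.cong refl) (simp add: c1)
  also have "\<dots> = (real N ^ (n - 1) - real r ^ (n - 1)) * ((real q - 1) * real r ^ (n - 1))"
    by (simp add: D q1)
  also have "\<dots> - real ((q - 1) * r ^ n) * c = ((real q - 1) * real r ^ (n - 1))\<^sup>2 * real q ^ (n - 2)"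
    unfolding c_def m by (simp add: q1 N_eq power_mult_distrib) (simp add: algebra_simps power2_eq_square)
  finally show "(\<Sum>a'\<in>unimodular n. of_bool (prop_vec n a a') *
      (real (common n 0 a a') - c)) =
    ((real q - 1) * real r ^ (n - 1))\<^sup>2 * real q ^ (n - 2)" .
qed auto

end

section \<open>The graph of equations with right-hand side one\<close>

context chain_ring
begin

lemma Um_eq: "(Um n :: ('a vec + 'a vec) ugraph) = bipartite_graph (unimodular n) (\<lambda>a b. a \<bullet> b = 1)"
  by (simp add: Um_def bipartite_graph_def)

lemma um_regular:
  assumes "n > 0"
  shows "regular_bipartite (unimodular n :: 'a vec set) (\<lambda>a b. a \<bullet> b = 1) (N ^ (n - 1))"
proof
  fix b :: "'a vec" assume b: "b \<in> unimodular n"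
  have "{a \<in> unimodular n. a \<bullet> b = 1} = {a \<in> unimodular n. b \<bullet> a = 1}"
    using b unimodular_scalar_prod_comm by auto
  thus "card {a \<in> unimodular n. a \<bullet> b = 1} = N ^ (n - 1)" using card_neighbours_one[OF b] by simp
qed (use assms unimodular_nonempty card_neighbours_one in auto)

lemma r_le_N: "r \<le> N" using N_eq q_ge_2 by simp

lemma N_pos: "N > 0" using r_le_N r_pos by simp

definition um_lam :: "nat \<Rightarrow> real" where
  "um_lam n = sqrt (real N ^ (n - 1) * real r ^ (n - 1))"

lemma um_lam_pos: "um_lam n > 0"
  using N_pos r_pos by (simp add: um_lam_def)

lemma um_lam_squared: "(um_lam n)\<^sup>2 = real N ^ (n - 1) * real r ^ (n - 1)"
  unfolding um_lam_def by (rule real_sqrt_pow2) simp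

lemma um_iso_ge:
  assumes "n > 0"
  shows "iso_const (Um n :: ('a vec + 'a vec) ugraph) \<ge> (real N ^ (n - 1) - um_lam n) / 2"
proof -
  interpret regular_bipartite "unimodular n :: 'a vec set" "\<lambda>a b. a \<bullet> b = 1" "N ^ (n - 1)"
    by (rule um_regular[OF assms])
  have "um_lam n \<le> sqrt (real N ^ (n - 1) * real N ^ (n - 1))"
    unfolding um_lam_def using r_le_N by (intro real_sqrt_le_mono mult_left_mono power_mono) auto
  hence "um_lam n \<le> real (N ^ (n - 1))" by simp
  from iso_const_ge[OF um_lam_pos this] codegree_decomposition.sum_squares_le[OF um_codegree_decomposition]
  show ?thesis unfolding Um_eq um_lam_squared by simp
qed

section \<open>Character functions on vectors\<close>

lemma obtain_field_coordinates:
  assumes n: "n > 0"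
  obtains phi :: "'a vec \<Rightarrow> 'f alg_closure" where
    "\<And>a. a \<in> carrier_vec n \<Longrightarrow> phi a \<in> field_ext n"
    "\<And>a b. a \<in> carrier_vec n \<Longrightarrow> b \<in> carrier_vec n \<Longrightarrow> phi a = phi b \<longleftrightarrow> cong_vec n a b"
    "\<And>x. x \<in> field_ext n \<Longrightarrow> \<exists>a\<in>carrier_vec n. phi a = x"
    "\<And>t a. a \<in> carrier_vec n \<Longrightarrow> phi (t \<cdot>\<^sub>v a) = to_ac (res t) * phi a"
    "\<And>b. b \<in> carrier_vec n \<Longrightarrow>
      \<exists>y\<in>field_ext n. \<forall>a\<in>carrier_vec n. field_trace n (y * phi a) = to_ac (res (a \<bullet> b))"
proof -
  obtain e :: "nat \<Rightarrow> 'f alg_closure" where e: "\<And>i. i < n \<Longrightarrow> e i \<in> field_ext n"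
    and bij: "bij_betw (\<lambda>c. \<Sum>i<n. to_ac (c i) * e i) ({..<n} \<rightarrow>\<^sub>E UNIV) (field_ext n)"
    by (rule field_ext_basis[OF n]) blast
  let ?h = "\<lambda>c. \<Sum>i<n. to_ac (c i) * e i"
  define phi where "phi = (\<lambda>a :: 'a vec. ?h (\<lambda>i. res (a $ i)))"
  have phi_restrict: "phi a = ?h (restrict (\<lambda>i. res (a $ i)) {..<n})" for a by (simp add: phi_def)
  show ?thesis
  proof (rule that[of phi])
    fix a :: "'a vec" assume a: "a \<in> carrier_vec n"
    show "phi a \<in> field_ext n" unfolding phi_def
      by (intro field_ext_sum) (auto intro!: field_ext_closed e)
    show "phi (t \<cdot>\<^sub>v a) = to_ac (res t) * phi a" for t
      using a by (simp add: phi_def res_mult sum_distrib_left mult.assoc)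
    show "phi a = phi b \<longleftrightarrow> cong_vec n a b" if b: "b \<in> carrier_vec n" for b
    proof
      assume "phi a = phi b"
      hence "restrict (\<lambda>i. res (a $ i)) {..<n} = restrict (\<lambda>i. res (b $ i)) {..<n}"
        unfolding phi_restrict
        by (rule inj_onD[OF bij_betw_imp_inj_on[OF bij]]) (auto simp only: restrict_PiE_iff)
      from fun_cong[OF this] show "cong_vec n a b"
        unfolding cong_vec_def by (metis lessThan_iff restrict_apply')
    qed (simp add: phi_def cong_vec_def)
  next
    fix x :: "'f alg_closure" assume "x \<in> field_ext n"
    then obtain c where c: "x = ?h c" using bij unfolding bij_betw_def by blast
    define T where "T = (\<lambda>s. SOME t. res t = s)"
    have T: "res (T s) = s" for s unfolding T_def by (rule someI_ex) (metis obtain_lift)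
    show "\<exists>a\<in>carrier_vec n. phi a = x"
      by (rule bexI[of _ "vec n (\<lambda>i. T (c i))"]) (simp_all add: phi_def c T)
  next
    fix b :: "'a vec" assume b: "b \<in> carrier_vec n"
    \<comment> \<open>The basis need not be self-dual, so \<open>b\<close> is not sent through
      \<open>phi\<close>; the element dual to the residues of \<open>b\<close> represents the form
      \<open>a \<mapsto> a \<bullet> b\<close> instead.\<close>
    obtain y where y: "y \<in> field_ext n" "\<And>i. i < n \<Longrightarrow> field_trace n (y * e i) = to_ac (res (b $ i))"
      using field_ext_dual[OF n e bij, where b = "\<lambda>i. res (b $ i)"] by blast
    have "field_trace n (y * phi a) = to_ac (res (a \<bullet> b))" for a
    proof -
      have "field_trace n (y * phi a) = (\<Sum>i<n. to_ac (res (a $ i)) * field_trace n (y * e i))"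
        unfolding phi_def sum_distrib_left field_trace_sum mult.left_commute[of y] field_trace_scale ..
      also have "\<dots> = to_ac (res (a \<bullet> b))" using b by (simp add: y(2) res_scalar_prod to_ac_sum)
      finally show ?thesis .
    qed
    thus "\<exists>y\<in>field_ext n. \<forall>a\<in>carrier_vec n. field_trace n (y * phi a) = to_ac (res (a \<bullet> b))"
      using y(1) by blast
  qed
qed

definition res_char :: "'a \<Rightarrow> real" where
  "res_char t = quad_char 1 (to_ac (res t))"

text \<open>The quadratic character of the degree \<open>n\<close> extension of the residue field, transported to
  vectors. Its sums over the neighbourhoods have constant absolute value because multiplication by
  field elements permutes the hyperplanes transitively.\<close>

lemma obtain_character:
  assumes n: "n > 0" and odd: "odd q"
  obtains f :: "'a vec \<Rightarrow> real" and G :: "'f \<Rightarrow> real" and sg :: "'a vec \<Rightarrow> real" where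
    "\<And>a. a \<in> unimodular n \<Longrightarrow> f a \<in> {1, -1}"
    "\<And>a. a \<in> carrier_vec n \<Longrightarrow> a \<notin> unimodular n \<Longrightarrow> f a = 0"
    "\<And>a b. a \<in> carrier_vec n \<Longrightarrow> b \<in> carrier_vec n \<Longrightarrow> cong_vec n a b \<Longrightarrow> f b = f a"
    "\<And>t a. Parity.odd n \<Longrightarrow> a \<in> carrier_vec n \<Longrightarrow> f (t \<cdot>\<^sub>v a) = res_char t * f a"
    "\<And>t a. even n \<Longrightarrow> a \<in> carrier_vec n \<Longrightarrow> res t \<noteq> 0 \<Longrightarrow> f (t \<cdot>\<^sub>v a) = f a"
    "\<And>b. b \<in> unimodular n \<Longrightarrow> sg b \<in> {1, -1}"
    "\<And>b c. b \<in> unimodular n \<Longrightarrow>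
      (\<Sum>a | a \<in> carrier_vec n \<and> a \<bullet> b = c. f a) = sg b * (real r ^ (n - 1) * G (res c))"
    "(\<Sum>a\<in>carrier_vec n. f a) = 0"
proof -
  have oddc: "Parity.odd CARD('f)" using odd by (simp add: card_residue_field)
  obtain phi :: "'a vec \<Rightarrow> 'f alg_closure" where
    phi_in: "\<And>a. a \<in> carrier_vec n \<Longrightarrow> phi a \<in> field_ext n" and
    phi_eq: "\<And>a b. a \<in> carrier_vec n \<Longrightarrow> b \<in> carrier_vec n \<Longrightarrow> phi a = phi b \<longleftrightarrow> cong_vec n a b" and
    phi_surj: "\<And>x. x \<in> field_ext n \<Longrightarrow> \<exists>a\<in>carrier_vec n. phi a = x" and
    phi_smult: "\<And>t a. a \<in> carrier_vec n \<Longrightarrow> phi (t \<cdot>\<^sub>v a) = to_ac (res t) * phi a" and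
    phi_dual: "\<And>b. b \<in> carrier_vec n \<Longrightarrow>
      \<exists>y\<in>field_ext n. \<forall>a\<in>carrier_vec n. field_trace n (y * phi a) = to_ac (res (a \<bullet> b))"
    by (rule obtain_field_coordinates[OF n]) blast
  define f where "f = (\<lambda>a. quad_char n (phi a))"
  define G where "G = (\<lambda>s. \<Sum>x | x \<in> field_ext n \<and> field_trace n x = to_ac s. quad_char n (x :: 'f alg_closure))"
  define Y where "Y = (\<lambda>b. SOME y. y \<in> field_ext n \<and> (\<forall>a\<in>carrier_vec n. field_trace n (y * phi a) = to_ac (res (a \<bullet> b))))"
  have Y: "Y b \<in> field_ext n" "\<And>a. a \<in> carrier_vec n \<Longrightarrow> field_trace n (Y b * phi a) = to_ac (res (a \<bullet> b))"
    if "b \<in> carrier_vec n" for b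
  proof -
    have "\<exists>y. y \<in> field_ext n \<and> (\<forall>a\<in>carrier_vec n. field_trace n (y * phi a) = to_ac (res (a \<bullet> b)))"
      using phi_dual[OF that] by blast
    from someI_ex[OF this] show "Y b \<in> field_ext n"
      "\<And>a. a \<in> carrier_vec n \<Longrightarrow> field_trace n (Y b * phi a) = to_ac (res (a \<bullet> b))"
      unfolding Y_def by blast+
  qed
  have Y0: "Y b \<noteq> 0" if b: "b \<in> unimodular n" for b
  proof
    assume "Y b = 0"
    from b obtain i where i: "i < n" "res (b $ i) \<noteq> 0" by (auto simp: unimodular_iff)
    have "to_ac (res (unit_vec n i \<bullet> b)) = 0"
      using Y(2)[OF unimodular_carrier[OF b], of "unit_vec n i"] \<open>Y b = 0\<close> by simp
    thus False using i unimodular_carrier[OF b] by simp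
  qed
  have phi0: "phi a = 0 \<longleftrightarrow> a \<notin> unimodular n" if a: "a \<in> carrier_vec n" for a
  proof -
    have "phi (0 \<cdot>\<^sub>v a) = 0" using phi_smult[OF a, of 0] by simp
    hence "phi a = 0 \<longleftrightarrow> cong_vec n a (0 \<cdot>\<^sub>v a)" using phi_eq[OF a, of "0 \<cdot>\<^sub>v a"] a by auto
    also have "\<dots> \<longleftrightarrow> a \<notin> unimodular n" using a by (auto simp: cong_vec_def unimodular_iff)
    finally show ?thesis .
  qed
  \<comment> \<open>\<open>f\<close> depends only on residues, so a sum over ring vectors becomes
    one over field elements as soon as each residue that occurs is hit equally often.\<close>
  have group: "(\<Sum>a\<in>S. f a) = real k * (\<Sum>x\<in>phi ` S. quad_char n x)"
    if "finite S" "\<And>a0. a0 \<in> S \<Longrightarrow> card {a \<in> S. phi a = phi a0} = k" for S k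
  proof -
    have "(\<Sum>a\<in>S. f a) = (\<Sum>x\<in>phi ` S. \<Sum>a | a \<in> S \<and> phi a = x. f a)"
      using sum.image_gen[OF that(1), of f phi] by simp
    also have "\<dots> = (\<Sum>x\<in>phi ` S. real k * quad_char n x)"
    proof (intro sum.cong refl)
      fix x assume "x \<in> phi ` S"
      hence "card {a \<in> S. phi a = x} = k" using that(2) by auto
      moreover have "(\<Sum>a | a \<in> S \<and> phi a = x. f a) = (\<Sum>a | a \<in> S \<and> phi a = x. quad_char n x)"
        by (intro sum.cong refl) (auto simp: f_def)
      ultimately show "(\<Sum>a | a \<in> S \<and> phi a = x. f a) = real k * quad_char n x" by simp
    qed
    finally show ?thesis by (simp add: sum_distrib_left)
  qed
  show ?thesis
  proof (rule that[of f "\<lambda>b. quad_char n (Y b)" G])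
    show "f a \<in> {1, -1}" if "a \<in> unimodular n" for a
      using that phi0[OF unimodular_carrier[OF that]] quad_char_abs[of "phi a" n] by (simp add: f_def)
    show "f a = 0" if "a \<in> carrier_vec n" "a \<notin> unimodular n" for a
      using phi0[OF that(1)] that(2) by (simp add: f_def)
    show "f b = f a" if "a \<in> carrier_vec n" "b \<in> carrier_vec n" "cong_vec n a b" for a b
      using phi_eq[OF that(1,2)] that(3) by (simp add: f_def)
    have mult: "f (t \<cdot>\<^sub>v a) = quad_char n (to_ac (res t)) * f a" if "a \<in> carrier_vec n" for t a
      unfolding f_def phi_smult[OF that]
      by (rule quad_char_mult[OF oddc]) (auto intro: field_ext_closed phi_in that)
    show "f (t \<cdot>\<^sub>v a) = res_char t * f a" if "Parity.odd n" "a \<in> carrier_vec n" for t a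
      unfolding mult[OF that(2)] res_char_def using quad_char_to_ac_odd[OF oddc that(1)] by simp
    show "f (t \<cdot>\<^sub>v a) = f a" if "even n" "a \<in> carrier_vec n" "res t \<noteq> 0" for t a
      unfolding mult[OF that(2)] using quad_char_to_ac_even[OF oddc that(1,3)] by simp
    show "quad_char n (Y b) \<in> {1, -1}" if "b \<in> unimodular n" for b
      using Y0[OF that] by (rule quad_char_abs)
    show "(\<Sum>a | a \<in> carrier_vec n \<and> a \<bullet> b = c. f a) = quad_char n (Y b) * (real r ^ (n - 1) * G (res c))"
      if b: "b \<in> unimodular n" for b c
    proof -
      note bc = unimodular_carrier[OF b]
      let ?S = "{a. a \<in> carrier_vec n \<and> a \<bullet> b = c}"
      have lifts: "card {a \<in> carrier_vec n. cong_vec n a0 a \<and> a \<bullet> b = c} = r ^ (n - 1)"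
        if "a0 \<in> carrier_vec n" "res (a0 \<bullet> b) = res c" for a0
        using card_lifts[OF that(1) b that(2)] .
      have "(\<Sum>a\<in>?S. f a) = real (r ^ (n - 1)) * (\<Sum>x\<in>phi ` ?S. quad_char n x)"
      proof (rule group)
        fix a0 assume a0: "a0 \<in> ?S"
        hence "{a \<in> ?S. phi a = phi a0} = {a \<in> carrier_vec n. cong_vec n a0 a \<and> a \<bullet> b = c}"
          using phi_eq cong_vec_sym by blast
        thus "card {a \<in> ?S. phi a = phi a0} = r ^ (n - 1)" using lifts[of a0] a0 by simp
      qed simp
      also have "phi ` ?S = {x. x \<in> field_ext n \<and> field_trace n (Y b * x) = to_ac (res c)}"
      proof (intro equalityI subsetI)
        fix x assume "x \<in> phi ` ?S"
        thus "x \<in> {x. x \<in> field_ext n \<and> field_trace n (Y b * x) = to_ac (res c)}"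
          using phi_in Y(2)[OF bc] by auto
      next
        fix x assume "x \<in> {x. x \<in> field_ext n \<and> field_trace n (Y b * x) = to_ac (res c)}"
        hence x: "x \<in> field_ext n" "field_trace n (Y b * x) = to_ac (res c)" by auto
        then obtain a0 where a0: "a0 \<in> carrier_vec n" "phi a0 = x" using phi_surj by blast
        hence "res (a0 \<bullet> b) = res c" using Y(2)[OF bc a0(1)] x(2) by simp
        \<comment> \<open>A solution over the residue field lifts because the number of its lifts is
          positive.\<close>
        from lifts[OF a0(1) this] have "{a \<in> carrier_vec n. cong_vec n a0 a \<and> a \<bullet> b = c} \<noteq> {}"
          using r_pos by (intro notI) simp
        then obtain a where "a \<in> carrier_vec n" "cong_vec n a0 a" "a \<bullet> b = c" by blast
        thus "x \<in> phi ` ?S" using phi_eq[OF a0(1), of a] a0(2) by auto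
      qed
      also have "(\<Sum>x | x \<in> field_ext n \<and> field_trace n (Y b * x) = to_ac (res c). quad_char n x) =
        quad_char n (Y b) * G (res c)"
        unfolding G_def by (rule sum_quad_char_trace[OF oddc Y(1)[OF bc] Y0[OF b]])
      finally show ?thesis by simp
    qed
    have "(\<Sum>a\<in>carrier_vec n. f a) = real (r ^ n) * (\<Sum>x\<in>phi ` carrier_vec n. quad_char n x)"
    proof (rule group)
      fix a0 :: "'a vec" assume a0: "a0 \<in> carrier_vec n"
      hence "{a \<in> carrier_vec n. phi a = phi a0} = {a \<in> carrier_vec n. cong_vec n a0 a}"
        using phi_eq cong_vec_sym by blast
      thus "card {a \<in> carrier_vec n. phi a = phi a0} = r ^ n" using card_cong_class[OF a0] by simp
    qed simp
    also have "phi ` carrier_vec n = field_ext n" using phi_in phi_surj by blast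
    finally show "(\<Sum>a\<in>carrier_vec n. f a) = 0"
      using sum_quad_char_field_ext[OF oddc n] by simp
  qed
qed

lemma obtain_nonsquare:
  assumes "odd q"
  obtains t where "res t \<noteq> 0" "res_char t = -1"
proof -
  have oddc: "odd CARD('f)" using assms by (simp add: card_residue_field)
  obtain x :: "'f alg_closure" where x: "x \<in> field_ext 1" "x \<noteq> 0" "quad_char 1 x = -1"
    using quad_char_nontrivial[OF oddc, of 1] by auto
  from x(1) obtain s where s: "x = to_ac s" unfolding range_to_ac_eq[symmetric] by blast
  obtain t where "res t = s" by (rule obtain_lift)
  with x s show ?thesis by (intro that[of t]) (auto simp: res_char_def)
qed

text \<open>Scaling by the unit \<open>t\<close> permutes \<open>S\<close> and reverses the sign of
  \<open>f\<close>. This serves for the sums over proportionality classes and for the balance of the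
  cut in even dimension.\<close>

lemma sum_odd_function_eq_0:
  fixes f :: "'a vec \<Rightarrow> real"
  assumes t: "res t \<noteq> 0" and S: "S \<subseteq> unimodular n"
    and closed: "\<And>s a. res s \<noteq> 0 \<Longrightarrow> a \<in> S \<Longrightarrow> s \<cdot>\<^sub>v a \<in> S"
    and odd: "\<And>a. a \<in> S \<Longrightarrow> f (t \<cdot>\<^sub>v a) = - f a"
  shows "(\<Sum>a\<in>S. f a) = 0"
proof -
  obtain u where u: "u * t = 1" using t by (rule obtain_inverse)
  hence "res u * res t = 1" by (metis res_1 res_mult)
  hence ru: "res u \<noteq> 0" by auto
  have "(\<Sum>a\<in>S. f a) = (\<Sum>a\<in>S. f (t \<cdot>\<^sub>v a))"
    by (rule sum.reindex_bij_witness[of _ "\<lambda>a. t \<cdot>\<^sub>v a" "\<lambda>a. u \<cdot>\<^sub>v a"])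
       (use u t ru closed in \<open>auto simp: smult_smult_assoc mult.commute[of t]\<close>)
  also have "\<dots> = (\<Sum>a\<in>S. - f a)" by (intro sum.cong refl odd)
  finally show ?thesis by (simp add: sum_negf)
qed

lemma prop_vec_smult:
  assumes "a' \<in> unimodular n" "res s \<noteq> 0" "prop_vec n a a'"
  shows "prop_vec n a (s \<cdot>\<^sub>v a')"
proof -
  have "prop_vec n a' (s \<cdot>\<^sub>v a')" unfolding prop_vec_def
    using assms unimodular_carrier[OF assms(1)] by (intro exI[of _ "res s"]) (auto simp: res_mult)
  with assms(3) show ?thesis by (rule prop_vec_trans)
qed

lemma sum_unimodular_restrict:
  assumes "\<And>a. a \<in> carrier_vec n \<Longrightarrow> a \<notin> unimodular n \<Longrightarrow> f a = (0 :: real)"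
  shows "(\<Sum>a | a \<in> unimodular n \<and> Q a. f a) = (\<Sum>a :: 'a vec | a \<in> carrier_vec n \<and> Q a. f a)"
  using assms unimodular_carrier by (intro sum.mono_neutral_left) auto

text \<open>The character function attains the spectral bound, so the constant absolute value of its
  neighbourhood sums is the second singular value.\<close>

lemma um_character:
  assumes n: "odd n" and q: "odd q"
  obtains f :: "'a vec \<Rightarrow> real" and sg :: "'a vec \<Rightarrow> real" where
    "\<And>a. a \<in> unimodular n \<Longrightarrow> f a \<in> {1, -1}"
    "\<And>a. a \<in> carrier_vec n \<Longrightarrow> a \<notin> unimodular n \<Longrightarrow> f a = 0"
    "\<And>t a. a \<in> carrier_vec n \<Longrightarrow> f (t \<cdot>\<^sub>v a) = res_char t * f a"
    "\<And>b. b \<in> unimodular n \<Longrightarrow> sg b \<in> {1, -1}"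
    "\<And>b c. b \<in> unimodular n \<Longrightarrow> res c = 1 \<Longrightarrow>
      (\<Sum>a | a \<in> carrier_vec n \<and> a \<bullet> b = c. f a) = sg b * um_lam n"
    "(\<Sum>a\<in>carrier_vec n. f a) = 0"
proof -
  have n0: "n > 0" using n by (simp add: odd_pos)
  obtain f :: "'a vec \<Rightarrow> real" and G :: "'f \<Rightarrow> real" and sg :: "'a vec \<Rightarrow> real" where
    f1: "\<And>a. a \<in> unimodular n \<Longrightarrow> f a \<in> {1, -1}" and
    f0: "\<And>a. a \<in> carrier_vec n \<Longrightarrow> a \<notin> unimodular n \<Longrightarrow> f a = 0" and
    f_cong: "\<And>a b. a \<in> carrier_vec n \<Longrightarrow> b \<in> carrier_vec n \<Longrightarrow> cong_vec n a b \<Longrightarrow> f b = f a" and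
    f_smult: "\<And>t a. odd n \<Longrightarrow> a \<in> carrier_vec n \<Longrightarrow> f (t \<cdot>\<^sub>v a) = res_char t * f a" and
    sg: "\<And>b. b \<in> unimodular n \<Longrightarrow> sg b \<in> {1, -1}" and
    f_sum: "\<And>b c. b \<in> unimodular n \<Longrightarrow>
      (\<Sum>a | a \<in> carrier_vec n \<and> a \<bullet> b = c. f a) = sg b * (real r ^ (n - 1) * G (res c))" and
    f_total: "(\<Sum>a\<in>carrier_vec n. f a) = 0"
    by (rule obtain_character[OF n0 q]) blast
  obtain t where t: "res t \<noteq> 0" "res_char t = -1" using obtain_nonsquare[OF q] by blast
  let ?X = "unimodular n :: 'a vec set"
  have f_sum': "(\<Sum>a | a \<in> ?X \<and> a \<bullet> b = 1. f a) = sg b * (real r ^ (n - 1) * G 1)" if "b \<in> ?X" for b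
    using f_sum[OF that, of 1] sum_unimodular_restrict[of n f] f0 by simp
  have "(real r ^ (n - 1) * G 1)\<^sup>2 = real N ^ (n - 1) * real r ^ (n - 1)"
  proof (rule codegree_decomposition.eigen_const_squared[OF um_codegree_decomposition unimodular_nonempty[OF n0]])
    show "(\<Sum>a\<in>?X. f a) = 0" using f_total sum_unimodular_restrict[of n f "\<lambda>_. True"] f0 by simp
    show "f a' = f a" if "a \<in> ?X" "a' \<in> ?X"
      "of_bool (cong_vec n a a') * real (common n 1 a a') \<noteq> 0" for a a'
      using that by (intro f_cong unimodular_carrier) auto
    \<comment> \<open>Odd dimension enters here: a nonsquare multiple reverses the sign of
      \<open>f\<close>, so the sum over a proportionality class cancels.\<close>
    show "(\<Sum>a' | a' \<in> ?X \<and> prop_class n a = prop_class n a'. f a') = 0" if a: "a \<in> ?X" for a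
    proof (rule sum_odd_function_eq_0[OF t(1), of _ n])
      show "f (t \<cdot>\<^sub>v a') = - f a'" if "a' \<in> {a' \<in> ?X. prop_class n a = prop_class n a'}" for a'
        using that f_smult[OF n unimodular_carrier[of a'], of t] t(2) by simp
      show "s \<cdot>\<^sub>v a' \<in> {a' \<in> ?X. prop_class n a = prop_class n a'}"
        if "res s \<noteq> 0" "a' \<in> {a' \<in> ?X. prop_class n a = prop_class n a'}" for s a'
      proof -
        from that have a': "a' \<in> ?X" "prop_vec n a a'" using prop_class_eq_iff[OF a] by auto
        have "s \<cdot>\<^sub>v a' \<in> ?X" "prop_vec n a (s \<cdot>\<^sub>v a')"
          using smult_unimodular[OF a'(1) that(1)] prop_vec_smult[OF a'(1) that(1) a'(2)] by auto
        thus ?thesis using prop_class_eq_iff[OF a] by blast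
      qed
    qed auto
  qed (use f1 f_sum' sg in auto)
  hence "(real r ^ (n - 1) * G 1)\<^sup>2 = (um_lam n)\<^sup>2" by (simp only: um_lam_squared)
  hence abs: "\<bar>real r ^ (n - 1) * G 1\<bar> = um_lam n"
    using um_lam_pos[of n] by (metis abs_of_pos power2_eq_iff abs_minus_cancel)
  \<comment> \<open>The sign of \<open>G 1\<close> stays undetermined and is absorbed into the sign
    function.\<close>
  obtain s where s: "s \<in> {1, -1}" "real r ^ (n - 1) * G 1 = s * um_lam n"
  proof -
    have "x = 1 * um_lam n \<or> x = -1 * um_lam n" if "\<bar>x\<bar> = um_lam n" for x using that by linarith
    from this[OF abs] show ?thesis using that by blast
  qed
  show ?thesis
  proof (rule that[of f "\<lambda>b. sg b * s"])
    show "sg b * s \<in> {1, -1}" if "b \<in> ?X" for b using sg[OF that] s(1) by auto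
    \<comment> \<open>Only the residue of \<open>c\<close> matters; in even dimension the right-hand
      side will be \<open>1 - s * t\<close> with a nonunit \<open>t\<close>.\<close>
    show "(\<Sum>a | a \<in> carrier_vec n \<and> a \<bullet> b = c. f a) = sg b * s * um_lam n"
      if "b \<in> ?X" "res c = 1" for b c using f_sum[OF that(1), of c] that(2) s(2) by simp
  qed (use f1 f0 f_smult n f_total in auto)
qed

lemma um_iso_le_odd:
  assumes n: "odd n" and q: "odd q"
  shows "iso_const (Um n :: ('a vec + 'a vec) ugraph) \<le> (real N ^ (n - 1) - um_lam n) / 2"
proof -
  have n0: "n > 0" using n by (simp add: odd_pos)
  interpret regular_bipartite "unimodular n :: 'a vec set" "\<lambda>a b. a \<bullet> b = 1" "N ^ (n - 1)"
    by (rule um_regular[OF n0])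
  obtain f :: "'a vec \<Rightarrow> real" and sg :: "'a vec \<Rightarrow> real" where
    f1: "\<And>a. a \<in> unimodular n \<Longrightarrow> f a \<in> {1, -1}" and
    f0: "\<And>a. a \<in> carrier_vec n \<Longrightarrow> a \<notin> unimodular n \<Longrightarrow> f a = 0" and
    sg: "\<And>b. b \<in> unimodular n \<Longrightarrow> sg b \<in> {1, -1}" and
    f_sum: "\<And>b c. b \<in> unimodular n \<Longrightarrow> res c = 1 \<Longrightarrow>
      (\<Sum>a | a \<in> carrier_vec n \<and> a \<bullet> b = c. f a) = sg b * um_lam n" and
    f_total: "(\<Sum>a\<in>carrier_vec n. f a) = 0"
    by (rule um_character[OF n q]) blast
  have "iso_const (Um n :: ('a vec + 'a vec) ugraph) \<le> (real (N ^ (n - 1)) - um_lam n) / 2"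
    unfolding Um_eq
  proof (rule iso_const_le_eigen[where f = f])
    show "(\<Sum>a\<in>unimodular n. f a) = 0" using f_total sum_unimodular_restrict[of n f "\<lambda>_. True"] f0 by simp
    show "\<bar>\<Sum>a | a \<in> unimodular n \<and> a \<bullet> b = 1. f a\<bar> = um_lam n" if b: "b \<in> unimodular n" for b
      using f_sum[OF b, of 1] sum_unimodular_restrict[of n f] f0 sg[OF b] um_lam_pos[of n]
      by (auto simp: abs_mult)
  qed (use f1 um_lam_pos in auto)
  thus ?thesis by simp
qed

section \<open>The upper bound in even dimension\<close>

lemma res_char_cong: "res s = res t \<Longrightarrow> res_char s = res_char t"
  by (simp add: res_char_def)

lemma res_char_mult:
  assumes "odd q"
  shows "res_char (s * t) = res_char s * res_char t"
proof -
  have "odd CARD('f)" using assms by (simp add: card_residue_field)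
  thus ?thesis by (simp add: res_char_def res_mult quad_char_mult field_ext_closed)
qed

lemma res_char_abs: "res t \<noteq> 0 \<Longrightarrow> res_char t \<in> {1, -1}"
  unfolding res_char_def by (rule quad_char_abs) simp

lemma vCons_scalar_prod:
  fixes a b :: "'a vec"
  assumes "a \<in> carrier_vec m" "b \<in> carrier_vec m"
  shows "vCons s a \<bullet> vCons t b = s * t + a \<bullet> b"
  using assms by (simp add: scalar_prod_def sum.atLeast0_lessThan_Suc_shift del: sum.op_ivl_Suc)

lemma vCons_unimodular_iff:
  "vCons s (a :: 'a vec) \<in> unimodular (Suc m) \<longleftrightarrow> a \<in> carrier_vec m \<and> (res s \<noteq> 0 \<or> a \<in> unimodular m)"
  by (auto simp: unimodular_iff Ex_less_Suc2)

lemma carrier_vec_Suc_eq: "carrier_vec (Suc m) = (\<lambda>(s, a). vCons s a) ` (UNIV \<times> carrier_vec m)"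
proof (intro equalityI subsetI)
  fix v :: "'b vec" assume v: "v \<in> carrier_vec (Suc m)"
  show "v \<in> (\<lambda>(s, a). vCons s a) ` (UNIV \<times> carrier_vec m)"
    using v by (cases v) auto
qed auto

lemma inj_vCons: "inj_on (\<lambda>(s, a). vCons s a) A"
  by (auto simp: inj_on_def)

lemma smult_vCons: "t \<cdot>\<^sub>v vCons s (a :: 'a vec) = vCons (t * s) (t \<cdot>\<^sub>v a)"
  by (rule eq_vecI) (auto simp: vec_index_vCons)

text \<open>In even dimension \<open>n = m + 1\<close>, the character function in dimension \<open>m\<close> is extended to the
  vectors that it does not see by the quadratic character of the first entry.\<close>

lemma um_iso_le_even:
  assumes n: "n = Suc m" and m: "odd m" and q: "odd q"
  shows "iso_const (Um n :: ('a vec + 'a vec) ugraph) \<le>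
    real r ^ m * (real q ^ m - real q ^ (m div 2)) / 2"
proof -
  let ?X = "unimodular n :: 'a vec set"
  have n0: "n > 0" using n by simp
  interpret regular_bipartite ?X "\<lambda>a b. a \<bullet> b = 1" "N ^ (n - 1)"
    by (rule um_regular[OF n0])
  obtain h :: "'a vec \<Rightarrow> real" and sg :: "'a vec \<Rightarrow> real" where
    h1: "\<And>a. a \<in> unimodular m \<Longrightarrow> h a \<in> {1, -1}" and
    h0: "\<And>a. a \<in> carrier_vec m \<Longrightarrow> a \<notin> unimodular m \<Longrightarrow> h a = 0" and
    h_smult: "\<And>t a. a \<in> carrier_vec m \<Longrightarrow> h (t \<cdot>\<^sub>v a) = res_char t * h a" and
    sg: "\<And>b. b \<in> unimodular m \<Longrightarrow> sg b \<in> {1, -1}" and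
    h_sum: "\<And>b c. b \<in> unimodular m \<Longrightarrow> res c = 1 \<Longrightarrow>
      (\<Sum>a | a \<in> carrier_vec m \<and> a \<bullet> b = c. h a) = sg b * um_lam m" and
    h_total: "(\<Sum>a\<in>carrier_vec m. h a) = 0"
    by (rule um_character[OF m q]) blast
  obtain t0 where t0: "res t0 \<noteq> 0" "res_char t0 = -1" using obtain_nonsquare[OF q] by blast
  obtain u0 where u0: "u0 * t0 = 1" using t0(1) by (rule obtain_inverse)
  have ru0: "res u0 \<noteq> 0" using u0 by (metis mult_zero_left res_1 res_mult zero_neq_one)
  define tail where "tail = (\<lambda>v :: 'a vec. vec m (\<lambda>i. v $ Suc i))"
  have tail [simp]: "tail (vCons s a) = a" if "a \<in> carrier_vec m" for s and a :: "'a vec"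
    using that unfolding tail_def by (intro eq_vecI) auto
  define f where "f = (\<lambda>v. if tail v \<in> unimodular m then h (tail v) else res_char (v $ 0))"
  have f: "f (vCons s a) = (if a \<in> unimodular m then h a else res_char s)" if "a \<in> carrier_vec m" for s a
    using that by (simp add: f_def)
  have X_cases: thesis if "v \<in> ?X"
      "\<And>s a. v = vCons s a \<Longrightarrow> a \<in> carrier_vec m \<Longrightarrow> res s \<noteq> 0 \<or> a \<in> unimodular m \<Longrightarrow> thesis" for v thesis
  proof -
    have "v \<in> (\<lambda>(s, a). vCons s a) ` (UNIV \<times> carrier_vec m)"
      using unimodular_carrier[OF that(1)] unfolding n carrier_vec_Suc_eq .
    then obtain s a where "v = vCons s a" "a \<in> carrier_vec m" by auto
    with that(1) show thesis by (intro that(2)) (auto simp: n vCons_unimodular_iff)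
  qed
  have f1: "f v \<in> {1, -1}" if "v \<in> ?X" for v
    using that by (rule X_cases) (use h1 res_char_abs f in auto)
  have f_odd: "f (t0 \<cdot>\<^sub>v v) = - f v" if "v \<in> ?X" for v
    using that
  proof (rule X_cases)
    fix s a assume v: "v = vCons s a" and a: "a \<in> carrier_vec m" "res s \<noteq> 0 \<or> a \<in> unimodular m"
    have "t0 \<cdot>\<^sub>v a \<in> unimodular m \<longleftrightarrow> a \<in> unimodular m"
      using a(1) t0(1) by (auto simp: unimodular_iff res_mult)
    thus "f (t0 \<cdot>\<^sub>v v) = - f v"
      using a(1) by (auto simp: v smult_vCons f h_smult t0 res_char_mult[OF q])
  qed
  \<comment> \<open>Unlike in odd dimension, the neighbourhood sums vary in size. The second copy is
    cut by their signs, and only the average of their absolute values has to be estimated.\<close>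
  define w where "w = (\<lambda>b. \<Sum>a | a \<in> ?X \<and> a \<bullet> b = 1. f a)"
  have w_odd: "w (t0 \<cdot>\<^sub>v b) = - w b" if b: "b \<in> ?X" for b
  proof -
    have bc: "b \<in> carrier_vec n" using b by (rule unimodular_carrier)
    have eq: "a \<bullet> (t0 \<cdot>\<^sub>v b) = (t0 \<cdot>\<^sub>v a) \<bullet> b" if "a \<in> ?X" for a
      using unimodular_carrier[OF that] bc by simp
    have "w (t0 \<cdot>\<^sub>v b) = (\<Sum>a | a \<in> ?X \<and> (t0 \<cdot>\<^sub>v a) \<bullet> b = 1. - f (t0 \<cdot>\<^sub>v a))"
      unfolding w_def by (intro sum.cong) (auto simp: eq f_odd)
    also have "\<dots> = (\<Sum>a | a \<in> ?X \<and> a \<bullet> b = 1. - f a)"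
      by (rule sum.reindex_bij_witness[of _ "\<lambda>a. u0 \<cdot>\<^sub>v a" "\<lambda>a. t0 \<cdot>\<^sub>v a"])
         (use u0 t0 ru0 in \<open>auto simp: smult_smult_assoc mult.commute[of t0] intro: smult_unimodular\<close>)
    finally show ?thesis by (simp add: w_def sum_negf)
  qed
  have sum_pairs: "w (vCons t b) = (\<Sum>p | p \<in> UNIV \<times> carrier_vec m \<and> fst p * t + snd p \<bullet> b = 1.
      f (vCons (fst p) (snd p)))" if b: "b \<in> carrier_vec m" for t b
  proof -
    have "{a. a \<in> ?X \<and> a \<bullet> vCons t b = 1} =
       (\<lambda>(s, a). vCons s a) ` {p. p \<in> UNIV \<times> carrier_vec m \<and> fst p * t + snd p \<bullet> b = 1}" (is "?A = ?g ` ?B")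
    proof (intro equalityI subsetI)
      fix v assume v: "v \<in> ?A"
      hence "v \<in> ?X" by simp
      thus "v \<in> ?g ` ?B" by (rule X_cases) (use v b in \<open>auto simp: vCons_scalar_prod\<close>)
    next
      fix v assume "v \<in> ?g ` ?B"
      then obtain s a where v: "v = vCons s a" "a \<in> carrier_vec m" "s * t + a \<bullet> b = 1" by auto
      have vb: "v \<bullet> vCons t b = 1" using v b by (simp add: vCons_scalar_prod)
      have "v \<bullet> vCons t b = vCons t b \<bullet> v"
        using v b by (intro comm_scalar_prod[of _ "Suc m"]) auto
      hence "v \<in> ?X" using v vb by (intro unimodular_of_scalar_prod[of _ _ "vCons t b"]) (auto simp: n)
      thus "v \<in> ?A" using vb by simp
    qed
    hence "w (vCons t b) = sum f (?g ` ?B)" by (simp add: w_def)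
    also have "\<dots> = (\<Sum>p\<in>?B. f (?g p))" by (subst sum.reindex[OF inj_vCons]) simp
    finally show ?thesis by (simp add: case_prod_unfold)
  qed
  \<comment> \<open>For a unit \<open>t\<close> the equation determines the first entry by the tail,
    which then runs over all vectors. The values of \<open>h\<close> cancel, and each of the
    \<open>r ^ m\<close> tails over \<open>\<PP>\<close> contributes the sign
    \<open>res_char u\<close>.\<close>
  have w_unit: "\<bar>w (vCons t b)\<bar> = real r ^ m" if t: "res t \<noteq> 0" and b: "b \<in> carrier_vec m" for t b
  proof -
    obtain u where u: "u * t = 1" using t by (rule obtain_inverse)
    have "res u * res t = 1" using u by (metis res_1 res_mult)
    hence ru: "res u \<noteq> 0" by auto
    have ut: "x * t + y = 1 \<longleftrightarrow> x = u * (1 - y)" for x y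
    proof
      assume "x * t + y = 1"
      hence "u * (1 - y) = u * (x * t)" by (metis add_diff_cancel_right')
      also have "\<dots> = (u * t) * x" by (simp add: mult_ac)
      finally show "x = u * (1 - y)" by (simp add: u)
    next
      assume x: "x = u * (1 - y)"
      have "x * t = (u * t) * (1 - y)" by (simp add: x mult_ac)
      thus "x * t + y = 1" by (simp add: u)
    qed
    have "w (vCons t b) = (\<Sum>a\<in>carrier_vec m. f (vCons (u * (1 - a \<bullet> b)) a))"
      unfolding sum_pairs[OF b]
      by (rule sum.reindex_bij_witness[of _ "\<lambda>a. (u * (1 - a \<bullet> b), a)" snd]) (auto simp: ut)
    also have "\<dots> = (\<Sum>a\<in>carrier_vec m. h a + of_bool (a \<in> vecs_in \<PP> m) * res_char u)"
    proof (intro sum.cong refl)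
      fix a :: "'a vec" assume a: "a \<in> carrier_vec m"
      show "f (vCons (u * (1 - a \<bullet> b)) a) = h a + of_bool (a \<in> vecs_in \<PP> m) * res_char u"
      proof (cases "a \<in> unimodular m")
        case True
        hence "a \<notin> vecs_in \<PP> m" using not_unimodular by blast
        thus ?thesis using True a f by simp
      next
        case False
        hence aP: "a \<in> vecs_in \<PP> m" using a not_unimodular by blast
        have "a \<bullet> b = b \<bullet> a" using a b by (rule comm_scalar_prod)
        hence "res (a \<bullet> b) = 0" using is_ideal_set_scalar_prod[OF is_ideal_set_PP aP] by (simp add: \<PP>_def)
        hence "res_char (u * (1 - a \<bullet> b)) = res_char u" by (intro res_char_cong) (simp add: res_mult res_diff)
        thus ?thesis using False a aP f h0 by simp
      qed
    qed
    also have "\<dots> = (\<Sum>a\<in>carrier_vec m. h a) + (\<Sum>a\<in>carrier_vec m. of_bool (a \<in> vecs_in \<PP> m)) * res_char u"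
      by (simp only: sum.distrib sum_distrib_right)
    also have "(\<Sum>a\<in>carrier_vec m. of_bool (a \<in> vecs_in \<PP> m)) = real (card (vecs_in \<PP> m))"
    proof -
      have "carrier_vec m \<inter> vecs_in \<PP> m = vecs_in \<PP> m" by (auto simp: vecs_in_def)
      thus ?thesis by simp
    qed
    finally have "w (vCons t b) = real r ^ m * res_char u" by (simp add: h_total card_vecs_in r_def)
    thus ?thesis using res_char_abs[OF ru] by (auto simp: abs_mult)
  qed
  \<comment> \<open>For a nonunit \<open>t\<close> the tail satisfies
    \<open>a \<bullet> b = 1 - s * t\<close>, which has residue 1. So the tail is unimodular, and
    each of the \<open>N\<close> first entries repeats the sum from dimension
    \<open>m\<close>.\<close>
  have w_nonunit: "\<bar>w (vCons t b)\<bar> = real N * um_lam m" if t: "res t = 0" and b: "b \<in> unimodular m" for t b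
  proof -
    have bc: "b \<in> carrier_vec m" using b by (rule unimodular_carrier)
    let ?S = "SIGMA s:UNIV. {a. a \<in> carrier_vec m \<and> a \<bullet> b = 1 - s * t}"
    have "w (vCons t b) = (\<Sum>p\<in>?S. h (snd p))"
      unfolding sum_pairs[OF bc]
    proof (rule sum.cong)
      show "{p. p \<in> UNIV \<times> carrier_vec m \<and> fst p * t + snd p \<bullet> b = 1} = ?S"
        by (auto simp: algebra_simps)
      fix p assume "p \<in> ?S"
      then obtain s a where p: "p = (s, a)" "a \<in> carrier_vec m" "a \<bullet> b = 1 - s * t" by auto
      have "b \<bullet> a = a \<bullet> b" using p(2) bc by (metis comm_scalar_prod)
      hence "res (b \<bullet> a) = 1" using p t by (simp add: res_diff res_mult)
      hence "a \<in> unimodular m" using p(2) by (intro unimodular_of_scalar_prod[of _ _ b]) auto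
      thus "f (vCons (fst p) (snd p)) = h (snd p)" using p f by simp
    qed
    also have "\<dots> = (\<Sum>s\<in>UNIV. \<Sum>a | a \<in> carrier_vec m \<and> a \<bullet> b = 1 - s * t. h a)"
      by (subst sum.Sigma) (auto simp: case_prod_unfold)
    also have "\<dots> = (\<Sum>s\<in>(UNIV :: 'a set). sg b * um_lam m)"
      using t by (intro sum.cong refl h_sum[OF b]) (simp add: res_diff res_mult)
    also have "\<dots> = real N * (sg b * um_lam m)" by (simp add: card_ring)
    finally show ?thesis using sg[OF b] um_lam_pos[of m] by (auto simp: abs_mult)
  qed
  have w0: "w v \<noteq> 0" if "v \<in> ?X" for v
    using that
  proof (rule X_cases)
    fix s a assume v: "v = vCons s a" and a: "a \<in> carrier_vec m" "res s \<noteq> 0 \<or> a \<in> unimodular m"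
    have "\<bar>w v\<bar> > 0"
    proof (cases "res s = 0")
      case True
      thus ?thesis using w_nonunit[OF True] a v N_pos um_lam_pos[of m] by simp
    next
      case False
      thus ?thesis using w_unit[OF False a(1)] v r_pos by simp
    qed
    thus "w v \<noteq> 0" by auto
  qed
  have sum_f: "(\<Sum>v\<in>?X. f v) = 0"
    by (rule sum_odd_function_eq_0[OF t0(1), of _ n]) (auto simp: f_odd smult_unimodular)
  have sum_g: "(\<Sum>v\<in>?X. sgn (w v)) = 0"
    by (rule sum_odd_function_eq_0[OF t0(1), of _ n]) (auto simp: w_odd smult_unimodular sgn_minus)
  have form: "biadj_form ?X (\<lambda>a b. a \<bullet> b = 1) f (\<lambda>v. sgn (w v)) = (\<Sum>v\<in>?X. \<bar>w v\<bar>)"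
    by (simp add: biadj_form_def w_def abs_sgn)
  obtain k where k: "m = 2 * k + 1" using m by (rule oddE)
  have lam: "um_lam m = real r ^ (2 * k) * real q ^ k"
  proof (rule power2_eq_imp_eq)
    show "(um_lam m)\<^sup>2 = (real r ^ (2 * k) * real q ^ k)\<^sup>2"
      unfolding um_lam_squared k N_eq by (simp add: power_mult_distrib power2_eq_square mult_2 power_add)
  qed (use um_lam_pos[of m] in auto)
  \<comment> \<open>A unit first entry allows every tail, a nonunit first entry only the unimodular
    ones.\<close>
  have "(\<Sum>v\<in>?X. \<bar>w v\<bar>) = real ((q - 1) * r * N ^ m) * real r ^ m + real (r * card (unimodular m :: 'a vec set)) * (real N * um_lam m)"
  proof -
    let ?A = "{s. res s \<noteq> 0} \<times> (carrier_vec m :: 'a vec set)" and ?B = "\<PP> \<times> (unimodular m :: 'a vec set)"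
    have "?X = (\<lambda>(s, a). vCons s a) ` (?A \<union> ?B)"
    proof (intro equalityI subsetI)
      fix v assume "v \<in> ?X"
      thus "v \<in> (\<lambda>(s, a). vCons s a) ` (?A \<union> ?B)"
        by (rule X_cases) (auto simp: \<PP>_def)
    qed (auto simp: n vCons_unimodular_iff unimodular_carrier)
    hence "(\<Sum>v\<in>?X. \<bar>w v\<bar>) = (\<Sum>v\<in>(\<lambda>(s, a). vCons s a) ` (?A \<union> ?B). \<bar>w v\<bar>)" by (simp only:)
    also have "\<dots> = (\<Sum>p\<in>?A \<union> ?B. \<bar>w (vCons (fst p) (snd p))\<bar>)"
      by (subst sum.reindex[OF inj_vCons]) (simp add: case_prod_unfold)
    also have "\<dots> = (\<Sum>p\<in>?A. \<bar>w (vCons (fst p) (snd p))\<bar>) + (\<Sum>p\<in>?B. \<bar>w (vCons (fst p) (snd p))\<bar>)"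
      by (rule sum.union_disjoint) (auto simp: \<PP>_def)
    also have "(\<Sum>p\<in>?A. \<bar>w (vCons (fst p) (snd p))\<bar>) = (\<Sum>p\<in>?A. real r ^ m)"
      by (intro sum.cong refl w_unit) auto
    also have "(\<Sum>p\<in>?B. \<bar>w (vCons (fst p) (snd p))\<bar>) = (\<Sum>p\<in>?B. real N * um_lam m)"
      by (intro sum.cong refl w_nonunit) (auto simp: \<PP>_def)
    also have "(\<Sum>p\<in>?B. real N * um_lam m) = real (r * card (unimodular m :: 'a vec set)) * (real N * um_lam m)"
      by (simp add: card_cartesian_product r_def)
    also have "(\<Sum>p\<in>?A. real r ^ m) = real ((q - 1) * r * N ^ m) * real r ^ m"
    proof -
      have "{s. res s \<noteq> 0} = UNIV - \<PP>" by (auto simp: \<PP>_def)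
      hence "card {s. res s \<noteq> 0} = q * r - r" by (simp add: card_Diff_subset card_ring_eq r_def)
      moreover have "card (carrier_vec m :: 'a vec set) = N ^ m"
        using card_vecs_in[of "UNIV :: 'a set" m] by (simp add: card_ring)
      ultimately show ?thesis by (simp add: card_cartesian_product diff_mult_distrib)
    qed
    finally show ?thesis .
  qed
  moreover have "real (card (unimodular m :: 'a vec set)) = real r ^ m * (real q ^ m - 1)"
    using card_unimodular[of m]
    by (simp add: N_eq power_mult_distrib algebra_simps flip: of_nat_power of_nat_mult of_nat_add)
  moreover have "real (q - 1) = real q - 1" using q_ge_2 by simp
  ultimately have S: "(\<Sum>v\<in>?X. \<bar>w v\<bar>) =
     real r ^ (2 * m + 1) * ((real q - 1) * real q ^ m + (real q ^ m - 1) * real q ^ Suc k)"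
    unfolding lam by (simp add: N_eq k power_mult_distrib power_add mult_2) (simp add: algebra_simps)
  have X: "real (card ?X) = real r ^ Suc m * (real q ^ Suc m - 1)"
    using card_unimodular[of n]
    by (simp add: N_eq n power_mult_distrib algebra_simps flip: of_nat_power of_nat_mult of_nat_add)
  have q1: "real q > 1" using q_ge_2 by simp
  have qm: "real q ^ Suc m - 1 > 0" using q1 by (simp add: one_less_power del: power_Suc)
  \<comment> \<open>The two sides differ by \<open>(q - 1) * (q ^ m - q ^ k)\<close>; the factor
    \<open>r ^ (2 * m + 1)\<close>, common to the sum and the bound, has been left out.\<close>
  have key: "real q ^ k * (real q ^ Suc m - 1) \<le> (real q - 1) * real q ^ m + (real q ^ m - 1) * real q ^ Suc k"
  proof -
    have "real q ^ k \<le> real q ^ m" using q1 k by (intro power_increasing) auto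
    hence "(real q - 1) * (real q ^ m - real q ^ k) \<ge> 0" using q1 by (intro mult_nonneg_nonneg) auto
    thus ?thesis by (simp add: algebra_simps)
  qed
  have "real r ^ m * real q ^ k \<le> (\<Sum>v\<in>?X. \<bar>w v\<bar>) / real (card ?X)"
  proof (subst pos_le_divide_eq)
    show "real (card ?X) > 0" using card_V_pos by simp
    have "real r ^ m * real q ^ k * real (card ?X) = real r ^ (2 * m + 1) * (real q ^ k * (real q ^ Suc m - 1))"
      unfolding X by (simp add: power_add mult_2)
    also have "\<dots> \<le> (\<Sum>v\<in>?X. \<bar>w v\<bar>)" unfolding S using key by (intro mult_left_mono) auto
    finally show "real r ^ m * real q ^ k * real (card ?X) \<le> (\<Sum>v\<in>?X. \<bar>w v\<bar>)" .
  qed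
  moreover have "iso_const (Um n :: ('a vec + 'a vec) ugraph) \<le>
      (real (N ^ (n - 1)) - (\<Sum>v\<in>?X. \<bar>w v\<bar>) / real (card ?X)) / 2"
    unfolding Um_eq form[symmetric]
    by (rule iso_const_le) (use f1 w0 sum_f sum_g in \<open>auto simp: sgn_if\<close>)
  moreover have "real (N ^ (n - 1)) = real r ^ m * real q ^ m" by (simp add: n N_eq power_mult_distrib)
  moreover have "m div 2 = k" using k by simp
  ultimately show ?thesis by (simp add: algebra_simps)
qed

end

section \<open>The projective graph\<close>

context chain_ring
begin

definition unit_class :: "nat \<Rightarrow> 'a vec \<Rightarrow> 'a vec set" where
  "unit_class n a = unit_rel n `` {a}"

definition proj :: "nat \<Rightarrow> 'a vec set set" where
  "proj n = unimodular n // unit_rel n"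

text \<open>Scaling by units preserves a zero dot product, so one pair of representatives decides
  for all.\<close>

definition proj_adj :: "'a vec set \<Rightarrow> 'a vec set \<Rightarrow> bool" where
  "proj_adj A B \<longleftrightarrow> (\<exists>a\<in>A. \<exists>b\<in>B. a \<bullet> b = 0)"

lemma unit_iff: "(t :: 'a) dvd 1 \<longleftrightarrow> res t \<noteq> 0"
proof
  assume "t dvd 1"
  then obtain s where "1 = t * s" by (elim dvdE)
  hence "res t * res s = 1" by (metis res_1 res_mult)
  thus "res t \<noteq> 0" by auto
next
  assume "res t \<noteq> 0"
  then obtain u where "u * t = 1" by (rule obtain_inverse)
  thus "t dvd 1" by (metis dvd_triv_right)
qed

lemma unit_class_eq:
  assumes "a \<in> unimodular n"
  shows "unit_class n a = (\<lambda>t. t \<cdot>\<^sub>v a) ` {t. res t \<noteq> 0}"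
  using assms smult_unimodular[OF assms] by (auto simp: unit_class_def unit_rel_def unit_iff)

lemma equiv_unit_rel: "equiv (unimodular n :: 'a vec set) (unit_rel n)"
proof (rule equivI)
  show "unit_rel n \<subseteq> unimodular n \<times> (unimodular n :: 'a vec set)" by (auto simp: unit_rel_def)
  show "refl_on (unimodular n :: 'a vec set) (unit_rel n)"
    by (rule refl_onI) (auto simp: unit_rel_def intro!: exI[of _ 1])
  show "sym (unit_rel n :: ('a vec \<times> 'a vec) set)"
  proof (rule symI)
    fix a b :: "'a vec" assume "(a, b) \<in> unit_rel n"
    then obtain t where t: "a \<in> unimodular n" "b \<in> unimodular n" "res t \<noteq> 0" "b = t \<cdot>\<^sub>v a"
      by (auto simp: unit_rel_def unit_iff)
    from t(3) obtain u where u: "u * t = 1" by (rule obtain_inverse)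
    hence "u dvd 1" by (metis dvd_triv_left)
    moreover have "a = u \<cdot>\<^sub>v b" by (simp add: t(4) smult_smult_assoc u)
    ultimately show "(b, a) \<in> unit_rel n" using t by (auto simp: unit_rel_def)
  qed
  show "trans (unit_rel n :: ('a vec \<times> 'a vec) set)"
  proof (rule transI)
    fix a b c :: "'a vec" assume "(a, b) \<in> unit_rel n" "(b, c) \<in> unit_rel n"
    then obtain s t where *: "a \<in> unimodular n" "c \<in> unimodular n" "s dvd 1" "t dvd 1"
      "c = t \<cdot>\<^sub>v (s \<cdot>\<^sub>v a)" by (auto simp: unit_rel_def)
    have "t * s dvd 1" using * by (simp add: unit_iff res_mult)
    moreover have "c = (t * s) \<cdot>\<^sub>v a" by (simp add: * smult_smult_assoc)
    ultimately show "(a, c) \<in> unit_rel n" using * by (auto simp: unit_rel_def)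
  qed
qed

lemma proj_eq: "proj n = unit_class n ` unimodular n"
  by (auto simp: proj_def quotient_def unit_class_def)

lemma finite_proj: "finite (proj n)" by (simp add: proj_eq)

lemma unit_class_eq_iff:
  "a \<in> unimodular n \<Longrightarrow> b \<in> unimodular n \<Longrightarrow> unit_class n a = unit_class n b \<longleftrightarrow> b \<in> unit_class n a"
  using eq_equiv_class_iff[OF equiv_unit_rel, of a n b] by (simp add: unit_class_def)

lemma proj_adj_iff:
  assumes "a \<in> unimodular n" "b \<in> unimodular n"
  shows "proj_adj (unit_class n a) (unit_class n b) \<longleftrightarrow> a \<bullet> b = 0"
proof
  assume "proj_adj (unit_class n a) (unit_class n b)"
  then obtain a' b' where "(a, a') \<in> unit_rel n" "(b, b') \<in> unit_rel n" "a' \<bullet> b' = 0"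
    by (auto simp: proj_adj_def unit_class_def)
  thus "a \<bullet> b = 0" using unit_rel_scalar_prod by blast
next
  have "a \<in> unit_class n a" "b \<in> unit_class n b"
    using assms unit_class_eq_iff by blast+
  thus "a \<bullet> b = 0 \<Longrightarrow> proj_adj (unit_class n a) (unit_class n b)" by (auto simp: proj_adj_def)
qed

lemma Um0_eq: "(Um0 n :: ('a vec set + 'a vec set) ugraph) = bipartite_graph (proj n) proj_adj"
proof -
  have "{{Inl (unit_rel n `` {a}), Inr (unit_rel n `` {b})} | a b.
           a \<in> unimodular n \<and> b \<in> unimodular n \<and> a \<bullet> b = 0} =
     {{Inl A, Inr B} | A B. A \<in> proj n \<and> B \<in> proj n \<and> proj_adj A B}"
    unfolding proj_eq unit_class_def[symmetric] using proj_adj_iff by blast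
  thus ?thesis by (simp add: Um0_def bipartite_graph_def proj_def)
qed

definition num_units :: nat where "num_units = (q - 1) * r"

lemma num_units_pos: "num_units > 0" using q_ge_2 r_pos by (simp add: num_units_def)

lemma card_unit_class:
  assumes a: "a \<in> unimodular n"
  shows "card (unit_class n a) = num_units"
proof -
  from a obtain i where i: "i < n" "res (a $ i) \<noteq> 0" and ac: "a \<in> carrier_vec n"
    by (auto simp: unimodular_iff)
  obtain u where u: "u * a $ i = 1" using i(2) by (rule obtain_inverse)
  have "inj_on (\<lambda>t. t \<cdot>\<^sub>v a) {t. res t \<noteq> 0}"
  proof (rule inj_onI)
    fix s t assume "s \<cdot>\<^sub>v a = t \<cdot>\<^sub>v a"
    hence "(s \<cdot>\<^sub>v a) $ i = (t \<cdot>\<^sub>v a) $ i" by simp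
    hence "s * a $ i = t * a $ i" using i ac by simp
    hence "s * (u * a $ i) = t * (u * a $ i)" by (metis mult.left_commute)
    thus "s = t" by (simp add: u)
  qed
  hence "card (unit_class n a) = card {t. res t \<noteq> 0}"
    unfolding unit_class_eq[OF a] by (rule card_image)
  also have "{t. res t \<noteq> 0} = UNIV - \<PP>" by (auto simp: \<PP>_def)
  also have "card \<dots> = num_units"
    by (simp add: card_Diff_subset card_ring_eq r_def num_units_def diff_mult_distrib)
  finally show ?thesis .
qed

text \<open>Every class has \<open>num_units\<close> elements. This carries sums, and with them
  degrees and spectral bounds, between vectors and classes.\<close>

lemma sum_proj:
  fixes h :: "'a vec set \<Rightarrow> real"
  assumes "S \<subseteq> proj n"
  shows "(\<Sum>a | a \<in> unimodular n \<and> unit_class n a \<in> S. h (unit_class n a)) = real num_units * (\<Sum>A\<in>S. h A)"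
proof -
  let ?X = "{a \<in> unimodular n. unit_class n a \<in> S}"
  have fin: "finite S" using assms finite_proj finite_subset by blast
  have "(\<Sum>a\<in>?X. h (unit_class n a)) = (\<Sum>A\<in>S. \<Sum>a | a \<in> ?X \<and> unit_class n a = A. h (unit_class n a))"
    by (rule sum.group[symmetric]) (use fin in auto)
  also have "\<dots> = (\<Sum>A\<in>S. real num_units * h A)"
  proof (intro sum.cong refl)
    fix A assume A: "A \<in> S"
    then obtain a0 where a0: "a0 \<in> unimodular n" "A = unit_class n a0" using assms by (auto simp: proj_eq)
    have "{a. a \<in> ?X \<and> unit_class n a = A} = A"
    proof (intro equalityI subsetI)
      fix a assume "a \<in> {a. a \<in> ?X \<and> unit_class n a = A}"
      thus "a \<in> A" using unit_class_eq_iff[of a n a] by auto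
    next
      fix a assume "a \<in> A"
      moreover from this have "a \<in> unimodular n" using a0 by (auto simp: unit_class_def unit_rel_def)
      ultimately show "a \<in> {a. a \<in> ?X \<and> unit_class n a = A}"
        using a0 A unit_class_eq_iff[of a0 n a] by auto
    qed
    moreover have "(\<Sum>a | a \<in> ?X \<and> unit_class n a = A. h (unit_class n a)) =
        (\<Sum>a | a \<in> ?X \<and> unit_class n a = A. h A)"
      by (rule sum.cong) auto
    ultimately show "(\<Sum>a | a \<in> ?X \<and> unit_class n a = A. h (unit_class n a)) = real num_units * h A"
      using card_unit_class[OF a0(1)] a0(2) by simp
  qed
  finally show ?thesis by (simp add: sum_distrib_left)
qed

lemma sum_proj_all:
  "(\<Sum>a\<in>unimodular n. h (unit_class n a)) = real num_units * (\<Sum>A\<in>proj n. h A :: real)"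
proof -
  have "{a. a \<in> unimodular n \<and> unit_class n a \<in> proj n} = unimodular n" by (auto simp: proj_eq)
  thus ?thesis using sum_proj[of "proj n" n h] by simp
qed

lemma sum_proj_adj:
  assumes "b \<in> unimodular n"
  shows "(\<Sum>a | a \<in> unimodular n \<and> a \<bullet> b = 0. h (unit_class n a)) =
    real num_units * (\<Sum>A | A \<in> proj n \<and> proj_adj A (unit_class n b). h A :: real)"
proof -
  have "{a. a \<in> unimodular n \<and> unit_class n a \<in> {A. A \<in> proj n \<and> proj_adj A (unit_class n b)}} =
     {a. a \<in> unimodular n \<and> a \<bullet> b = 0}"
    using assms by (auto simp: proj_eq proj_adj_iff)
  thus ?thesis using sum_proj[of "{A. A \<in> proj n \<and> proj_adj A (unit_class n b)}" n h] by auto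
qed

text \<open>This is \<open>(N ^ (n - 1) - r ^ (n - 1)) / num_units\<close> for
  \<open>n \<ge> 2\<close>, with the quotient \<open>(q ^ (n - 1) - 1) / (q - 1)\<close> expanded as
  a geometric sum to stay within the natural numbers.\<close>

definition um0_degree :: "nat \<Rightarrow> nat" where
  "um0_degree n = r ^ (n - 2) * (\<Sum>i<n - 1. q ^ i)"

lemma um0_degree_eq:
  assumes "n \<ge> 2"
  shows "num_units * um0_degree n + r ^ (n - 1) = N ^ (n - 1)"
proof -
  obtain m where m: "n = Suc (Suc m)" using assms by (metis add_2_eq_Suc le_Suc_ex)
  have "q ^ Suc m - 1 = (q - 1) * (\<Sum>i<Suc m. q ^ i)"
    using q_ge_2 by (intro power_minus_one_eq_sum) auto
  moreover have "q ^ Suc m \<ge> 1" using q_ge_2 by (intro one_le_power) auto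
  ultimately have *: "q ^ Suc m = (q - 1) * (\<Sum>i<Suc m. q ^ i) + 1" by linarith
  have "num_units * um0_degree n + r ^ (n - 1) = r ^ Suc m * ((q - 1) * (\<Sum>i<Suc m. q ^ i) + 1)"
    unfolding num_units_def um0_degree_def m by (simp add: algebra_simps del: sum.lessThan_Suc)
  also have "\<dots> = r ^ Suc m * q ^ Suc m" by (simp only: *)
  finally show ?thesis by (simp add: m N_eq power_mult_distrib)
qed

lemma proj_adj_sym: "A \<in> proj n \<Longrightarrow> B \<in> proj n \<Longrightarrow> proj_adj A B \<longleftrightarrow> proj_adj B A"
  by (auto simp: proj_eq proj_adj_iff unimodular_scalar_prod_comm)

lemma um0_regular:
  assumes n: "n \<ge> 2"
  shows "regular_bipartite (proj n) proj_adj (um0_degree n)"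
proof
  have right: "card {A \<in> proj n. proj_adj A B} = um0_degree n" if B: "B \<in> proj n" for B
  proof -
    from B obtain b where b: "b \<in> unimodular n" "B = unit_class n b" by (auto simp: proj_eq)
    have "{a \<in> unimodular n. b \<bullet> a = 0} = {a. a \<in> unimodular n \<and> a \<bullet> b = 0}"
      using b unimodular_scalar_prod_comm by auto
    moreover have "card {a \<in> unimodular n. b \<bullet> a = 0} = num_units * um0_degree n"
      using card_neighbours_zero[OF b(1)] um0_degree_eq[OF n] by simp
    ultimately have "real (num_units * um0_degree n) = real (num_units * card {A \<in> proj n. proj_adj A B})"
      using sum_proj_adj[OF b(1), of "\<lambda>_. 1"] b(2) by simp
    hence "num_units * um0_degree n = num_units * card {A \<in> proj n. proj_adj A B}"
      by (simp only: of_nat_eq_iff)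
    thus ?thesis using num_units_pos by simp
  qed
  show "card {A \<in> proj n. proj_adj A B} = um0_degree n" if "B \<in> proj n" for B
    using right[OF that] .
  show "card {B \<in> proj n. proj_adj A B} = um0_degree n" if A: "A \<in> proj n" for A
  proof -
    have "{B \<in> proj n. proj_adj A B} = {B \<in> proj n. proj_adj B A}" using A proj_adj_sym by auto
    thus ?thesis using right[OF A] by simp
  qed
  show "proj n \<noteq> {}" using unimodular_nonempty[of n] n by (auto simp: proj_eq)
qed (rule finite_proj)

text \<open>The square root of the row sum for vectors, divided by \<open>num_units\<close>, because
  a neighbourhood sum over vectors meets each class that many times.\<close>

definition um0_lam :: "nat \<Rightarrow> real" where
  "um0_lam n = real r ^ (n - 2) * sqrt (real q ^ (n - 2))"

lemma um0_lam_pos: "um0_lam n > 0"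
  using q_ge_2 r_pos by (simp add: um0_lam_def)

lemma um0_lam_squared:
  assumes "n \<ge> 2"
  shows "((real q - 1) * real r ^ (n - 1))\<^sup>2 * real q ^ (n - 2) = (real num_units * um0_lam n)\<^sup>2"
proof -
  obtain m where m: "n = Suc (Suc m)" using assms by (metis add_2_eq_Suc le_Suc_ex)
  have "real (q - Suc 0) = real q - 1" using q_ge_2 by simp
  thus ?thesis unfolding num_units_def um0_lam_def m by (simp add: power_mult_distrib)
qed

text \<open>A function on classes is pulled back to vectors, where the codegree bound holds. The sum
  of the squared neighbourhood sums thereby gains the factor \<open>num_units ^ 3\<close> and the
  squared norm the factor \<open>num_units\<close>, so the constant is divided by
  \<open>num_units ^ 2\<close>.\<close>

lemma um0_iso_ge:
  assumes n: "n \<ge> 2"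
  shows "iso_const (Um0 n :: ('a vec set + 'a vec set) ugraph) \<ge> (real (um0_degree n) - um0_lam n) / 2"
  unfolding Um0_eq
proof (rule regular_bipartite.iso_const_ge[OF um0_regular[OF n] um0_lam_pos])
  have "sqrt (real q ^ (n - 2)) \<le> real q ^ (n - 2)"
  proof -
    have "1 \<le> real q ^ (n - 2)" using q_ge_2 by (intro one_le_power) auto
    hence "sqrt (real q ^ (n - 2)) \<le> sqrt ((real q ^ (n - 2))\<^sup>2)"
      by (intro real_sqrt_le_mono self_le_power) auto
    thus ?thesis by simp
  qed
  also have "real q ^ (n - 2) \<le> (\<Sum>i<n - 1. real q ^ i)"
    using n by (intro member_le_sum) auto
  finally show "um0_lam n \<le> real (um0_degree n)"
    unfolding um0_lam_def um0_degree_def by (auto intro!: mult_left_mono)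
next
  fix f :: "'a vec set \<Rightarrow> real" assume f: "(\<Sum>A\<in>proj n. f A) = 0"
  let ?u = "real num_units" and ?f = "\<lambda>a. f (unit_class n a)"
  have u: "?u > 0" using num_units_pos by simp
  have "(\<Sum>a\<in>unimodular n. ?f a) = 0" using sum_proj_all[of f n] f by simp
  from codegree_decomposition.sum_squares_le[OF um0_codegree_decomposition[OF n] this]
  have "(\<Sum>b\<in>unimodular n. (\<Sum>a | a \<in> unimodular n \<and> a \<bullet> b = 0. ?f a)\<^sup>2) \<le>
     (?u * um0_lam n)\<^sup>2 * (\<Sum>a\<in>unimodular n. (?f a)\<^sup>2)"
    unfolding um0_lam_squared[OF n] .
  also have "(\<Sum>a\<in>unimodular n. (?f a)\<^sup>2) = ?u * (\<Sum>A\<in>proj n. (f A)\<^sup>2)"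
    by (rule sum_proj_all)
  also have "(\<Sum>b\<in>unimodular n. (\<Sum>a | a \<in> unimodular n \<and> a \<bullet> b = 0. ?f a)\<^sup>2) =
     (\<Sum>b\<in>unimodular n. (?u * (\<Sum>A | A \<in> proj n \<and> proj_adj A (unit_class n b). f A))\<^sup>2)"
    by (intro sum.cong refl) (simp add: sum_proj_adj)
  also have "\<dots> = ?u * (\<Sum>B\<in>proj n. (?u * (\<Sum>A | A \<in> proj n \<and> proj_adj A B. f A))\<^sup>2)"
    by (rule sum_proj_all)
  also have "\<dots> = (?u * ?u\<^sup>2) * (\<Sum>B\<in>proj n. (\<Sum>A | A \<in> proj n \<and> proj_adj A B. f A)\<^sup>2)"
    by (simp only: power_mult_distrib sum_distrib_left[symmetric] mult.assoc)
  also have "(?u * um0_lam n)\<^sup>2 * (?u * (\<Sum>A\<in>proj n. (f A)\<^sup>2)) =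
      (?u * ?u\<^sup>2) * ((um0_lam n)\<^sup>2 * (\<Sum>A\<in>proj n. (f A)\<^sup>2))"
    by (simp add: power_mult_distrib mult_ac)
  finally show "(\<Sum>B\<in>proj n. (\<Sum>A | A \<in> proj n \<and> proj_adj A B. f A)\<^sup>2) \<le> (um0_lam n)\<^sup>2 * (\<Sum>A\<in>proj n. (f A)\<^sup>2)"
    by (rule mult_left_le_imp_le) (use u in simp)
qed

text \<open>In even dimension the character is constant on proportional vectors, and only for such
  pairs can \<open>B\<close> be nonzero. With \<open>c0 = 0\<close> this is all that equality in the
  spectral bound requires; invariance under units lets the function descend to classes.\<close>

lemma um0_iso_le_even:
  assumes n: "even n" "n \<ge> 2" and q: "odd q"
  shows "iso_const (Um0 n :: ('a vec set + 'a vec set) ugraph) \<le> (real (um0_degree n) - um0_lam n) / 2"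
proof -
  have n0: "n > 0" using n by simp
  obtain f :: "'a vec \<Rightarrow> real" and G :: "'f \<Rightarrow> real" and sg :: "'a vec \<Rightarrow> real" where
    f1: "\<And>a. a \<in> unimodular n \<Longrightarrow> f a \<in> {1, -1}" and
    f0: "\<And>a. a \<in> carrier_vec n \<Longrightarrow> a \<notin> unimodular n \<Longrightarrow> f a = 0" and
    f_cong: "\<And>a b. a \<in> carrier_vec n \<Longrightarrow> b \<in> carrier_vec n \<Longrightarrow> cong_vec n a b \<Longrightarrow> f b = f a" and
    f_smult: "\<And>t a. even n \<Longrightarrow> a \<in> carrier_vec n \<Longrightarrow> res t \<noteq> 0 \<Longrightarrow> f (t \<cdot>\<^sub>v a) = f a" and
    sg: "\<And>b. b \<in> unimodular n \<Longrightarrow> sg b \<in> {1, -1}" and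
    f_sum: "\<And>b c. b \<in> unimodular n \<Longrightarrow>
      (\<Sum>a | a \<in> carrier_vec n \<and> a \<bullet> b = c. f a) = sg b * (real r ^ (n - 1) * G (res c))" and
    f_total: "(\<Sum>a\<in>carrier_vec n. f a) = 0"
    by (rule obtain_character[OF n0 q]) blast
  let ?X = "unimodular n :: 'a vec set" and ?u = "real num_units"
  have u: "?u > 0" using num_units_pos by simp
  have f_sum': "(\<Sum>a | a \<in> ?X \<and> a \<bullet> b = 0. f a) = sg b * (real r ^ (n - 1) * G 0)" if "b \<in> ?X" for b
    using f_sum[OF that, of 0] sum_unimodular_restrict[of n f] f0 by simp
  have total: "(\<Sum>a\<in>?X. f a) = 0"
    using f_total sum_unimodular_restrict[of n f "\<lambda>_. True"] f0 by simp
  have f_prop: "f a' = f a" if a: "a \<in> ?X" and a': "a' \<in> ?X" and "prop_vec n a a'" for a a'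
  proof -
    from that obtain s where s: "s \<noteq> 0" "\<forall>i<n. res (a' $ i) = s * res (a $ i)" by (auto simp: prop_vec_def)
    obtain t where t: "res t = s" by (rule obtain_lift)
    have "cong_vec n (t \<cdot>\<^sub>v a) a'"
      using unimodular_carrier[OF a] s(2) t by (simp add: cong_vec_def res_mult)
    hence "f a' = f (t \<cdot>\<^sub>v a)"
      using unimodular_carrier[OF a] unimodular_carrier[OF a'] by (intro f_cong) auto
    also have "\<dots> = f a" using s t n unimodular_carrier[OF a] by (intro f_smult) auto
    finally show ?thesis .
  qed
  have "(real r ^ (n - 1) * G 0)\<^sup>2 = ((real q - 1) * real r ^ (n - 1))\<^sup>2 * real q ^ (n - 2)"
  proof (rule codegree_decomposition.eigen_const_squared[OF um0_codegree_decomposition[OF n(2)]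
        unimodular_nonempty[OF n0] _ total])
    fix a a' assume aa: "a \<in> ?X" "a' \<in> ?X" and "of_bool (prop_vec n a a') *
      (real (common n 0 a a') - (real N ^ (n - 2) - real r ^ (n - 2))) \<noteq> 0"
    hence "prop_vec n a a'" by (cases "prop_vec n a a'") auto
    with aa show "f a' = f a" by (rule f_prop)
  qed (use f1 f_sum' sg in auto)
  hence "(real r ^ (n - 1) * G 0)\<^sup>2 = (?u * um0_lam n)\<^sup>2" by (simp only: um0_lam_squared[OF n(2)])
  moreover have "?u * um0_lam n > 0" using u um0_lam_pos by simp
  ultimately have abs: "\<bar>real r ^ (n - 1) * G 0\<bar> = ?u * um0_lam n"
    by (metis abs_of_pos power2_eq_iff abs_minus_cancel)
  define F where "F = (\<lambda>A. f (SOME a. a \<in> A))"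
  have F: "F (unit_class n a) = f a" if a: "a \<in> ?X" for a
  proof -
    have "a \<in> unit_class n a" using unit_class_eq_iff[OF a a] by simp
    hence "(SOME a'. a' \<in> unit_class n a) \<in> unit_class n a" by (rule someI)
    then obtain t where t: "res t \<noteq> 0" "(SOME a'. a' \<in> unit_class n a) = t \<cdot>\<^sub>v a"
      unfolding unit_class_eq[OF a] by blast
    show ?thesis unfolding F_def t(2) using f_smult[OF n(1) unimodular_carrier[OF a] t(1)] .
  qed
  show ?thesis
    unfolding Um0_eq
  proof (rule regular_bipartite.iso_const_le_eigen[OF um0_regular[OF n(2)], where f = F])
    show "F A \<in> {1, -1}" if "A \<in> proj n" for A
    proof -
      from that obtain a where "a \<in> ?X" "A = unit_class n a" by (auto simp: proj_eq)
      thus ?thesis using F f1[of a] by simp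
    qed
    have "?u * (\<Sum>A\<in>proj n. F A) = (\<Sum>a\<in>?X. F (unit_class n a))" by (rule sum_proj_all[symmetric])
    also have "\<dots> = 0" using total F by simp
    finally show "(\<Sum>A\<in>proj n. F A) = 0" using u by simp
    show "\<bar>\<Sum>A | A \<in> proj n \<and> proj_adj A B. F A\<bar> = um0_lam n" if B: "B \<in> proj n" for B
    proof -
      from B obtain b where b: "b \<in> ?X" "B = unit_class n b" by (auto simp: proj_eq)
      have "?u * (\<Sum>A | A \<in> proj n \<and> proj_adj A B. F A) = (\<Sum>a | a \<in> ?X \<and> a \<bullet> b = 0. F (unit_class n a))"
        using sum_proj_adj[OF b(1), of F] b(2) by simp
      also have "\<dots> = (\<Sum>a | a \<in> ?X \<and> a \<bullet> b = 0. f a)" by (intro sum.cong refl) (auto simp: F)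
      also have "\<dots> = sg b * (real r ^ (n - 1) * G 0)" by (rule f_sum'[OF b(1)])
      finally have "\<bar>?u * (\<Sum>A | A \<in> proj n \<and> proj_adj A B. F A)\<bar> = \<bar>sg b\<bar> * \<bar>real r ^ (n - 1) * G 0\<bar>"
        by (simp add: abs_mult)
      also have "\<bar>sg b\<bar> = 1" using sg[OF b(1)] by auto
      finally have "?u * \<bar>\<Sum>A | A \<in> proj n \<and> proj_adj A B. F A\<bar> = ?u * um0_lam n"
        using u unfolding abs by (simp add: abs_mult)
      thus ?thesis using u by simp
    qed
  qed (rule um0_lam_pos)
qed

end

section \<open>Values of the bounds\<close>

context chain_ring
begin

text \<open>By \<open>N = q * r\<close>, the singular value is \<open>N ^ (n - 1)\<close> divided by
  the square root of \<open>q ^ (n - 1)\<close>; the real exponent covers both parities.\<close>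

lemma um_value:
  assumes "n > 0"
  shows "(real N ^ (n - 1) - um_lam n) / 2 =
    1/2 * real q ^ ((n - 1) * l) * (1 - real q powr (- ((real n - 1) / 2)))"
proof -
  have q: "real q > 0" using q_ge_2 by simp
  have "um_lam n = real N ^ (n - 1) * real q powr (- ((real n - 1) / 2))"
  proof (rule power2_eq_imp_eq)
    have "(real q powr (- ((real n - 1) / 2)))\<^sup>2 = real q powr (- real (n - 1))"
      using assms q by (simp add: powr_power of_nat_diff)
    also have "\<dots> = 1 / real q ^ (n - 1)" using q by (simp add: powr_minus_divide powr_realpow)
    finally have *: "(real q powr (- ((real n - 1) / 2)))\<^sup>2 = 1 / real q ^ (n - 1)" .
    have N: "real N ^ (n - 1) = real q ^ (n - 1) * real r ^ (n - 1)" by (simp add: N_eq power_mult_distrib)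
    show "(um_lam n)\<^sup>2 = (real N ^ (n - 1) * real q powr (- ((real n - 1) / 2)))\<^sup>2"
      unfolding um_lam_squared power_mult_distrib * N using q by (simp add: power2_eq_square)
  qed (use um_lam_pos[of n] in auto)
  moreover have "real N ^ (n - 1) = real q ^ ((n - 1) * l)"
    by (simp add: N_def mult.commute flip: power_mult)
  ultimately show ?thesis by (simp add: algebra_simps)
qed

lemma um_value_even:
  assumes n: "n = Suc m" and m: "odd m"
  shows "real r ^ m * (real q ^ m - real q ^ (m div 2)) / 2 =
    1/2 * real q ^ ((n - 1) * l) * (1 - real q powr (- (real n / 2)))"
proof -
  have q: "real q > 0" using q_ge_2 by simp
  obtain k where k: "m = 2 * k + 1" using m by (rule oddE)
  have "real q powr (- (real n / 2)) = real q powr (- real (Suc k))" by (simp add: n k field_simps)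
  also have "\<dots> = 1 / real q ^ Suc k" using q by (simp only: powr_minus_divide powr_realpow)
  finally have *: "real q powr (- (real n / 2)) = 1 / real q ^ Suc k" .
  have "real q ^ m = real q ^ k * real q ^ Suc k" by (simp add: k mult_2 power_add)
  hence "real q ^ m * (1 / real q ^ Suc k) = real q ^ (m div 2)" using q by (simp add: k)
  hence "real q ^ m * (1 - real q powr (- (real n / 2))) = real q ^ m - real q ^ (m div 2)"
    unfolding * by (simp add: right_diff_distrib)
  moreover have "real q ^ ((n - 1) * l) = real r ^ m * real q ^ m"
  proof -
    have "q ^ ((n - 1) * l) = N ^ m" by (simp add: n N_def mult.commute flip: power_mult)
    thus ?thesis by (simp add: N_eq power_mult_distrib flip: of_nat_power)
  qed
  ultimately show ?thesis by simp
qed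

lemma um0_value:
  assumes n: "n \<ge> 2"
  shows "(real (um0_degree n) - um0_lam n) / 2 = 1/2 * real q ^ ((n - 2) * (l - 1))
    * ((real q ^ (n - 1) - 1) / (real q - 1) - real q powr (real n / 2 - 1))"
proof -
  have q: "real q > 1" using q_ge_2 by simp
  have "sqrt (real q ^ (n - 2)) = real q powr (real n / 2 - 1)"
  proof -
    have "sqrt (real q ^ (n - 2)) = (real q powr real (n - 2)) powr (1/2)"
      using q by (simp add: powr_half_sqrt powr_realpow)
    also have "\<dots> = real q powr (real n / 2 - 1)"
      using n by (simp add: powr_powr of_nat_diff field_simps)
    finally show ?thesis .
  qed
  moreover have "(\<Sum>i<n - 1. real q ^ i) = (real q ^ (n - 1) - 1) / (real q - 1)"
    using q by (intro geometric_sum) auto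
  moreover have "real r ^ (n - 2) = real q ^ ((n - 2) * (l - 1))"
    by (simp add: r_eq_power mult.commute flip: power_mult)
  ultimately show ?thesis unfolding um0_degree_def um0_lam_def by (simp add: right_diff_distrib)
qed

end

section \<open>The residue field\<close>

lemma exists_maximal_ideal:
  fixes I :: "'a::{comm_ring_1,finite} set"
  assumes "is_ideal_set I" "1 \<notin> I"
  obtains M where "maximalideal M (ring_of_type_algebra :: 'a ring)" "I \<subseteq> M"
proof -
  let ?R = "ring_of_type_algebra :: 'a ring"
  let ?A = "{J :: 'a set. is_ideal_set J \<and> 1 \<notin> J}"
  have "finite ?A" "I \<in> ?A" using assms by auto
  from finite_has_maximal2[OF this] obtain M where M: "is_ideal_set M" "1 \<notin> M" "I \<subseteq> M"
    and max: "\<And>J. is_ideal_set J \<Longrightarrow> 1 \<notin> J \<Longrightarrow> M \<subseteq> J \<Longrightarrow> M = J" by auto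
  have "maximalideal M ?R"
  proof (rule maximalidealI)
    show "ideal M ?R" using M(1) by (simp add: is_ideal_set_iff)
    show "carrier ?R \<noteq> M" using M(2) by (auto simp: ring_of_type_algebra_def)
    fix J assume J: "ideal J ?R" "M \<subseteq> J" "J \<subseteq> carrier ?R"
    show "J = M \<or> J = carrier ?R"
    proof (cases "1 \<in> J")
      case True
      have "is_ideal_set J" using J(1) by (simp add: is_ideal_set_iff)
      hence "x * 1 \<in> J" for x using True unfolding is_ideal_set_def by blast
      hence "J = UNIV" by auto
      thus ?thesis by (simp add: ring_of_type_algebra_def)
    next
      case False
      thus ?thesis using max[of J] J by (simp add: is_ideal_set_iff)
    qed
  qed
  with M(3) that show ?thesis by blast
qed

text \<open>A quotient type cannot take an ideal as a parameter, so one maximal ideal is chosen for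
  every ring type. In a valuation ring uniqueness identifies it with the ideal of the
  uniformizer.\<close>

definition some_maximal_ideal :: "'a::{comm_ring_1,finite} set" where
  "some_maximal_ideal = (SOME M. maximalideal M (ring_of_type_algebra :: 'a ring))"

lemma maximalideal_some: "maximalideal some_maximal_ideal (ring_of_type_algebra :: 'a::{comm_ring_1,finite} ring)"
proof -
  have "is_ideal_set {0 :: 'a}" "1 \<notin> {0 :: 'a}" by (auto simp: is_ideal_set_def)
  then obtain M where "maximalideal M (ring_of_type_algebra :: 'a ring)" by (rule exists_maximal_ideal)
  thus ?thesis unfolding some_maximal_ideal_def by (rule someI)
qed

lemma maximalideal_is_ideal_set:
  "maximalideal M (ring_of_type_algebra :: 'a::comm_ring_1 ring) \<Longrightarrow> is_ideal_set M"
  by (simp add: is_ideal_set_iff maximalideal.axioms(1))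

lemma maximalideal_one_notin:
  fixes M :: "'a::comm_ring_1 set"
  assumes "maximalideal M ring_of_type_algebra"
  shows "1 \<notin> M"
proof
  assume "1 \<in> M"
  hence "x * 1 \<in> M" for x using maximalideal_is_ideal_set[OF assms] unfolding is_ideal_set_def by blast
  hence "M = UNIV" by auto
  thus False using maximalideal.I_notcarr[OF assms] by (simp add: ring_of_type_algebra_def)
qed

lemma some_maximal_ideal_closed:
  fixes x y :: "'a::{comm_ring_1,finite}"
  shows "0 \<in> (some_maximal_ideal :: 'a set)" "1 \<notin> (some_maximal_ideal :: 'a set)"
    "x \<in> some_maximal_ideal \<Longrightarrow> y \<in> some_maximal_ideal \<Longrightarrow> x + y \<in> some_maximal_ideal"
    "x \<in> some_maximal_ideal \<Longrightarrow> y * x \<in> some_maximal_ideal"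
    "x \<in> some_maximal_ideal \<Longrightarrow> x * y \<in> some_maximal_ideal"
    "x \<in> some_maximal_ideal \<Longrightarrow> - x \<in> some_maximal_ideal"
proof -
  note ideal = maximalideal_is_ideal_set[OF maximalideal_some[where ?'a = 'a]]
  show "0 \<in> (some_maximal_ideal :: 'a set)"
    "x \<in> some_maximal_ideal \<Longrightarrow> y \<in> some_maximal_ideal \<Longrightarrow> x + y \<in> some_maximal_ideal"
    "x \<in> some_maximal_ideal \<Longrightarrow> y * x \<in> some_maximal_ideal"
    "x \<in> some_maximal_ideal \<Longrightarrow> x * y \<in> some_maximal_ideal"
    using ideal by (auto simp: is_ideal_set_def mult.commute[of x])
  show "x \<in> some_maximal_ideal \<Longrightarrow> - x \<in> some_maximal_ideal"
    using ideal is_ideal_set_diff[of some_maximal_ideal 0 x] by (simp add: is_ideal_set_def)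
  show "1 \<notin> (some_maximal_ideal :: 'a set)" by (rule maximalideal_one_notin[OF maximalideal_some])
qed

text \<open>The maximal ideal and \<open>x\<close> together generate a strictly larger ideal, which
  therefore contains 1.\<close>

lemma some_maximal_ideal_inverse:
  fixes x :: "'a::{comm_ring_1,finite}"
  assumes "x \<notin> some_maximal_ideal"
  obtains y where "x * y - 1 \<in> some_maximal_ideal"
proof -
  let ?M = "some_maximal_ideal :: 'a set" and ?R = "ring_of_type_algebra :: 'a ring"
  let ?J = "{m + x * y | m y. m \<in> ?M}"
  have "is_ideal_set ?J"
    unfolding is_ideal_set_def
  proof (intro conjI ballI allI)
    show "0 \<in> ?J" using some_maximal_ideal_closed(1) by (auto intro!: exI[of _ 0])
    fix a assume "a \<in> ?J"
    then obtain m y where a: "a = m + x * y" "m \<in> ?M" by auto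
    show "r * a \<in> ?J" for r
    proof -
      have "r * a = r * m + x * (r * y)" by (simp add: a algebra_simps)
      thus ?thesis using some_maximal_ideal_closed(4)[OF a(2), of r] by blast
    qed
    fix b assume "b \<in> ?J"
    then obtain m' y' where b: "b = m' + x * y'" "m' \<in> ?M" by auto
    have "a + b = (m + m') + x * (y + y')" by (simp add: a b algebra_simps)
    thus "a + b \<in> ?J" using some_maximal_ideal_closed(3)[OF a(2) b(2)] by blast
  qed
  hence "ideal ?J ?R" by (simp add: is_ideal_set_iff)
  moreover have "?M \<subseteq> ?J" by (force intro: exI[of _ 0])
  moreover have "x \<in> ?J" using some_maximal_ideal_closed(1) by (force intro: exI[of _ 1])
  hence "?J \<noteq> ?M" using assms by blast
  moreover have carr: "carrier ?R = UNIV" by (simp add: ring_of_type_algebra_def)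
  ultimately have "?J = carrier ?R"
    using maximalideal.I_maximal[OF maximalideal_some, of ?J] by blast
  hence "1 \<in> ?J" unfolding carr by blast
  then obtain m y where "1 = m + x * y" "m \<in> ?M" by auto
  hence "x * y - 1 = - m" "m \<in> ?M" by (auto simp: algebra_simps)
  thus ?thesis using some_maximal_ideal_closed(6) that by metis
qed

\<comment> \<open>The residue field as a type\<close>
quotient_type (overloaded) 'a residue = "'a::{comm_ring_1,finite}" / "\<lambda>x y. x - y \<in> some_maximal_ideal"
proof (rule equivpI)
  show "reflp (\<lambda>x y :: 'a. x - y \<in> some_maximal_ideal)"
    by (simp add: reflp_def some_maximal_ideal_closed)
  show "symp (\<lambda>x y :: 'a. x - y \<in> some_maximal_ideal)"
  proof (rule sympI)
    fix x y :: 'a assume "x - y \<in> some_maximal_ideal"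
    from some_maximal_ideal_closed(6)[OF this] show "y - x \<in> some_maximal_ideal" by simp
  qed
  show "transp (\<lambda>x y :: 'a. x - y \<in> some_maximal_ideal)"
  proof (rule transpI)
    fix x y z :: 'a assume "x - y \<in> some_maximal_ideal" "y - z \<in> some_maximal_ideal"
    from some_maximal_ideal_closed(3)[OF this] show "x - z \<in> some_maximal_ideal" by simp
  qed
qed

instantiation residue :: ("{comm_ring_1,finite}") field
begin

lift_definition zero_residue :: "'a residue" is 0 .
lift_definition one_residue :: "'a residue" is 1 .

lift_definition plus_residue :: "'a residue \<Rightarrow> 'a residue \<Rightarrow> 'a residue" is "(+)"
proof -
  fix a b c d :: 'a assume "a - b \<in> some_maximal_ideal" "c - d \<in> some_maximal_ideal"
  from some_maximal_ideal_closed(3)[OF this] show "a + c - (b + d) \<in> some_maximal_ideal"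
    by (simp add: algebra_simps)
qed

lift_definition uminus_residue :: "'a residue \<Rightarrow> 'a residue" is uminus
proof -
  fix a b :: 'a assume "a - b \<in> some_maximal_ideal"
  from some_maximal_ideal_closed(6)[OF this] show "- a - - b \<in> some_maximal_ideal"
    by (simp add: algebra_simps)
qed

lift_definition times_residue :: "'a residue \<Rightarrow> 'a residue \<Rightarrow> 'a residue" is "(*)"
proof -
  fix a b c d :: 'a assume *: "a - b \<in> some_maximal_ideal" "c - d \<in> some_maximal_ideal"
  have "(a - b) * c + b * (c - d) \<in> some_maximal_ideal"
    using * by (intro some_maximal_ideal_closed)
  thus "a * c - b * d \<in> some_maximal_ideal" by (simp add: algebra_simps)
qed

definition minus_residue :: "'a residue \<Rightarrow> 'a residue \<Rightarrow> 'a residue" where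
  "minus_residue x y = x + - y"

definition inverse_residue :: "'a residue \<Rightarrow> 'a residue" where
  "inverse_residue x = (if x = 0 then 0 else (SOME y. x * y = 1))"

definition divide_residue :: "'a residue \<Rightarrow> 'a residue \<Rightarrow> 'a residue" where
  "divide_residue x y = x * inverse y"

instance
proof
  have comm: "a * b = b * a" for a b :: "'a residue"
    by transfer (simp add: mult.commute some_maximal_ideal_closed)
  fix a b c :: "'a residue"
  show "a * b * c = a * (b * c)"
    by transfer (simp add: mult.assoc some_maximal_ideal_closed)
  show "a * b = b * a" by (rule comm)
  show "1 * a = a"
    by transfer (simp add: some_maximal_ideal_closed)
  show "a + b + c = a + (b + c)"
    by transfer (simp add: some_maximal_ideal_closed)
  show "a + b = b + a"
    by transfer (simp add: some_maximal_ideal_closed)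
  show "0 + a = a"
    by transfer (simp add: some_maximal_ideal_closed)
  show "- a + a = 0"
    by transfer (simp add: some_maximal_ideal_closed)
  show "a - b = a + - b" by (simp add: minus_residue_def)
  show "(a + b) * c = a * c + b * c"
    by transfer (simp add: some_maximal_ideal_closed algebra_simps)
  show "(0 :: 'a residue) \<noteq> 1"
  proof transfer
    show "\<not> 0 - 1 \<in> (some_maximal_ideal :: 'a set)"
      using some_maximal_ideal_closed(2) some_maximal_ideal_closed(6)[of "- 1 :: 'a"] by auto
  qed
  show "a div b = a * inverse b" by (simp add: divide_residue_def)
  show "inverse (0 :: 'a residue) = 0" by (simp add: inverse_residue_def)
  assume "a \<noteq> 0"
  hence "\<exists>b. a * b = 1"
  proof transfer
    fix a :: 'a assume "\<not> a - 0 \<in> some_maximal_ideal"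
    hence "a \<notin> some_maximal_ideal" by simp
    then obtain y where "a * y - 1 \<in> some_maximal_ideal" by (rule some_maximal_ideal_inverse)
    thus "\<exists>b. a * b - 1 \<in> some_maximal_ideal" ..
  qed
  hence "a * (SOME y. a * y = 1) = 1" by (rule someI_ex)
  hence "(SOME y. a * y = 1) * a = 1" by (subst comm)
  thus "inverse a * a = 1" using \<open>a \<noteq> 0\<close> by (simp add: inverse_residue_def)
qed

end

section \<open>The residue field of the given ring\<close>

lemma abs_residue_eq_iff: "abs_residue x = abs_residue y \<longleftrightarrow> x - y \<in> some_maximal_ideal"
  by (rule residue.abs_eq_iff)

lemma surj_abs_residue: "surj abs_residue"
  by (metis surjI Quotient3_abs_rep Quotient3_residue)

instance residue :: ("{comm_ring_1,finite}") finite_field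
proof (rule finite_fieldI)
  have "finite (range (abs_residue :: 'a \<Rightarrow> _))" by (rule finite_imageI) simp
  thus "finite (UNIV :: 'a residue set)" by (simp add: surj_abs_residue)
qed

lemma genideal_singleton:
  "Idl\<^bsub>ring_of_type_algebra\<^esub> {p} = {x. p dvd (x :: 'a::comm_ring_1)}"
proof -
  let ?R = "ring_of_type_algebra :: 'a ring"
  interpret cring ?R by (rule cring_from_type_algebra)
  have carr: "carrier ?R = UNIV" by (simp add: ring_of_type_algebra_def)
  show ?thesis
  proof (intro equalityI)
    have "ideal {x. p dvd x} ?R" unfolding is_ideal_set_iff[symmetric] by (simp add: is_ideal_set_def)
    thus "Idl\<^bsub>?R\<^esub> {p} \<subseteq> {x. p dvd x}" by (rule genideal_minimal) simp
    have "ideal (Idl\<^bsub>?R\<^esub> {p}) ?R" by (rule genideal_ideal) (simp add: carr)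
    hence "is_ideal_set (Idl\<^bsub>?R\<^esub> {p})" by (simp add: is_ideal_set_iff)
    moreover have "p \<in> Idl\<^bsub>?R\<^esub> {p}" using genideal_self[of "{p}"] by (simp add: carr)
    ultimately have "r * p \<in> Idl\<^bsub>?R\<^esub> {p}" for r unfolding is_ideal_set_def by blast
    thus "{x. p dvd x} \<subseteq> Idl\<^bsub>?R\<^esub> {p}" by (auto simp: dvd_def mult.commute)
  qed
qed

text \<open>Both images are the quotient by the common kernel relation. This matches cosets with
  elements of the type \<open>residue\<close>.\<close>

lemma card_range_eqI:
  assumes "\<And>x y. f x = f y \<longleftrightarrow> g x = g y"
  shows "card (range f) = card (range g)"
proof -
  have "bij_betw (\<lambda>z. g (inv_into UNIV f z)) (range f) (range g)"
  proof (rule bij_betwI[where g = "\<lambda>z. f (inv_into UNIV g z)"])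
    fix z assume "z \<in> range f"
    hence "f (inv_into UNIV f z) = z" by (rule f_inv_into_f)
    moreover have "g (inv_into UNIV g (g (inv_into UNIV f z))) = g (inv_into UNIV f z)" by (intro f_inv_into_f) simp
    ultimately show "f (inv_into UNIV g (g (inv_into UNIV f z))) = z" using assms by metis
  next
    fix z assume "z \<in> range g"
    hence "g (inv_into UNIV g z) = z" by (rule f_inv_into_f)
    moreover have "f (inv_into UNIV f (f (inv_into UNIV g z))) = f (inv_into UNIV g z)" by (intro f_inv_into_f) simp
    ultimately show "g (inv_into UNIV f (f (inv_into UNIV g z))) = z" using assms by metis
  qed auto
  thus ?thesis by (rule bij_betw_same_card)
qed

lemma residue_size_eq:
  fixes p :: "'a::{comm_ring_1,finite}"
  assumes "some_maximal_ideal = {x :: 'a. p dvd x}"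
  shows "residue_size p = card (range (abs_residue :: 'a \<Rightarrow> _))"
proof -
  let ?R = "ring_of_type_algebra :: 'a ring"
  have "carrier (?R Quot Idl\<^bsub>?R\<^esub> {p}) = range (\<lambda>x. {h + x | h. p dvd h})"
    unfolding genideal_singleton FactRing_def A_RCOSETS_def RCOSETS_def r_coset_def
    by (auto simp: ring_of_type_algebra_def)
  moreover have "card (range (\<lambda>x. {h + x | h. p dvd h})) = card (range (abs_residue :: 'a \<Rightarrow> _))"
  proof (rule card_range_eqI)
    fix x y :: 'a
    have "{h + x | h. p dvd h} = {h + y | h. p dvd h} \<longleftrightarrow> p dvd x - y"
    proof
      assume eq: "{h + x | h. p dvd h} = {h + y | h. p dvd h}"
      have "x \<in> {h + x | h. p dvd h}" by (auto intro!: exI[of _ 0])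
      thus "p dvd x - y" unfolding eq by auto
    next
      assume d: "p dvd x - y"
      have "\<exists>h'. h + x = h' + y \<and> p dvd h'" if "p dvd h" for h
        using that d by (intro exI[of _ "h + (x - y)"]) auto
      moreover have "\<exists>h'. h + y = h' + x \<and> p dvd h'" if "p dvd h" for h
        using that d by (intro exI[of _ "h - (x - y)"]) auto
      ultimately show "{h + x | h. p dvd h} = {h + y | h. p dvd h}" by blast
    qed
    thus "{h + x | h. p dvd h} = {h + y | h. p dvd h} \<longleftrightarrow> abs_residue x = abs_residue y"
      unfolding abs_residue_eq_iff assms by simp
  qed
  ultimately show ?thesis by (simp add: residue_size_def)
qed

lemma chain_ring_residue:
  fixes p :: "'a::{comm_ring_1,finite}"
  assumes fvr: "finite_valuation_ring TYPE('a)" and unif: "uniformizer p"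
  shows "chain_ring p abs_residue (nilpotency_degree p)"
    and "some_maximal_ideal = {x. p dvd x}"
proof -
  let ?R = "ring_of_type_algebra :: 'a ring"
  have max: "maximalideal {x. p dvd x} ?R"
    using unif by (simp add: uniformizer_def genideal_singleton)
  have uniq: "M = {x. p dvd x}" if "maximalideal M ?R" for M
    using fvr that max unfolding finite_valuation_ring_def by blast
  show some: "some_maximal_ideal = {x. p dvd x}" by (rule uniq[OF maximalideal_some])
  \<comment> \<open>A nonunit generates a proper ideal, and the maximal ideal above it can only be
    the one generated by \<open>p\<close>.\<close>
  have unit: "\<exists>u. u * x = 1" if "\<not> p dvd x" for x
  proof (rule ccontr)
    assume "\<nexists>u. u * x = 1"
    hence "1 \<notin> {y. x dvd y}" by (auto simp: dvd_def mult.commute)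
    moreover have "is_ideal_set {y. x dvd y}" by (simp add: is_ideal_set_def)
    ultimately obtain M where M: "maximalideal M ?R" "{y. x dvd y} \<subseteq> M"
      using exists_maximal_ideal by blast
    have "x \<in> M" using M(2) by auto
    thus False using that unfolding uniq[OF M(1)] by simp
  qed
  have not1: "\<not> p dvd 1" using maximalideal_one_notin[OF max] by simp
  have "\<exists>k. 0 < k \<and> p ^ k = 0"
  proof -
    have "\<not> inj (\<lambda>k::nat. p ^ k)"
    proof
      assume "inj (\<lambda>k::nat. p ^ k)"
      moreover have "finite (range (\<lambda>k::nat. p ^ k))" by (rule finite_subset[of _ UNIV]) auto
      ultimately have "finite (UNIV :: nat set)" by (rule finite_imageD[rotated])
      thus False by simp
    qed
    \<comment> \<open>Two powers coincide in a finite ring, so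
      \<open>p ^ i * (1 - p ^ (j - i)) = 0\<close>. The second factor is not divisible by
      \<open>p\<close>, hence a unit, and \<open>p ^ i = 0\<close> follows.\<close>
    then obtain i j where ij: "i < j" "p ^ i = p ^ j"
      by (metis injI linorder_neqE_nat)
    have "p dvd p ^ (j - i)" using ij by (simp add: dvd_power)
    hence "\<not> p dvd 1 - p ^ (j - i)"
      using not1 dvd_add[of p "1 - p ^ (j - i)" "p ^ (j - i)"] by auto
    then obtain u where u: "u * (1 - p ^ (j - i)) = 1" using unit by blast
    have "p ^ j = p ^ i * p ^ (j - i)" using ij(1) by (simp flip: power_add)
    hence "p ^ i * (1 - p ^ (j - i)) = 0" using ij(2) by (simp add: right_diff_distrib)
    hence "p ^ i * (u * (1 - p ^ (j - i))) = 0" by (metis mult.left_commute mult_zero_right)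
    hence "p ^ i = 0" using u by simp
    \<comment> \<open>\<open>Suc i\<close> because the exponent has to be positive.\<close>
    thus ?thesis by (intro exI[of _ "Suc i"]) simp
  qed
  hence l: "0 < nilpotency_degree p \<and> p ^ nilpotency_degree p = 0"
    unfolding nilpotency_degree_def by (rule LeastI_ex)
  show "chain_ring p abs_residue (nilpotency_degree p)"
  proof
    fix x y :: 'a
    show "abs_residue (x + y) = abs_residue x + abs_residue y" by (simp add: plus_residue.abs_eq)
    show "abs_residue (x * y) = abs_residue x * abs_residue y" by (simp add: times_residue.abs_eq)
    show "abs_residue (1 :: 'a) = 1" by (simp add: one_residue.abs_eq)
    show "surj (abs_residue :: 'a \<Rightarrow> _)" by (rule surj_abs_residue)
    show "abs_residue x = 0 \<longleftrightarrow> p dvd x"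
      unfolding zero_residue.abs_eq abs_residue_eq_iff by (simp add: some)
    show "p ^ nilpotency_degree p = 0" "nilpotency_degree p > 0" using l by auto
    \<comment> \<open>The minimum ranges over positive exponents only; \<open>k = 0\<close> is
      settled by \<open>p ^ 0 = 1\<close>.\<close>
    show "p ^ k \<noteq> 0" if "k < nilpotency_degree p" for k
      using not_less_Least[OF that[unfolded nilpotency_degree_def]] by (cases "k = 0") auto
  qed
qed

theorem theorem1p9:
  fixes \<pi> :: "'a::{comm_ring_1,finite}" and q l :: nat
  assumes "finite_valuation_ring TYPE('a)"
    and "uniformizer \<pi>"
    and "q = residue_size \<pi>"
    and "odd q"
    and "l = nilpotency_degree \<pi>"
  shows
    "(\<forall>n\<ge>2.
       (odd n \<longrightarrow>
          iso_const (Um n :: ('a vec + 'a vec) ugraph)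
            = 1/2 * real q ^ ((n - 1) * l) * (1 - real q powr (- ((real n - 1) / 2)))) \<and>
       (even n \<longrightarrow>
          1/2 * real q ^ ((n - 1) * l) * (1 - real q powr (- (real n / 2)))
            \<ge> iso_const (Um n :: ('a vec + 'a vec) ugraph) \<and>
          iso_const (Um n :: ('a vec + 'a vec) ugraph)
            \<ge> 1/2 * real q ^ ((n - 1) * l) * (1 - real q powr (- ((real n - 1) / 2))))) \<and>
     (\<forall>n\<ge>3.
       (odd n \<longrightarrow>
          iso_const (Um0 n :: ('a vec set + 'a vec set) ugraph)
            \<ge> 1/2 * real q ^ ((n - 2) * (l - 1))
                * ((real q ^ (n - 1) - 1) / (real q - 1) - real q powr (real n / 2 - 1))) \<and>
       (even n \<longrightarrow>
          iso_const (Um0 n :: ('a vec set + 'a vec set) ugraph)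
            = 1/2 * real q ^ ((n - 2) * (l - 1))
                * ((real q ^ (n - 1) - 1) / (real q - 1) - real q powr (real n / 2 - 1))))"
proof -
  interpret CR: chain_ring \<pi> abs_residue l
    unfolding assms(5) by (rule chain_ring_residue(1)[OF assms(1,2)])
  have q: "q = CR.q"
    unfolding CR.q_def assms(3) by (rule residue_size_eq[OF chain_ring_residue(2)[OF assms(1,2)]])
  hence odd: "odd CR.q" using assms(4) by simp
  show ?thesis
    unfolding q
  proof (intro conjI allI impI, goal_cases)
    case (1 n)
    thus ?case using CR.um_iso_ge[of n] CR.um_iso_le_odd[of n] odd CR.um_value[of n] by simp
  next
    case (2 n)
    then obtain m where m: "n = Suc m" "Parity.odd m" by (cases n) auto
    show ?case using CR.um_iso_le_even[OF m odd] CR.um_value_even[OF m] by simp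
  next
    case (3 n)
    thus ?case using CR.um_iso_ge[of n] CR.um_value[of n] by simp
  next
    case (4 n)
    thus ?case using CR.um0_iso_ge[of n] CR.um0_value[of n] by simp
  next
    case (5 n)
    thus ?case using CR.um0_iso_ge[of n] CR.um0_iso_le_even[of n] odd CR.um0_value[of n] by simp
  qed
qed

end
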